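(* For each $\epsilon>0$ there is a $d_0>0$ such that for every fundamental discriminant $d<0$ with $|d|>d_0$, the Bianchi group $\Gamma_d=\mathrm{PSL}_2(\mathcal{O}_d)$ admits a surjective homomorphism onto a free group of rank $\geq |d|^{\frac{1}{4}-\epsilon}$.
   Context: For a fundamental discriminant $d<0$ (the discriminant of an imaginary quadratic field), $\mathcal{O}_d$ denotes the ring of integers of the field $\mathbb{Q}(\sqrt{d})$, and $\Gamma_d=\mathrm{PSL}_2(\mathcal{O}_d)=\mathrm{SL}_2(\mathcal{O}_d)/\{\pm I\}$ is the corresponding Bianchi group. *)

theory Defs
  imports "HOL-Analysis.Analysis" "HOL-Algebra.Coset"
begin

section \<open>Imaginary quadratic fields as subfields of the complex numbers\<close>

definition quadratic_field :: "int \<Rightarrow> complex set" where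
  "quadratic_field m = {of_rat a + of_rat b * csqrt (of_int m) | a b. True}"

definition ring_of_integers :: "complex set \<Rightarrow> complex set" where
  "ring_of_integers K = {z \<in> K. algebraic_int z}"

definition integral_basis :: "complex set \<Rightarrow> complex \<Rightarrow> complex \<Rightarrow> bool" where
  "integral_basis K w1 w2 \<longleftrightarrow>
     ring_of_integers K = {of_int x * w1 + of_int y * w2 | x y. True} \<and>
     (\<forall>x y :: int. of_int x * w1 + of_int y * w2 = 0 \<longrightarrow> x = 0 \<and> y = 0)"

text \<open>
  An imaginary quadratic field has exactly two embeddings into the complex numbers, the inclusion
  and its composition with complex conjugation. Its discriminant is therefore the square of the
  determinant with rows \<open>(w1, w2)\<close> and \<open>(cnj w1, cnj w2)\<close>, for any integral basis \<open>(w1, w2)\<close>.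
  The integers \<open>m < 0\<close> are not required to be squarefree: every imaginary quadratic field is
  \<open>quadratic_field m\<close> for some such \<open>m\<close>, and every such \<open>m\<close> yields one.
\<close>

definition imaginary_quadratic_field :: "complex set \<Rightarrow> bool" where
  "imaginary_quadratic_field K \<longleftrightarrow> (\<exists>m<0. K = quadratic_field m)"

definition is_discriminant :: "complex set \<Rightarrow> int \<Rightarrow> bool" where
  "is_discriminant K d \<longleftrightarrow>
     (\<exists>w1 w2. integral_basis K w1 w2 \<and> of_int d = (w1 * cnj w2 - w2 * cnj w1)\<^sup>2)"

definition negative_fundamental_discriminant :: "int \<Rightarrow> bool" where
  "negative_fundamental_discriminant d \<longleftrightarrow>
     d < 0 \<and> (\<exists>K. imaginary_quadratic_field K \<and> is_discriminant K d)"

definition quadratic_integers :: "int \<Rightarrow> complex set" where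
  "quadratic_integers d = ring_of_integers (quadratic_field d)"

text \<open>
  The next lemmas show that the algebraic integers of an imaginary quadratic field form a ring.
  They go through the property that all powers of an element have a common denominator.
\<close>

definition quadratic_order :: "int \<Rightarrow> complex set" where
  "quadratic_order m = {of_int x + of_int y * csqrt (of_int m) | x y. True}"

definition bounded_denominators :: "int \<Rightarrow> complex \<Rightarrow> bool" where
  "bounded_denominators m z \<longleftrightarrow> (\<exists>D::int. D > 0 \<and> (\<forall>k. of_int D * z ^ k \<in> quadratic_order m))"

lemma csqrt_sq: "csqrt (of_int m) * csqrt (of_int m) = of_int m"
  by (metis power2_csqrt power2_eq_square)

lemma quadratic_order_add: "u \<in> quadratic_order m \<Longrightarrow> v \<in> quadratic_order m \<Longrightarrow> u + v \<in> quadratic_order m"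
proof -
  assume "u \<in> quadratic_order m" "v \<in> quadratic_order m"
  then obtain a b c d where "u = of_int a + of_int b * csqrt (of_int m)" "v = of_int c + of_int d * csqrt (of_int m)"
    unfolding quadratic_order_def by blast
  then have "u + v = of_int (a + c) + of_int (b + d) * csqrt (of_int m)"
    by (simp add: algebra_simps)
  then show ?thesis unfolding quadratic_order_def by blast
qed

lemma quadratic_order_mult: "u \<in> quadratic_order m \<Longrightarrow> v \<in> quadratic_order m \<Longrightarrow> u * v \<in> quadratic_order m"
proof -
  assume "u \<in> quadratic_order m" "v \<in> quadratic_order m"
  then obtain a b c d where e: "u = of_int a + of_int b * csqrt (of_int m)" "v = of_int c + of_int d * csqrt (of_int m)"
    unfolding quadratic_order_def by blast
  have "u * v = of_int a * of_int c + of_int b * of_int d * (csqrt (of_int m) * csqrt (of_int m))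
      + (of_int a * of_int d + of_int b * of_int c) * csqrt (of_int m)"
    unfolding e by (simp add: algebra_simps)
  also have "\<dots> = of_int (a * c + b * d * m) + of_int (a * d + b * c) * csqrt (of_int m)"
    by (simp add: csqrt_sq)
  finally show ?thesis unfolding quadratic_order_def by blast
qed

lemma quadratic_order_of_int: "of_int a \<in> quadratic_order m"
proof -
  have "(of_int a :: complex) = of_int a + of_int 0 * csqrt (of_int m)" by simp
  then show ?thesis unfolding quadratic_order_def by blast
qed

lemma quadratic_order_power: "u \<in> quadratic_order m \<Longrightarrow> u ^ k \<in> quadratic_order m"
  using quadratic_order_of_int[of 1] by (induction k) (auto intro: quadratic_order_mult)

lemma quadratic_order_sum: "(\<And>i. i \<in> A \<Longrightarrow> f i \<in> quadratic_order m) \<Longrightarrow> sum f A \<in> quadratic_order m"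
  using quadratic_order_of_int[of 0]
  by (induction A rule: infinite_finite_induct) (auto intro: quadratic_order_add)

lemma quadratic_field_denominator:
  assumes "z \<in> quadratic_field m"
  shows "\<exists>e::int. e > 0 \<and> of_int e * z \<in> quadratic_order m"
proof -
  obtain a b where z: "z = of_rat a + of_rat b * csqrt (of_int m)"
    using assms unfolding quadratic_field_def by blast
  obtain p q where a: "a = Fract p q" "q > 0" by (cases a) auto
  obtain r t where b: "b = Fract r t" "t > 0" by (cases b) auto
  have "of_int (q * t) * z = of_int (p * t) + of_int (r * q) * csqrt (of_int m)"
    using a(2) b(2) unfolding z a(1) b(1) by (simp add: of_rat_rat field_simps)
  then have "of_int (q * t) * z \<in> quadratic_order m" unfolding quadratic_order_def by blast
  then show ?thesis using a(2) b(2) by (intro exI[of _ "q * t"]) simp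
qed

lemma algebraic_int_bounded_denominators:
  assumes "z \<in> quadratic_field m" "algebraic_int z"
  shows "bounded_denominators m z"
proof -
  obtain p where p: "lead_coeff p = 1" "\<And>i. coeff p i \<in> \<int>" "poly p z = 0"
    using assms(2) by (auto elim: algebraic_int.cases)
  obtain e :: int where e: "e > 0" "of_int e * z \<in> quadratic_order m"
    using quadratic_field_denominator[OF assms(1)] by blast
  define n where "n = degree p"
  have "of_int (e ^ n) * z ^ k \<in> quadratic_order m" for k
  proof (induction k rule: less_induct)
    case (less k)
    show ?case
    proof (cases "k < n")
      case True
      then have "of_int (e ^ n) * z ^ k = of_int (e ^ (n - k)) * (of_int e * z) ^ k"
        by (simp add: power_mult_distrib flip: power_add)
      then show ?thesis
        by (simp only:) (intro quadratic_order_mult quadratic_order_of_int quadratic_order_power e)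
    next
      case False
      have "0 = z ^ n + (\<Sum>i<n. coeff p i * z ^ i)"
        using p(1,3) unfolding poly_altdef n_def lessThan_Suc_atMost [symmetric]
        by (simp add: add.commute)
      then have "z ^ n = (\<Sum>i<n. - coeff p i * z ^ i)"
        by (simp add: sum_negf eq_neg_iff_add_eq_0)
      then have "of_int (e ^ n) * z ^ k = of_int (e ^ n) * z ^ (k - n) * (\<Sum>i<n. - coeff p i * z ^ i)"
        using False by (metis (no_types, lifting) le_add_diff_inverse2 linorder_not_less mult.assoc power_add)
      also have "\<dots> = (\<Sum>i<n. - coeff p i * (of_int (e ^ n) * z ^ (k - n + i)))"
        by (simp add: sum_distrib_left power_add mult_ac)
      also have "\<dots> \<in> quadratic_order m"
      proof (rule quadratic_order_sum)
        fix i assume "i \<in> {..<n}"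
        then have "of_int (e ^ n) * z ^ (k - n + i) \<in> quadratic_order m"
          using False by (intro less.IH) auto
        moreover have "- coeff p i \<in> quadratic_order m"
          using Ints_minus[OF p(2)[of i]] by (metis Ints_cases quadratic_order_of_int)
        ultimately show "- coeff p i * (of_int (e ^ n) * z ^ (k - n + i)) \<in> quadratic_order m"
          using quadratic_order_mult by blast
      qed
      finally show ?thesis .
    qed
  qed
  then show ?thesis
    using e(1) unfolding bounded_denominators_def by (intro exI[of _ "e ^ n"]) simp
qed

lemma bounded_denominators_mult:
  assumes "bounded_denominators m z" "bounded_denominators m w"
  shows "bounded_denominators m (z * w)"
proof -
  obtain D E :: int where DE: "D > 0" "E > 0"
    "\<And>k. of_int D * z ^ k \<in> quadratic_order m" "\<And>k. of_int E * w ^ k \<in> quadratic_order m"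
    using assms unfolding bounded_denominators_def by auto
  have "of_int (D * E) * (z * w) ^ k = (of_int D * z ^ k) * (of_int E * w ^ k)" for k
    by (simp add: power_mult_distrib mult_ac)
  then have "of_int (D * E) * (z * w) ^ k \<in> quadratic_order m" for k
    using DE(3,4)[of k] quadratic_order_mult by metis
  then show ?thesis
    using DE(1,2) unfolding bounded_denominators_def by (intro exI[of _ "D * E"]) simp
qed

lemma bounded_denominators_add:
  assumes "bounded_denominators m z" "bounded_denominators m w"
  shows "bounded_denominators m (z + w)"
proof -
  obtain D E :: int where DE: "D > 0" "E > 0"
    "\<And>k. of_int D * z ^ k \<in> quadratic_order m" "\<And>k. of_int E * w ^ k \<in> quadratic_order m"
    using assms unfolding bounded_denominators_def by auto
  have "of_int (D * E) * (z + w) ^ k =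
      (\<Sum>i\<le>k. of_int (int (k choose i)) * ((of_int D * z ^ i) * (of_int E * w ^ (k - i))))" for k
    by (simp add: binomial_ring sum_distrib_left mult_ac)
  then have "of_int (D * E) * (z + w) ^ k \<in> quadratic_order m" for k
    by (simp only:)
      (intro quadratic_order_sum quadratic_order_mult quadratic_order_of_int DE(3,4))
  then show ?thesis
    using DE(1,2) unfolding bounded_denominators_def by (intro exI[of _ "D * E"]) simp
qed

lemma bounded_denominators_of_int: "bounded_denominators m (of_int a)"
  unfolding bounded_denominators_def
  using quadratic_order_power[OF quadratic_order_of_int] by (intro exI[of _ 1]) simp

lemma int_of_bounded_powers:
  assumes "D > 0" "\<And>k. of_int D * r ^ k \<in> (\<int> :: rat set)"
  shows "r \<in> \<int>"
proof -
  obtain p q where r: "r = Fract p q" "q > 0" "coprime p q" by (cases r) auto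
  have "q ^ k dvd D" for k
  proof -
    obtain c where "of_int D * r ^ k = of_int c" using assms(2)[of k] by (auto elim: Ints_cases)
    then have "of_int (D * p ^ k) = (of_int (c * q ^ k) :: rat)"
      using r(2) unfolding r(1) Fract_of_int_quotient by (simp add: field_simps)
    then have "D * p ^ k = c * q ^ k" by (simp only: of_int_eq_iff)
    then have "q ^ k dvd D * p ^ k" by simp
    moreover have "coprime (q ^ k) (p ^ k)" using r(3) by (simp add: coprime_commute)
    ultimately show ?thesis by (simp add: coprime_dvd_mult_left_iff)
  qed
  then have le: "q ^ k \<le> D" for k using assms(1) by (auto intro: zdvd_imp_le)
  have "q = 1"
  proof (rule ccontr)
    assume "q \<noteq> 1"
    then have "2 ^ nat D \<le> q ^ nat D" using r(2) by (intro power_mono) auto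
    then have "(2::int) ^ nat D \<le> D" using le order_trans by blast
    moreover have "nat D < 2 ^ nat D" by (rule less_exp)
    then have "int (nat D) < int (2 ^ nat D)" by (simp only: of_nat_less_iff)
    ultimately show False using assms(1) by simp
  qed
  then show ?thesis using r(1) by (simp add: Fract_of_int_quotient)
qed

lemma quadratic_field_add: "u \<in> quadratic_field m \<Longrightarrow> v \<in> quadratic_field m \<Longrightarrow> u + v \<in> quadratic_field m"
proof -
  assume "u \<in> quadratic_field m" "v \<in> quadratic_field m"
  then obtain a b c d where "u = of_rat a + of_rat b * csqrt (of_int m)" "v = of_rat c + of_rat d * csqrt (of_int m)"
    unfolding quadratic_field_def by blast
  then have "u + v = of_rat (a + c) + of_rat (b + d) * csqrt (of_int m)"
    by (simp add: algebra_simps of_rat_add)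
  then show ?thesis unfolding quadratic_field_def by blast
qed

lemma quadratic_field_mult: "u \<in> quadratic_field m \<Longrightarrow> v \<in> quadratic_field m \<Longrightarrow> u * v \<in> quadratic_field m"
proof -
  assume "u \<in> quadratic_field m" "v \<in> quadratic_field m"
  then obtain a b c d where e: "u = of_rat a + of_rat b * csqrt (of_int m)" "v = of_rat c + of_rat d * csqrt (of_int m)"
    unfolding quadratic_field_def by blast
  have "u * v = of_rat a * of_rat c + of_rat b * of_rat d * (csqrt (of_int m) * csqrt (of_int m))
      + (of_rat a * of_rat d + of_rat b * of_rat c) * csqrt (of_int m)"
    unfolding e by (simp add: algebra_simps)
  also have "\<dots> = of_rat (a * c + b * d * of_int m) + of_rat (a * d + b * c) * csqrt (of_int m)"
    by (simp add: csqrt_sq of_rat_add of_rat_mult)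
  finally show ?thesis unfolding quadratic_field_def by blast
qed

lemma quadratic_field_of_int: "of_int a \<in> quadratic_field m"
proof -
  have "(of_int a :: complex) = of_rat (of_int a) + of_rat 0 * csqrt (of_int m)" by simp
  then show ?thesis unfolding quadratic_field_def by blast
qed

lemma norm_csqrt_form:
  assumes "m < 0" "Im x = 0" "Im y = 0"
  shows "(x + y * csqrt (of_int m)) * cnj (x + y * csqrt (of_int m)) = x\<^sup>2 - y\<^sup>2 * of_int m"
proof -
  have s: "cnj (csqrt (of_int m)) = - csqrt (of_int m)"
    using assms(1) by (simp add: complex_eq_iff)
  have xy: "cnj x = x" "cnj y = y" using assms by (simp_all add: complex_eq_iff)
  have "(x + y * csqrt (of_int m)) * cnj (x + y * csqrt (of_int m)) =
      x * x - y * y * (csqrt (of_int m) * csqrt (of_int m))"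
    by (simp add: s xy algebra_simps)
  then show ?thesis by (simp add: csqrt_sq power2_eq_square)
qed

lemma Im_of_rat [simp]: "Im (of_rat a) = 0"
  by (cases a) (simp add: of_rat_rat)

lemma bounded_denominators_norm:
  assumes "m < 0" "z \<in> quadratic_field m" "bounded_denominators m z"
  shows "z * cnj z \<in> \<int>"
proof -
  obtain a b where z: "z = of_rat a + of_rat b * csqrt (of_int m)"
    using assms(2) unfolding quadratic_field_def by blast
  define r where "r = a\<^sup>2 - b\<^sup>2 * of_int m"
  have r: "z * cnj z = of_rat r"
    unfolding z r_def using assms(1)
    by (subst norm_csqrt_form) (simp_all add: of_rat_diff of_rat_mult of_rat_power)
  obtain D :: int where D: "D > 0" "\<And>k. of_int D * z ^ k \<in> quadratic_order m"
    using assms(3) unfolding bounded_denominators_def by auto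
  have "of_int (D\<^sup>2) * r ^ k \<in> \<int>" for k
  proof -
    obtain x y where xy: "of_int D * z ^ k = of_int x + of_int y * csqrt (of_int m)"
      using D(2)[of k] unfolding quadratic_order_def by blast
    have "of_rat (of_int (D\<^sup>2) * r ^ k) = of_int D * of_int D * (z * cnj z) ^ k"
      unfolding r by (simp add: of_rat_mult of_rat_power power2_eq_square)
    also have "\<dots> = (of_int D * z ^ k) * cnj (of_int D * z ^ k)"
      by (simp only: complex_cnj_mult complex_cnj_power complex_cnj_of_int power_mult_distrib mult_ac)
    also have "\<dots> = of_int (x\<^sup>2 - y\<^sup>2 * m)"
      unfolding xy using assms(1) by (subst norm_csqrt_form) simp_all
    also have "\<dots> = (of_rat (of_int (x\<^sup>2 - y\<^sup>2 * m)) :: complex)" by (simp only: of_rat_of_int_eq)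
    finally have "of_int (D\<^sup>2) * r ^ k = of_int (x\<^sup>2 - y\<^sup>2 * m)" by (simp only: of_rat_eq_iff)
    then show ?thesis by (simp only: Ints_of_int)
  qed
  moreover have "D\<^sup>2 > 0" using D(1) by simp
  ultimately have "r \<in> \<int>" by (rule int_of_bounded_powers [rotated])
  then obtain c where "r = of_int c" by (rule Ints_cases)
  then show ?thesis unfolding r by simp
qed

lemma bounded_denominators_algebraic_int:
  assumes "m < 0" "z \<in> quadratic_field m" "bounded_denominators m z"
  shows "algebraic_int z"
proof -
  have "(z + 1) * cnj (z + 1) \<in> \<int>"
    using quadratic_field_add[OF assms(2) quadratic_field_of_int[of 1]]
      bounded_denominators_add[OF assms(3) bounded_denominators_of_int[of m 1]]
    by (intro bounded_denominators_norm[OF assms(1)]) (simp_all only: of_int_1)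
  moreover have n: "z * cnj z \<in> \<int>" using assms by (rule bounded_denominators_norm)
  ultimately have "(z + 1) * cnj (z + 1) - z * cnj z - 1 \<in> \<int>" by (intro Ints_diff) auto
  also have "(z + 1) * cnj (z + 1) - z * cnj z - 1 = z + cnj z" by (simp add: algebra_simps)
  finally have t: "z + cnj z \<in> \<int>" .
  define p where "p = [: z * cnj z, - (z + cnj z), 1 :]"
  have "coeff p i \<in> \<int>" for i
    using n Ints_minus[OF t] by (auto simp: p_def coeff_pCons split: nat.splits)
  moreover have "z * c + z * (- (z + c) + z) = 0" for c :: complex
    by (simp only: distrib_left minus_add_distrib mult_minus_right) simp
  then have "poly p z = 0"
    by (simp only: p_def poly_pCons poly_0 mult_zero_right add_0_right mult_1_right)
  moreover have "lead_coeff p = 1"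
    by (simp add: p_def)
  ultimately show ?thesis
    by (intro algebraic_int.intros[of p] allI)
qed

lemma quadratic_integers_iff:
  assumes "d < 0"
  shows "z \<in> quadratic_integers d \<longleftrightarrow> z \<in> quadratic_field d \<and> bounded_denominators d z"
  unfolding quadratic_integers_def ring_of_integers_def
  using algebraic_int_bounded_denominators bounded_denominators_algebraic_int[OF assms] by blast

lemma quadratic_integers_add:
  "d < 0 \<Longrightarrow> u \<in> quadratic_integers d \<Longrightarrow> v \<in> quadratic_integers d \<Longrightarrow> u + v \<in> quadratic_integers d"
  by (simp add: quadratic_integers_iff quadratic_field_add bounded_denominators_add)

lemma quadratic_integers_mult:
  "d < 0 \<Longrightarrow> u \<in> quadratic_integers d \<Longrightarrow> v \<in> quadratic_integers d \<Longrightarrow> u * v \<in> quadratic_integers d"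
  by (simp add: quadratic_integers_iff quadratic_field_mult bounded_denominators_mult)

lemma quadratic_integers_of_int: "d < 0 \<Longrightarrow> of_int a \<in> quadratic_integers d"
  by (simp add: quadratic_integers_iff quadratic_field_of_int bounded_denominators_of_int)


section \<open>Bianchi groups\<close>

definition SL2 :: "complex set \<Rightarrow> (complex^2^2) monoid" where
  "SL2 R = \<lparr>carrier = {A. (\<forall>i j. A $ i $ j \<in> R) \<and> det A = 1}, mult = (**), one = mat 1\<rparr>"

definition PSL2 :: "complex set \<Rightarrow> (complex^2^2) set monoid" where
  "PSL2 R = SL2 R Mod {mat 1, - mat 1}"

definition Bianchi_group :: "int \<Rightarrow> (complex^2^2) set monoid" where
  "Bianchi_group d = PSL2 (quadratic_integers d)"

lemma SL2_inverse:
  fixes A :: "complex^2^2"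
  assumes "det A = 1"
  defines "B \<equiv> (\<chi> i j. if i = j then A $ (if i = 1 then 2 else 1) $ (if i = 1 then 2 else 1) else - A $ i $ j)"
  shows "B ** A = mat 1" "det B = 1"
  using assms(1) unfolding B_def
  by (auto simp: det_2 vec_eq_iff matrix_matrix_mult_def mat_def sum_2 forall_2 algebra_simps)

lemma minus_matrix_mult: "- A ** B = - (A ** B :: complex^2^2)" "A ** - B = - (A ** B :: complex^2^2)"
  by (simp_all add: vec_eq_iff matrix_matrix_mult_def sum_negf)

lemma group_SL2:
  assumes "0 \<in> R" "1 \<in> R"
    and add: "\<And>u v. u \<in> R \<Longrightarrow> v \<in> R \<Longrightarrow> u + v \<in> R"
    and mult: "\<And>u v. u \<in> R \<Longrightarrow> v \<in> R \<Longrightarrow> u * v \<in> R"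
    and neg: "\<And>u. u \<in> R \<Longrightarrow> - u \<in> R"
  shows "group (SL2 R)"
proof (rule groupI)
  fix A assume A: "A \<in> carrier (SL2 R)"
  define B :: "complex^2^2" where
    "B = (\<chi> i j. if i = j then A $ (if i = 1 then 2 else 1) $ (if i = 1 then 2 else 1) else - A $ i $ j)"
  have "B ** A = mat 1" "det B = 1" "\<And>i j. B $ i $ j \<in> R"
    using A SL2_inverse[of A] neg unfolding B_def SL2_def by auto
  then show "\<exists>B\<in>carrier (SL2 R). B \<otimes>\<^bsub>SL2 R\<^esub> A = \<one>\<^bsub>SL2 R\<^esub>"
    by (intro bexI[of _ B]) (auto simp: SL2_def)
next
  fix A B assume "A \<in> carrier (SL2 R)" "B \<in> carrier (SL2 R)"
  then show "A \<otimes>\<^bsub>SL2 R\<^esub> B \<in> carrier (SL2 R)"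
    using det_mul[of A B] by (auto simp: SL2_def) (auto simp: matrix_matrix_mult_def sum_2 intro!: add mult)
next
  show "\<one>\<^bsub>SL2 R\<^esub> \<in> carrier (SL2 R)"
    using assms(1,2) by (simp add: SL2_def) (simp add: mat_def)
qed (auto simp: SL2_def matrix_mul_assoc)

lemma normal_center_SL2:
  assumes G: "group (SL2 R)" and "0 \<in> R" "1 \<in> R" "- 1 \<in> R"
  shows "{mat 1, - mat 1} \<lhd> SL2 R"
proof -
  interpret group "SL2 R" by fact
  have sub: "{mat 1, - mat 1} \<subseteq> carrier (SL2 R)"
    using assms by (auto simp: SL2_def mat_def det_2)
  have one: "\<one>\<^bsub>SL2 R\<^esub> = mat 1" and mul: "A \<otimes>\<^bsub>SL2 R\<^esub> B = A ** B" for A B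
    by (simp_all add: SL2_def)
  have "- mat 1 \<otimes>\<^bsub>SL2 R\<^esub> - mat 1 = \<one>\<^bsub>SL2 R\<^esub>"
    by (simp add: one mul minus_matrix_mult)
  then have inv: "inv\<^bsub>SL2 R\<^esub> (- mat 1) = - mat 1"
    using sub by (intro inv_equality) auto
  have "subgroup {mat 1, - mat 1} (SL2 R)"
    using sub inv inv_one by (intro subgroupI) (auto simp: one mul minus_matrix_mult)
  then show ?thesis
    by (rule normalI) (auto simp: r_coset_def l_coset_def mul minus_matrix_mult)
qed

theorem group_Bianchi_group:
  assumes "d < 0"
  shows "group (Bianchi_group d)"
proof -
  let ?R = "quadratic_integers d"
  have ints: "0 \<in> ?R" "1 \<in> ?R" "- 1 \<in> ?R"
    using quadratic_integers_of_int[OF assms, of 0] quadratic_integers_of_int[OF assms, of 1]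
      quadratic_integers_of_int[OF assms, of "- 1"] by simp_all
  have "- u \<in> ?R" if "u \<in> ?R" for u
    using quadratic_integers_mult[OF assms ints(3) that] by simp
  then have "group (SL2 ?R)"
    using ints quadratic_integers_add[OF assms] quadratic_integers_mult[OF assms]
    by (intro group_SL2) auto
  then show ?thesis
    unfolding Bianchi_group_def PSL2_def
    using normal_center_SL2 ints normal.factorgroup_is_group by blast
qed


section \<open>Free groups\<close>

text \<open>
  The free group on \<open>X\<close>, realised on reduced words. The letter \<open>(x, True)\<close> stands for the
  generator \<open>x\<close> and \<open>(x, False)\<close> for its inverse.
\<close>

definition inv_letter :: "'a \<times> bool \<Rightarrow> 'a \<times> bool" where
  "inv_letter a = (fst a, \<not> snd a)"

definition reduced_word :: "('a \<times> bool) list \<Rightarrow> bool" where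
  "reduced_word w \<longleftrightarrow> successively (\<lambda>a b. b \<noteq> inv_letter a) w"

fun push_letter :: "'a \<times> bool \<Rightarrow> ('a \<times> bool) list \<Rightarrow> ('a \<times> bool) list" where
  "push_letter a [] = [a]"
| "push_letter a (b # w) = (if b = inv_letter a then w else a # b # w)"

definition free_group :: "'a set \<Rightarrow> ('a \<times> bool) list monoid" where
  "free_group X =
     \<lparr>carrier = {w. fst ` set w \<subseteq> X \<and> reduced_word w}, mult = foldr push_letter, one = []\<rparr>"

lemma inv_letter_inv_letter [simp]: "inv_letter (inv_letter a) = a"
  by (simp add: inv_letter_def)

lemma inv_letter_neq [simp]: "inv_letter a \<noteq> a"
  by (cases a) (simp add: inv_letter_def)

lemma fst_inv_letter [simp]: "fst (inv_letter a) = fst a"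
  by (simp add: inv_letter_def)

lemma reduced_Nil [simp]: "reduced_word []"
  by (simp add: reduced_word_def)

lemma reduced_Cons:
  "reduced_word (a # w) \<longleftrightarrow> reduced_word w \<and> (case w of [] \<Rightarrow> True | b # _ \<Rightarrow> b \<noteq> inv_letter a)"
  by (cases w) (auto simp: reduced_word_def)

lemma push_letter_reduced: "reduced_word w \<Longrightarrow> reduced_word (push_letter a w)"
  by (cases w) (auto simp: reduced_Cons)

lemma push_letter_reduced_Cons: "reduced_word (a # w) \<Longrightarrow> push_letter a w = a # w"
  by (cases w) (simp_all add: reduced_Cons)

lemma push_letter_cancel:
  assumes "reduced_word w"
  shows "push_letter a (push_letter (inv_letter a) w) = w"
proof (cases w)
  case (Cons b v)
  show ?thesis
  proof (cases "b = a")
    case True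
    then show ?thesis using assms Cons push_letter_reduced_Cons[of a v] by simp
  next
    case False
    then show ?thesis using Cons by simp
  qed
qed simp

lemma foldr_push_reduced: "reduced_word w \<Longrightarrow> reduced_word (foldr push_letter u w)"
  by (induction u) (auto simp: push_letter_reduced)

lemma foldr_push_Nil: "reduced_word u \<Longrightarrow> foldr push_letter u [] = u"
proof (induction u)
  case (Cons a u)
  then show ?case using push_letter_reduced_Cons[of a u] by (simp add: reduced_Cons)
qed simp

lemma set_push_letter: "set (push_letter a w) \<subseteq> insert a (set w)"
  by (cases w) auto

lemma set_foldr_push: "set (foldr push_letter u w) \<subseteq> set u \<union> set w"
proof (induction u)
  case (Cons a u)
  then show ?case using set_push_letter[of a "foldr push_letter u w"] by auto
qed simp

lemma foldr_push_push:
  assumes "reduced_word u" "reduced_word w"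
  shows "foldr push_letter (push_letter a u) w = push_letter a (foldr push_letter u w)"
  using assms
  by (cases u) (simp_all add: push_letter_cancel foldr_push_reduced)

lemma foldr_push_assoc:
  assumes "reduced_word v" "reduced_word w"
  shows "foldr push_letter (foldr push_letter u v) w = foldr push_letter u (foldr push_letter v w)"
  using assms by (induction u) (auto simp: foldr_push_push foldr_push_reduced)

lemma reduced_inverse: "reduced_word w \<Longrightarrow> reduced_word (rev (map inv_letter w))"
  unfolding reduced_word_def successively_rev successively_map
  by (erule successively_mono) auto

lemma foldr_push_inverse: "foldr push_letter (rev (map inv_letter w)) w = []"
  by (induction w) auto

theorem group_free_group: "group (free_group X)"
proof (rule groupI)
  fix x assume x: "x \<in> carrier (free_group X)"
  have "rev (map inv_letter x) \<in> carrier (free_group X)"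
    using x by (auto simp: free_group_def reduced_inverse)
  then show "\<exists>y\<in>carrier (free_group X). y \<otimes>\<^bsub>free_group X\<^esub> x = \<one>\<^bsub>free_group X\<^esub>"
    by (rule bexI[rotated]) (simp add: free_group_def foldr_push_inverse)
next
  fix x y assume "x \<in> carrier (free_group X)" "y \<in> carrier (free_group X)"
  then show "x \<otimes>\<^bsub>free_group X\<^esub> y \<in> carrier (free_group X)"
    using image_mono[OF set_foldr_push[of x y], of fst]
    by (simp add: free_group_def foldr_push_reduced image_Un) blast
qed (auto simp: free_group_def foldr_push_assoc)

theorem free_group_universal:
  fixes G (structure)
  assumes "group G" and f: "f \<in> X \<rightarrow> carrier G"
  shows "\<exists>h \<in> hom (free_group X) G. (\<forall>x\<in>X. h [(x, True)] = f x) \<and>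
           (\<forall>k \<in> hom (free_group X) G. (\<forall>x\<in>X. k [(x, True)] = f x) \<longrightarrow>
              (\<forall>w \<in> carrier (free_group X). k w = h w))"
proof -
  interpret G: group G by fact
  interpret F: group "free_group X" by (rule group_free_group)
  define g where "g = (\<lambda>a. if snd a then f (fst a) else inv (f (fst a)))"
  define h where "h = (\<lambda>w. foldr (\<lambda>a y. g a \<otimes> y) w \<one>)"
  have g: "g a \<in> carrier G" if "fst a \<in> X" for a
    using f that by (auto simp: g_def)
  have h: "h w \<in> carrier G" if "fst ` set w \<subseteq> X" for w
    using that by (induction w) (auto simp: h_def g)
  have ginv: "g (inv_letter a) = inv (g a)" if "fst a \<in> X" for a
    using f that G.inv_inv[of "f (fst a)"] by (auto simp: g_def inv_letter_def Pi_iff)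
  have hpush: "h (push_letter a w) = g a \<otimes> h w" if "fst a \<in> X" "fst ` set w \<subseteq> X" for a w
  proof (cases w)
    case (Cons b v)
    have "g a \<otimes> (inv (g a) \<otimes> h v) = h v"
      using that Cons g h by (simp add: G.m_assoc [symmetric])
    then show ?thesis
      using that Cons by (auto simp: h_def ginv)
  qed (auto simp: h_def)
  have hfoldr: "h (foldr push_letter u w) = h u \<otimes> h w"
    if "fst ` set u \<subseteq> X" "fst ` set w \<subseteq> X" for u w
    using that(1)
  proof (induction u)
    case Nil
    then show ?case using h[OF that(2)] by (simp add: h_def)
  next
    case (Cons a u)
    have "fst ` set (foldr push_letter u w) \<subseteq> X"
      using set_foldr_push[of u w] Cons.prems that(2) by fastforce
    then have "h (foldr push_letter (a # u) w) = g a \<otimes> (h u \<otimes> h w)"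
      using hpush[of a "foldr push_letter u w"] Cons by auto
    moreover have "h (a # u) = g a \<otimes> h u"
      by (simp add: h_def)
    ultimately show ?case
      using Cons.prems that(2) g h by (auto simp: G.m_assoc)
  qed
  have hom: "h \<in> hom (free_group X) G"
    using h hfoldr by (auto simp: hom_def free_group_def)
  have hgen: "\<forall>x\<in>X. h [(x, True)] = f x"
    using f by (auto simp: h_def g_def Pi_iff)
  have "k w = h w"
    if k: "k \<in> hom (free_group X) G" "\<forall>x\<in>X. k [(x, True)] = f x" and w: "w \<in> carrier (free_group X)"
    for k w
  proof -
    interpret k: group_hom "free_group X" G k
      by (intro group_hom.intro group_hom_axioms.intro F.group_axioms G.group_axioms k)
    have k1: "k [a] = g a" if "fst a \<in> X" for a
    proof (cases "snd a")
      case True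
      then show ?thesis using k that by (cases a) (auto simp: g_def)
    next
      case False
      define x where "x = fst a"
      have a: "a = (x, False)" "x \<in> X" using False that by (simp_all add: x_def prod_eq_iff)
      have c: "[(x, b)] \<in> carrier (free_group X)" for b
        using a by (auto simp: free_group_def reduced_Cons)
      have "[(x, False)] \<otimes>\<^bsub>free_group X\<^esub> [(x, True)] = \<one>\<^bsub>free_group X\<^esub>"
        by (simp add: free_group_def inv_letter_def)
      then have "[(x, False)] = inv\<^bsub>free_group X\<^esub> [(x, True)]"
        using c F.inv_equality by metis
      then show ?thesis
        using a c k by (simp add: g_def)
    qed
    show ?thesis
      using w
    proof (induction w)
      case Nil
      then show ?case using k.hom_one by (simp add: free_group_def h_def)
    next
      case (Cons a w)
      have c: "w \<in> carrier (free_group X)" "[a] \<in> carrier (free_group X)" "fst a \<in> X"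
        using Cons.prems by (auto simp: free_group_def reduced_Cons)
      have "a # w = [a] \<otimes>\<^bsub>free_group X\<^esub> w"
        using Cons.prems by (simp add: free_group_def push_letter_reduced_Cons)
      then have "k (a # w) = k [a] \<otimes> k w"
        using c by (metis k.hom_mult)
      then show ?case
        using Cons.IH c k1 by (simp add: h_def)
    qed
  qed
  then show ?thesis
    using hom hgen by blast
qed

end

theory Submission
  imports Defs "HOL-Number_Theory.Number_Theory" "HOL-Computational_Algebra.Squarefree" "HOL-Real_Asymp.Real_Asymp"
begin

text \<open>
  Following Zimmert, hyperbolic 3-space is cut along the translates of the vertical planes
  \<open>Im z = k \<surd>|d| / (2 n)\<close>, where \<open>k\<close> is coprime to \<open>n\<close>, \<open>4 n\<^sup>2 < |d|\<close>, and \<open>n\<close> is odd,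
  squarefree and a product of inert primes. Because \<open>n\<close> has only inert prime factors, the points
  \<open>(e + k \<omega>)/n\<close> are centres of hemispheres of radius \<open>1/n\<close> equivalent to the floor below infinity;
  they cover the plane, and \<open>4 n\<^sup>2 < |d|\<close> keeps all other hemispheres away. Hence distinct planes are
  disjoint, and recording the planes crossed by a path gives a homomorphism to the free group on the
  set of all such \<open>n\<close>. Each \<open>n\<close> contributes a group element that carries the plane at
  \<open>(n - 1)/(2n)\<close> to the one at \<open>(n + 1)/(2n)\<close>. Between these two lie only planes with larger
  denominator, so descending induction on \<open>n\<close> puts every generator into the image.

  It remains to find \<open>|d|\<close> to the power \<open>1/4 - \<epsilon>\<close> such \<open>n\<close>. If there were fewer, then counting products of
  inert primes of equal size shows that the inert primes up to \<open>\<surd>|d|/2\<close> are sparse, so the quadratic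
  character equals 1 at almost all primes beyond a power of \<open>log |d|\<close>. Sieving by the smaller primes, the mean of the
  character over an interval of length \<open>\<surd>|d| log |d|\<close> would be at least a power of \<open>1/log log |d|\<close>, whereas the
  size \<open>\<surd>|d|\<close> of its Gauss sum bounds it by \<open>1/log |d|\<close>.
\<close>

section \<open>Half-spaces and words in the free group\<close>

text \<open>The exponent 1/4 comes from a rounding loss in the counting. A product of inert primes
  from one dyadic block around 2^j is admissible while four times its square stays below |d|, so
  about log |d| / (2 j) factors fit, rounded down. Just above |d|^(1/4) only one factor fits and a
  prime yields just one wall; fewer than |d|^(1/4 - \<epsilon>) inert primes is still sparse in that
  block, whereas |d|^(1/4) of them would say nothing. From about |d|^(1/2) on no walls are
  available; there the reciprocal sum over all primes, of order log log |d| / log |d|, is small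
  because the interval exceeds |d|^(1/2) by a logarithm only. For odd squarefree \<open>n\<close>
  every residue is a sum of two squares. This yields two hemispheres with opposite norms modulo
  \<open>n\<close>, whose composition negates the index \<open>k\<close> of a plane; that is the
  group element belonging to \<open>n\<close>. No geodesics occur: points are positive definite
  Hermitian matrices up to scaling, planes are zero sets of linear functions, and paths are straight
  segments in the cone.\<close>

locale halfspaces =
  fixes HS :: "'h set" and opp :: "'h \<Rightarrow> 'h" and le :: "'h \<Rightarrow> 'h \<Rightarrow> bool"
    and lab :: "'h \<Rightarrow> 'a \<times> bool"
  assumes opp_in: "h \<in> HS \<Longrightarrow> opp h \<in> HS"
    and opp_opp: "h \<in> HS \<Longrightarrow> opp (opp h) = h"
    and not_le_opp: "h \<in> HS \<Longrightarrow> \<not> le h (opp h)"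
    and le_trans: "h \<in> HS \<Longrightarrow> k \<in> HS \<Longrightarrow> l \<in> HS \<Longrightarrow> le h k \<Longrightarrow> le k l \<Longrightarrow> le h l"
    and le_refl: "h \<in> HS \<Longrightarrow> le h h"
    and le_antisym: "h \<in> HS \<Longrightarrow> k \<in> HS \<Longrightarrow> le h k \<Longrightarrow> le k h \<Longrightarrow> h = k"
    and le_opp: "h \<in> HS \<Longrightarrow> k \<in> HS \<Longrightarrow> le h k \<Longrightarrow> le (opp k) (opp h)"
    and nested: "h \<in> HS \<Longrightarrow> k \<in> HS \<Longrightarrow> le h k \<or> le k h \<or> le h (opp k) \<or> le (opp k) h"
    and lab_opp: "h \<in> HS \<Longrightarrow> lab (opp h) = inv_letter (lab h)"
begin

definition orientation :: "'h set \<Rightarrow> bool" where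
  "orientation \<sigma> \<longleftrightarrow> \<sigma> \<subseteq> HS \<and> (\<forall>h\<in>HS. opp h \<in> \<sigma> \<longleftrightarrow> h \<notin> \<sigma>) \<and>
     (\<forall>h\<in>\<sigma>. \<forall>k\<in>HS. le h k \<longrightarrow> k \<in> \<sigma>)"

lemma orientation_up: "orientation \<sigma> \<Longrightarrow> h \<in> \<sigma> \<Longrightarrow> k \<in> HS \<Longrightarrow> le h k \<Longrightarrow> k \<in> \<sigma>"
  unfolding orientation_def by simp

lemma orientation_subset: "orientation \<sigma> \<Longrightarrow> \<sigma> \<subseteq> HS"
  unfolding orientation_def by simp

lemma orientation_opp: "orientation \<sigma> \<Longrightarrow> h \<in> HS \<Longrightarrow> opp h \<in> \<sigma> \<longleftrightarrow> h \<notin> \<sigma>"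
  unfolding orientation_def by simp

text \<open>An orientation plays the role of a vertex of the tree dual to the walls; \<open>\<tau> - \<sigma>\<close> is then the chain of
  half-spaces entered on the way from \<open>\<sigma>\<close> to \<open>\<tau>\<close>.\<close>
definition greatest :: "'h set \<Rightarrow> 'h" where
  "greatest S = (SOME m. m \<in> S \<and> (\<forall>k\<in>S. le k m))"

text \<open>The largest half-space has its wall nearest to the start and is entered first, so its
  label is the first letter. The number drives the recursion and is meant to be the size of the
  set.\<close>

primrec chain_word :: "nat \<Rightarrow> 'h set \<Rightarrow> ('a \<times> bool) list" where
  "chain_word 0 S = []"
| "chain_word (Suc n) S = push_letter (lab (greatest S)) (chain_word n (S - {greatest S}))"

definition word :: "'h set \<Rightarrow> 'h set \<Rightarrow> ('a \<times> bool) list" where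
  "word \<sigma> \<tau> = chain_word (card (\<tau> - \<sigma>)) (\<tau> - \<sigma>)"

lemma greatest_eq: "S \<subseteq> HS \<Longrightarrow> m \<in> S \<Longrightarrow> (\<And>k. k \<in> S \<Longrightarrow> le k m) \<Longrightarrow> greatest S = m"
  unfolding greatest_def by (rule some_equality, blast, meson le_antisym subsetD)

text \<open>Two of the four cases of \<open>nested\<close> are impossible:
  \<open>le h (opp k)\<close> would put \<open>opp k\<close> into \<open>\<tau>\<close>, and
  \<open>le (opp k) h\<close> would put \<open>h\<close> into \<open>\<sigma>\<close>.\<close>

lemma chain_diff:
  assumes "orientation \<sigma>" "orientation \<tau>" "h \<in> \<tau> - \<sigma>" "k \<in> \<tau> - \<sigma>"
  shows "le h k \<or> le k h"
proof -
  have hk: "h \<in> HS" "k \<in> HS" "opp k \<in> \<sigma>" "opp k \<notin> \<tau>" "opp k \<in> HS"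
    using assms opp_in orientation_subset[of \<tau>] orientation_opp by auto
  have "\<not> le h (opp k)" using hk assms(3) orientation_up[OF assms(2), of h "opp k"] by auto
  moreover have "\<not> le (opp k) h" using hk assms(3) orientation_up[OF assms(1), of "opp k" h] by auto
  ultimately show ?thesis using nested[of h k] hk by blast
qed

lemma greatest_exists:
  assumes "finite S" "S \<noteq> {}" "S \<subseteq> HS" "\<And>h k. h \<in> S \<Longrightarrow> k \<in> S \<Longrightarrow> le h k \<or> le k h"
  shows "\<exists>m\<in>S. \<forall>k\<in>S. le k m"
  using assms
proof (induction S rule: finite_ne_induct)
  case (singleton x)
  then show ?case by (auto intro: le_refl)
next
  case (insert x F)
  then obtain m where m: "m \<in> F" "\<forall>k\<in>F. le k m" by auto
  have H: "x \<in> HS" "m \<in> HS" "F \<subseteq> HS" using insert m by auto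
  show ?case
  proof (cases "le x m")
    case True
    then show ?thesis using m by auto
  next
    case False
    then have "le m x" using insert.prems(2)[of x m] m by auto
    then have "\<forall>k\<in>F. le k x" using m(2) H le_trans[of _ m x] by (meson subsetD)
    then show ?thesis using H le_refl[of x] by simp
  qed
qed

lemma word_step:
  assumes "finite (\<tau> - \<sigma>)" "\<tau> \<subseteq> HS" "m \<in> \<tau> - \<sigma>" "\<And>k. k \<in> \<tau> - \<sigma> \<Longrightarrow> le k m"
    and "\<tau> - \<sigma>' = (\<tau> - \<sigma>) - {m}"
  shows "word \<sigma> \<tau> = push_letter (lab m) (word \<sigma>' \<tau>)"
proof -
  have g: "greatest (\<tau> - \<sigma>) = m" using assms(2-4) by (intro greatest_eq) blast+
  obtain n where n: "card (\<tau> - \<sigma>) = Suc n"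
    using assms(1,3) by (metis card_Suc_Diff1)
  then have "card (\<tau> - \<sigma>') = n" unfolding assms(5) using assms(1,3) by simp
  then show ?thesis unfolding word_def n by (simp add: g assms(5))
qed

lemma chain_word_reduced: "reduced_word (chain_word n S)"
  by (induction n arbitrary: S) (auto simp: push_letter_reduced)

lemma word_reduced: "reduced_word (word \<sigma> \<tau>)"
  by (simp add: word_def chain_word_reduced)

lemma chain_word_closed:
  assumes "finite S" "S \<subseteq> HS" "\<And>h k. h \<in> S \<Longrightarrow> k \<in> S \<Longrightarrow> le h k \<or> le k h" "n = card S"
    and "[] \<in> I" "\<And>h w. h \<in> S \<Longrightarrow> w \<in> I \<Longrightarrow> push_letter (lab h) w \<in> I"
  shows "chain_word n S \<in> I"
  using assms(1-4,6)
proof (induction n arbitrary: S)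
  case 0
  then show ?case using assms(5) by simp
next
  case (Suc n)
  have "S \<noteq> {}" using Suc.prems(4) by auto
  then obtain m where m: "m \<in> S" "\<forall>k\<in>S. le k m" using greatest_exists[of S] Suc.prems(1-3) by blast
  have "greatest S = m" using m Suc.prems(2) by (intro greatest_eq) blast+
  moreover have "chain_word n (S - {m}) \<in> I"
    using Suc.prems(1-4) m by (intro Suc.IH Suc.prems(5)) (auto simp: subset_eq)
  ultimately show ?case using Suc.prems(5) m by simp
qed

text \<open>Serves twice: to confine the letters to the generators, and to place the word of a path
  in a given subgroup.\<close>

lemma word_closed:
  assumes "orientation \<sigma>" "orientation \<tau>" "finite (\<tau> - \<sigma>)"
    and "[] \<in> I" "\<And>h w. h \<in> \<tau> - \<sigma> \<Longrightarrow> w \<in> I \<Longrightarrow> push_letter (lab h) w \<in> I"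
  shows "word \<sigma> \<tau> \<in> I"
  unfolding word_def using assms chain_diff
  by (intro chain_word_closed) (auto simp: orientation_def)

text \<open>Passage to the neighbouring vertex across \<open>m\<close>; maximality of
  \<open>m\<close> among the half-spaces missing from \<open>\<sigma>\<close> says that no other
  wall lies between.\<close>

lemma flip:
  assumes s: "orientation \<sigma>" and m: "m \<in> HS" "m \<notin> \<sigma>" and
    max: "\<And>k. k \<in> HS \<Longrightarrow> k \<notin> \<sigma> \<Longrightarrow> le m k \<Longrightarrow> k = m"
  shows "orientation (insert m (\<sigma> - {opp m}))"
proof -
  have up: "k \<in> insert m (\<sigma> - {opp m})"
    if h: "h \<in> insert m (\<sigma> - {opp m})" and k: "k \<in> HS" "le h k" for h k
  proof (cases "h = m")
    case True
    show ?thesis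
    proof (cases "k = opp m")
      case True2: True
      have "m \<in> HS" "opp m \<in> HS" using m opp_in by auto
      then have "le m (opp m)" using True True2 k by simp
      then show ?thesis using m not_le_opp by blast
    next
      case False
      then show ?thesis using True k max s by (auto simp: orientation_def)
    qed
  next
    case False
    then have hs: "h \<in> \<sigma>" "h \<noteq> opp m" using h by auto
    then have ks: "k \<in> \<sigma>" using s k by (auto simp: orientation_def)
    \<comment> \<open>Otherwise \<open>m\<close> is below \<open>opp h\<close>, which is not in
      \<open>\<sigma>\<close>; maximality gives \<open>opp h = m\<close>, against
      \<open>h \<noteq> opp m\<close>.\<close>
    have "k \<noteq> opp m"
    proof
      assume "k = opp m"
      moreover have "h \<in> HS" using s hs by (auto simp: orientation_def)
      ultimately have "le m (opp h)" using k le_opp[of h k] opp_opp m by metis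
      moreover have "opp h \<in> HS" "opp h \<notin> \<sigma>" using s hs opp_in unfolding orientation_def by auto
      ultimately have "opp h = m" using max by blast
      then show False using hs opp_opp \<open>h \<in> HS\<close> by metis
    qed
    then show ?thesis using ks by auto
  qed
  have "opp h \<in> insert m (\<sigma> - {opp m}) \<longleftrightarrow> h \<notin> insert m (\<sigma> - {opp m})" if h: "h \<in> HS" for h
  proof -
    have "opp h = m \<longleftrightarrow> h = opp m" "opp h = opp m \<longleftrightarrow> h = m"
      using h m opp_opp by metis+
    moreover have "opp m \<noteq> m" using m le_refl not_le_opp by metis
    moreover have "opp h \<in> \<sigma> \<longleftrightarrow> h \<notin> \<sigma>" "opp m \<in> \<sigma>" using s h m by (auto simp: orientation_def)
    ultimately show ?thesis using m by auto
  qed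
  moreover have "insert m (\<sigma> - {opp m}) \<subseteq> HS" using s m unfolding orientation_def by auto
  ultimately show ?thesis unfolding orientation_def using up by simp
qed

text \<open>Upward closure of the flipped vertex leaves nothing else of
  \<open>\<rho> - \<sigma>\<close> above \<open>m\<close>, so \<open>m\<close> is the greatest
  element and supplies the first letter.\<close>

lemma word_flip:
  assumes s: "orientation \<sigma>" and r: "orientation \<rho>" and m: "m \<in> HS" "m \<notin> \<sigma>" "m \<in> \<rho>"
    and s': "orientation (insert m (\<sigma> - {opp m}))" and fin: "finite (\<rho> - \<sigma>)"
  shows "word \<sigma> \<rho> = push_letter (lab m) (word (insert m (\<sigma> - {opp m})) \<rho>)"
proof (rule word_step)
  show "finite (\<rho> - \<sigma>)" "\<rho> \<subseteq> HS" "m \<in> \<rho> - \<sigma>"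
    using assms by (auto simp: orientation_def)
  have "opp m \<notin> \<rho>" using r m by (auto simp: orientation_def)
  then show "\<rho> - insert m (\<sigma> - {opp m}) = \<rho> - \<sigma> - {m}" by auto
  fix k assume k: "k \<in> \<rho> - \<sigma>"
  show "le k m"
  proof (cases "k = m")
    case True
    then show ?thesis using m le_refl by simp
  next
    case False
    have "\<not> le m k"
      using orientation_up[OF s', of m k] k False orientation_subset[OF r] by auto
    then show ?thesis using chain_diff[OF s r, of k m] k m by auto
  qed
qed

text \<open>Induction on the distance from \<open>\<sigma>\<close> to \<open>\<tau>\<close>: flipping the outermost half-space multiplies both sides by
  the same letter on the left.\<close>
lemma word_cocycle:
  assumes "orientation \<sigma>" "orientation \<tau>" "orientation \<rho>"
    and "finite (\<tau> - \<sigma>)" "finite (\<rho> - \<tau>)" "finite (\<rho> - \<sigma>)"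
  shows "word \<sigma> \<rho> = foldr push_letter (word \<sigma> \<tau>) (word \<tau> \<rho>)"
  using assms
proof (induction "card (\<tau> - \<sigma>)" arbitrary: \<sigma>)
  case 0
  then have "\<tau> \<subseteq> \<sigma>" by auto
  moreover have "\<sigma> \<subseteq> \<tau>"
  proof
    fix h assume "h \<in> \<sigma>"
    then have "h \<in> HS" "opp h \<notin> \<sigma>" using 0 orientation_subset orientation_opp by blast+
    then show "h \<in> \<tau>" using 0 \<open>\<tau> \<subseteq> \<sigma>\<close> orientation_opp[of \<tau> h] by auto
  qed
  ultimately have "\<tau> = \<sigma>" by auto
  then show ?case by (simp add: word_def)
next
  case (Suc n)
  note s = \<open>orientation \<sigma>\<close> and t = \<open>orientation \<tau>\<close> and r = \<open>orientation \<rho>\<close>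
  have "\<tau> - \<sigma> \<noteq> {}" using Suc.hyps(2) by (metis card.empty nat.distinct(1))
  moreover have "\<tau> - \<sigma> \<subseteq> HS" using orientation_subset[OF t] by auto
  ultimately obtain m where m: "m \<in> \<tau> - \<sigma>" "\<And>k. k \<in> \<tau> - \<sigma> \<Longrightarrow> le k m"
    using greatest_exists[of "\<tau> - \<sigma>"] chain_diff[OF s t] Suc.prems(4) by metis
  have mHS: "m \<in> HS" "opp m \<in> HS" "opp (opp m) = m" "opp m \<in> \<sigma>" "opp m \<notin> \<tau>"
    using m t s opp_in opp_opp by (auto simp: orientation_def)
  define \<sigma>' where "\<sigma>' = insert m (\<sigma> - {opp m})"
  have s': "orientation \<sigma>'"
    unfolding \<sigma>'_def
  proof (rule flip[OF s])
    fix k assume k: "k \<in> HS" "k \<notin> \<sigma>" "le m k"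
    then have "k \<in> \<tau> - \<sigma>" using t m by (auto simp: orientation_def)
    then show "k = m" using m(2) k mHS le_antisym by blast
  qed (use m mHS in auto)
  have d: "\<tau> - \<sigma>' = (\<tau> - \<sigma>) - {m}" using mHS by (auto simp: \<sigma>'_def)
  have fin: "finite (\<tau> - \<sigma>')" "finite (\<rho> - \<sigma>')"
    using d Suc.prems(4-6) finite_subset[of "\<rho> - \<sigma>'" "insert (opp m) (\<rho> - \<sigma>)"]
    by (auto simp: \<sigma>'_def)
  have "card (\<tau> - \<sigma>') = n" using Suc.hyps(2) Suc.prems(4) m(1) unfolding d by simp
  then have IH: "word \<sigma>' \<rho> = foldr push_letter (word \<sigma>' \<tau>) (word \<tau> \<rho>)"
    using Suc.hyps(1)[of \<sigma>'] s' t r fin Suc.prems(5) by simp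
  have w: "word \<sigma> \<tau> = push_letter (lab m) (word \<sigma>' \<tau>)"
    using word_flip[OF s t, of m] m(1) mHS s' Suc.prems(4) by (simp add: \<sigma>'_def)
  have "word \<sigma> \<rho> = push_letter (lab m) (word \<sigma>' \<rho>)"
  proof (cases "m \<in> \<rho>")
    case True
    then show ?thesis
      using word_flip[OF s r, of m] m(1) mHS s' True Suc.prems(6) by (simp add: \<sigma>'_def)
  next
    case False
    \<comment> \<open>The target is on the side of \<open>\<sigma>\<close>, so the roles are
      exchanged: \<open>\<sigma>\<close> arises from \<open>\<sigma>'\<close> by flipping
      \<open>opp m\<close>, and the inverse label cancels.\<close>
    then have o: "opp m \<in> \<rho>" using r mHS by (auto simp: orientation_def)
    have e: "\<sigma> = insert (opp m) (\<sigma>' - {opp (opp m)})"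
      using mHS m(1) by (auto simp: \<sigma>'_def)
    have "opp m \<notin> \<sigma>'" using mHS le_refl[OF mHS(1)] not_le_opp[OF mHS(1)] by (auto simp: \<sigma>'_def)
    then have "word \<sigma>' \<rho> = push_letter (lab (opp m)) (word \<sigma> \<rho>)"
      using word_flip[OF s' r, of "opp m"] o mHS s fin e by metis
    then show ?thesis using lab_opp[OF mHS(1)] push_letter_cancel[OF word_reduced] by metis
  qed
  then show ?case
    using IH w foldr_push_push[OF word_reduced word_reduced] by metis
qed

lemma chain_word_image:
  assumes "\<And>h. h \<in> HS \<Longrightarrow> f h \<in> HS \<and> lab (f h) = lab h"
    and le: "\<And>h k. h \<in> HS \<Longrightarrow> k \<in> HS \<Longrightarrow> le (f h) (f k) \<longleftrightarrow> le h k"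
    and "finite S" "S \<subseteq> HS" "\<And>h k. h \<in> S \<Longrightarrow> k \<in> S \<Longrightarrow> le h k \<or> le k h" "n = card S"
  shows "chain_word n (f ` S) = chain_word n S"
  using assms(3-)
proof (induction n arbitrary: S)
  case 0
  then show ?case by simp
next
  case (Suc n)
  have "S \<noteq> {}" using Suc.prems(4) by auto
  then obtain m where m: "m \<in> S" "\<forall>k\<in>S. le k m" using greatest_exists[of S] Suc.prems(1-3) by blast
  have inj: "inj_on f HS"
  proof (rule inj_onI)
    fix h k assume "h \<in> HS" "k \<in> HS" "f h = f k"
    then show "h = k" using le[of h k] le[of k h] le_refl[of h] le_refl[of "f h"] assms(1) le_antisym
      by auto
  qed
  have "greatest S = m" using m Suc.prems(2) by (intro greatest_eq) blast+
  moreover have "greatest (f ` S) = f m"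
  proof (rule greatest_eq)
    show "f ` S \<subseteq> HS" using Suc.prems(2) assms(1) by blast
    show "f m \<in> f ` S" using m by blast
    fix k assume "k \<in> f ` S"
    then obtain k' where "k = f k'" "k' \<in> S" by blast
    moreover have "k' \<in> HS" "m \<in> HS" using Suc.prems(2) m \<open>k' \<in> S\<close> by auto
    ultimately show "le k (f m)" using m le[of k' m] by simp
  qed
  moreover have "f ` S - {f m} = f ` (S - {m})"
    by (subst inj_on_image_set_diff[OF inj]) (use m Suc.prems(2) in auto)
  moreover have "chain_word n (f ` (S - {m})) = chain_word n (S - {m})"
    using Suc.prems m by (intro Suc.IH) (simp, blast, blast, simp)
  ultimately show ?case using assms(1)[of m] m Suc.prems(2) by auto
qed

text \<open>This makes the words of paths invariant under the group, which permutes half-spaces and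
  keeps their order and labels.\<close>

lemma word_image:
  assumes "\<And>h. h \<in> HS \<Longrightarrow> f h \<in> HS \<and> lab (f h) = lab h"
    and le: "\<And>h k. h \<in> HS \<Longrightarrow> k \<in> HS \<Longrightarrow> le (f h) (f k) \<longleftrightarrow> le h k"
    and s: "orientation \<sigma>" and t: "orientation \<tau>" and "finite (\<tau> - \<sigma>)"
  shows "word (f ` \<sigma>) (f ` \<tau>) = word \<sigma> \<tau>"
proof -
  have inj: "inj_on f HS"
  proof (rule inj_onI)
    fix h k assume "h \<in> HS" "k \<in> HS" "f h = f k"
    then show "h = k" using le[of h k] le[of k h] le_refl[of h] le_refl[of "f h"] assms(1) le_antisym
      by auto
  qed
  have sub: "\<sigma> \<subseteq> HS" "\<tau> \<subseteq> HS" using s t by (auto simp: orientation_def)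
  have "f ` \<tau> - f ` \<sigma> = f ` (\<tau> - \<sigma>)"
    using inj_on_image_set_diff[OF inj, of \<tau> \<sigma>] sub by auto
  moreover have "card (f ` (\<tau> - \<sigma>)) = card (\<tau> - \<sigma>)"
    using inj sub by (intro card_image inj_on_subset[OF inj]) auto
  moreover have "chain_word (card (\<tau> - \<sigma>)) (f ` (\<tau> - \<sigma>)) = chain_word (card (\<tau> - \<sigma>)) (\<tau> - \<sigma>)"
    by (rule chain_word_image[OF assms(1,2) assms(5) _ chain_diff[OF s t] refl]) (use sub in auto)
  ultimately show ?thesis
    unfolding word_def by simp
qed

end

section \<open>Hermitian forms\<close>

definition adjoint_matrix :: "complex^2^2 \<Rightarrow> complex^2^2" where
  "adjoint_matrix A = (\<chi> i j. cnj (A $ j $ i))"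

definition herm_act :: "complex^2^2 \<Rightarrow> complex^2^2 \<Rightarrow> complex^2^2" where
  "herm_act A P = A ** P ** adjoint_matrix A"

text \<open>A positive definite Hermitian matrix \<open>P\<close>, up to scaling, is the point of hyperbolic 3-space over \<open>P$1$2 / P$2$2\<close>
  at height \<open>sqrt (herm_det P) / P$2$2\<close>; convexity of the cone replaces geodesics.\<close>
definition herm_det :: "complex^2^2 \<Rightarrow> real" where
  "herm_det P = Re (P$1$1) * Re (P$2$2) - (cmod (P$1$2))\<^sup>2"

definition posdef :: "(complex^2^2) set" where
  "posdef = {P. Im (P$1$1) = 0 \<and> Im (P$2$2) = 0 \<and> P$2$1 = cnj (P$1$2) \<and> Re (P$2$2) > 0 \<and> herm_det P > 0}"

text \<open>The Hermitian form of \<open>P\<close> at the row \<open>(c, \<delta>)\<close>, hence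
  the new lower right entry after acting with a matrix of that bottom row. This entry is inversely
  proportional to the height, so for \<open>c \<noteq> 0\<close> the inequality
  \<open>herm_form P c \<delta> \<ge> Re (P$2$2)\<close> puts the point of \<open>P\<close> on or
  outside the hemisphere with centre \<open>- \<delta> / c\<close> and radius
  \<open>1 / |c|\<close>.\<close>

definition herm_form :: "complex^2^2 \<Rightarrow> complex \<Rightarrow> complex \<Rightarrow> real" where
  "herm_form P c \<delta> = (cmod c)\<^sup>2 * Re (P$1$1) + 2 * Re (c * P$1$2 * cnj \<delta>) + (cmod \<delta>)\<^sup>2 * Re (P$2$2)"

lemma herm_act_nth:
  "herm_act A P $ i $ j = (A$i$1 * P$1$1 + A$i$2 * P$2$1) * cnj (A$j$1) + (A$i$1 * P$1$2 + A$i$2 * P$2$2) * cnj (A$j$2)"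
  by (simp add: herm_act_def adjoint_matrix_def matrix_matrix_mult_def sum_2)

lemma adjoint_matrix_mult: "adjoint_matrix (A ** B) = adjoint_matrix B ** adjoint_matrix A"
  by (simp add: adjoint_matrix_def vec_eq_iff matrix_matrix_mult_def sum_2 mult.commute)

lemma herm_act_mult: "herm_act (A ** B) P = herm_act A (herm_act B P)"
  by (simp add: herm_act_def adjoint_matrix_mult matrix_mul_assoc)

lemma herm_act_one: "herm_act (mat 1) P = P"
proof -
  have "adjoint_matrix (mat 1) = mat 1" by (simp add: adjoint_matrix_def vec_eq_iff mat_def)
  then show ?thesis by (simp add: herm_act_def)
qed

lemma herm_act_minus: "herm_act (- A) P = herm_act A P"
  by (simp add: vec_eq_iff herm_act_nth algebra_simps)

lemma herm_act_linear:
  "herm_act A (a *\<^sub>R P + b *\<^sub>R Q) = a *\<^sub>R herm_act A P + b *\<^sub>R herm_act A Q"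
  by (simp add: vec_eq_iff herm_act_nth algebra_simps)

lemma posdefD:
  assumes "P \<in> posdef"
  shows "P$2$1 = cnj (P$1$2)" "Re (P$2$2) > 0" "herm_det P > 0" "Re (P$1$1) > 0"
    "Im (P$1$1) = 0" "Im (P$2$2) = 0"
proof -
  show *: "P$2$1 = cnj (P$1$2)" "Re (P$2$2) > 0" "herm_det P > 0" "Im (P$1$1) = 0" "Im (P$2$2) = 0"
    using assms by (auto simp: posdef_def)
  have "Re (P$1$1) * Re (P$2$2) > 0" 
    using *(3) zero_le_power2[of "cmod (P$1$2)"] unfolding herm_det_def by linarith
  then show "Re (P$1$1) > 0" using *(2) zero_less_mult_pos2 by blast
qed

lemma herm_form_complete_square:
  "Re (P$2$2) * herm_form P c \<delta> = (cmod (c * P$1$2 + \<delta> * of_real (Re (P$2$2))))\<^sup>2 + (cmod c)\<^sup>2 * herm_det P"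
  unfolding herm_form_def herm_det_def cmod_power2
  by (simp add: algebra_simps power2_eq_square)

lemma herm_form_pos:
  assumes "P \<in> posdef" "c \<noteq> 0 \<or> \<delta> \<noteq> 0"
  shows "herm_form P c \<delta> > 0"
proof -
  note P = posdefD[OF assms(1)]
  have "0 < (cmod (c * P$1$2 + \<delta> * of_real (Re (P$2$2))))\<^sup>2 + (cmod c)\<^sup>2 * herm_det P"
  proof (cases "c = 0")
    case True
    then show ?thesis using assms(2) P(2) by simp
  next
    case False
    then show ?thesis using P(3) by (simp add: add_nonneg_pos)
  qed
  then show ?thesis using P(2) herm_form_complete_square[of P c \<delta>]
    by (metis zero_less_mult_pos)
qed

lemma herm_act_22:
  assumes "P \<in> posdef"
  shows "herm_act A P $ 2 $ 2 = of_real (herm_form P (A$2$1) (A$2$2))"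
  unfolding herm_act_nth herm_form_def cmod_power2 posdefD(1)[OF assms]
  using posdefD(5,6)[OF assms] by (simp add: complex_eq_iff algebra_simps power2_eq_square)

lemma herm_det_eq:
  assumes "P \<in> posdef"
  shows "of_real (herm_det P) = det P"
  using assms unfolding herm_det_def det_2 cmod_power2 posdef_def
  by (auto simp: complex_eq_iff algebra_simps power2_eq_square)

lemma posdef_herm_act:
  assumes P: "P \<in> posdef" and A: "det A = 1"
  shows "herm_act A P \<in> posdef" "herm_det (herm_act A P) = herm_det P"
proof -
  let ?Q = "herm_act A P"
  have r: "A$2$1 \<noteq> 0 \<or> A$2$2 \<noteq> 0" using A by (auto simp: det_2)
  have h: "Im (?Q$1$1) = 0" "Im (?Q$2$2) = 0" "?Q$2$1 = cnj (?Q$1$2)"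
    unfolding herm_act_nth posdefD(1)[OF P]
    using posdefD(5,6)[OF P] by (simp_all add: complex_eq_iff algebra_simps)
  have "det (adjoint_matrix A) = 1"
    using A by (simp add: adjoint_matrix_def det_2 flip: complex_cnj_mult complex_cnj_diff)
      (simp add: mult.commute)
  then have d: "det ?Q = det P" by (simp add: herm_act_def det_mul A)
  have e: "herm_det ?Q = Re (det ?Q)"
    using h unfolding herm_det_def det_2 cmod_power2 by (simp add: algebra_simps power2_eq_square)
  have "Re (of_real (herm_det P)) = Re (det P)" by (simp only: herm_det_eq[OF P])
  then show *: "herm_det ?Q = herm_det P" using e d by simp
  show "?Q \<in> posdef"
    unfolding posdef_def using h * posdefD(3)[OF P] herm_form_pos[OF P r]
    by (simp add: herm_act_22[OF P])
qed

text \<open>The mixed term \<open>u + v - 2 * w\<close> is nonnegative: positivity of both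
  determinants gives \<open>w\<^sup>2 \<le> u * v\<close>, and the geometric mean is at most the
  arithmetic one. The quantitative form later bounds determinants from below along a
  segment.\<close>

lemma herm_det_convex:
  assumes P: "P \<in> posdef" and Q: "Q \<in> posdef" and t: "0 \<le> a" "0 \<le> b"
  shows "herm_det (a *\<^sub>R P + b *\<^sub>R Q) \<ge> a\<^sup>2 * herm_det P + b\<^sup>2 * herm_det Q"
proof -
  note p = posdefD[OF P] and r = posdefD[OF Q]
  define u where "u = Re (P$1$1) * Re (Q$2$2)"
  define v where "v = Re (Q$1$1) * Re (P$2$2)"
  define w where "w = Re (P$1$2 * cnj (Q$1$2))"
  have uv: "u > 0" "v > 0" using p r by (auto simp: u_def v_def)
  have "(cmod (P$1$2))\<^sup>2 * (cmod (Q$1$2))\<^sup>2 \<le> (Re (P$1$1) * Re (P$2$2)) * (Re (Q$1$1) * Re (Q$2$2))"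
    using p r unfolding herm_det_def by (intro mult_mono) auto
  also have "\<dots> = u * v" by (simp add: u_def v_def)
  finally have "(cmod (P$1$2) * cmod (Q$1$2))\<^sup>2 \<le> u * v" by (simp add: power_mult_distrib)
  also have "\<dots> \<le> ((u + v) / 2)\<^sup>2" using zero_le_power2[of "u - v"] by (simp add: power2_eq_square field_simps)
  finally have "cmod (P$1$2) * cmod (Q$1$2) \<le> (u + v) / 2"
    using uv by (intro power2_le_imp_le[of "_ * _"]) auto
  moreover have "w \<le> cmod (P$1$2) * cmod (Q$1$2)"
    using complex_Re_le_cmod[of "P$1$2 * cnj (Q$1$2)"] by (simp only: w_def norm_mult complex_mod_cnj)
  ultimately have "w \<le> (u + v) / 2" by (rule order_trans[rotated])
  then have "u + v - 2 * w \<ge> 0" by simp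
  then have "a * b * (u + v - 2 * w) \<ge> 0" using t by simp
  moreover have "herm_det (a *\<^sub>R P + b *\<^sub>R Q) = a\<^sup>2 * herm_det P + b\<^sup>2 * herm_det Q
      + a * b * (u + v - 2 * w)"
    unfolding herm_det_def u_def v_def w_def cmod_power2 by (simp add: algebra_simps power2_eq_square)
  ultimately show ?thesis by linarith
qed

lemma posdef_convex:
  assumes P: "P \<in> posdef" and Q: "Q \<in> posdef" and t: "0 \<le> a" "0 \<le> b" "a + b > 0"
  shows "a *\<^sub>R P + b *\<^sub>R Q \<in> posdef"
proof -
  note p = posdefD[OF P] and r = posdefD[OF Q]
  have pos: "a * x + b * y > 0" if "x > 0" "y > 0" for x y
    using t that by (cases "a = 0") (auto intro: add_pos_nonneg)
  have "a\<^sup>2 * herm_det P + b\<^sup>2 * herm_det Q > 0"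
    using t p r by (cases "a = 0") (auto intro: add_pos_nonneg)
  then have "herm_det (a *\<^sub>R P + b *\<^sub>R Q) > 0"
    using herm_det_convex[OF P Q t(1,2)] by linarith
  then show ?thesis
    using P Q pos[OF p(2) r(2)] unfolding posdef_def by auto
qed

section \<open>Imaginary quadratic orders\<close>

definition mat2 :: "complex \<Rightarrow> complex \<Rightarrow> complex \<Rightarrow> complex \<Rightarrow> complex^2^2" where
  "mat2 a b c d = (\<chi> i j. if i = 1 then (if j = 1 then a else b) else (if j = 1 then c else d))"

lemma mat2_nth [simp]: "mat2 a b c d $ 1 $ 1 = a" "mat2 a b c d $ 1 $ 2 = b"
  "mat2 a b c d $ 2 $ 1 = c" "mat2 a b c d $ 2 $ 2 = d"
  by (simp_all add: mat2_def)

lemma det_mat2: "det (mat2 a b c d) = a * d - b * c"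
  by (simp add: det_2)

text \<open>The divisibility says that \<open>D\<close> is 0 or 1 modulo 4. The bound excludes the
  two orders with units other than 1 and -1 and gives \<open>q > 1\<close>.\<close>

locale imaginary_quadratic_order =
  fixes D :: int
  assumes D: "D < - 4" and D4: "4 dvd D * D - D"
begin

definition q :: real where "q = sqrt (of_int (- D)) / 2"

definition om :: complex where "om = Complex (of_int D / 2) q"

definition R :: "complex set" where "R = {of_int x + of_int y * om | x y. True}"

text \<open>Imaginary part measured in rows of the lattice: on \<open>R\<close> it is the integer
  coefficient of \<open>om\<close>.\<close>

definition yc :: "complex \<Rightarrow> real" where "yc z = Im z / q"

text \<open>The norm of \<open>e + k * om\<close>; the quotient by 4 is the norm of
  \<open>om\<close>.\<close>

definition nrm :: "int \<Rightarrow> int \<Rightarrow> int" where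
  "nrm e k = e * e + D * e * k + k * k * ((D * D - D) div 4)"

definition S :: "(complex^2^2) set" where "S = {A. (\<forall>i j. A $ i $ j \<in> R) \<and> det A = 1}"

text \<open>The odd squarefree part of Zimmert's set.\<close>
definition adm :: "nat set" where
  "adm = {n. odd n \<and> squarefree n \<and> 4 * (int n)\<^sup>2 < - D \<and>
     (\<forall>p. prime p \<and> p dvd n \<longrightarrow> \<not> (\<exists>x. [x\<^sup>2 = D] (mod int p)))}"

text \<open>Its zero set is the vertical plane \<open>Im z = k q / n\<close>.\<close>
definition wall_fun :: "nat \<Rightarrow> int \<Rightarrow> complex^2^2 \<Rightarrow> real" where
  "wall_fun n k P = real n * yc (P$1$2) - of_int k * Re (P$2$2)"

lemma q_sq: "q\<^sup>2 = - of_int D / 4"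
  using D by (simp add: q_def power_divide)

lemma q_gt_1: "q > 1"
proof -
  have "1\<^sup>2 < q\<^sup>2" using D unfolding q_sq by simp
  then show ?thesis using D by (intro power2_less_imp_less[of 1 q]) (auto simp: q_def)
qed

lemma adm_pos: "n \<in> adm \<Longrightarrow> n > 0"
  by (auto simp: adm_def intro: Nat.gr0I)

lemma adm_less_q:
  assumes "n \<in> adm" shows "(real n)\<^sup>2 < q\<^sup>2"
proof -
  have "real_of_int (4 * (int n)\<^sup>2) < real_of_int (- D)"
    using assms unfolding adm_def by (simp only: of_int_less_iff) simp
  then show ?thesis unfolding q_sq by simp
qed

lemma yc_add: "yc (a + b) = yc a + yc b" by (simp add: yc_def add_divide_distrib)
lemma yc_minus: "yc (- a) = - yc a" by (simp add: yc_def)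
lemma yc_of_int_mult: "yc (of_int x * a) = of_int x * yc a" by (simp add: yc_def)
lemma yc_om: "yc (of_int x + of_int y * om) = of_int y"
  using q_gt_1 by (simp add: yc_def om_def)

lemma Im_eq: "Im z = q * yc z" using q_gt_1 by (simp add: yc_def)

lemma RI [intro]: "of_int x + of_int y * om \<in> R" by (auto simp: R_def)

lemma R_of_int [simp]: "of_int x \<in> R"
  using RI[of x 0] by simp

lemma R_0 [simp]: "0 \<in> R" and R_1 [simp]: "1 \<in> R"
  using R_of_int[of 0] R_of_int[of 1] by simp_all

lemma om_sq: "om * om = of_int D * om - of_int ((D * D - D) div 4)"
proof -
  have "of_int ((D * D - D) div 4) = (of_int (D * D - D) / 4 :: real)"
    using D4 by (simp add: real_of_int_div)
  moreover have "q * q = - of_int D / 4" using q_sq by (simp add: power2_eq_square)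
  ultimately show ?thesis
    by (simp add: om_def complex_eq_iff field_simps)
qed

lemma cnj_om: "cnj om = of_int D - om"
  by (simp add: om_def complex_eq_iff)

lemma R_add: "u \<in> R \<Longrightarrow> v \<in> R \<Longrightarrow> u + v \<in> R"
proof -
  assume "u \<in> R" "v \<in> R"
  then obtain a b c d where "u = of_int a + of_int b * om" "v = of_int c + of_int d * om"
    unfolding R_def by blast
  then have "u + v = of_int (a + c) + of_int (b + d) * om" by (simp add: algebra_simps)
  then show ?thesis by (simp only: RI)
qed

lemma R_mult: "u \<in> R \<Longrightarrow> v \<in> R \<Longrightarrow> u * v \<in> R"
proof -
  assume "u \<in> R" "v \<in> R"
  then obtain a b c d where e: "u = of_int a + of_int b * om" "v = of_int c + of_int d * om"
    unfolding R_def by blast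
  have "u * v = of_int a * of_int c + of_int b * of_int d * (om * om) + (of_int a * of_int d + of_int b * of_int c) * om"
    unfolding e by (simp add: algebra_simps)
  also have "\<dots> = of_int (a * c - b * d * ((D * D - D) div 4)) + of_int (a * d + b * c + b * d * D) * om"
    unfolding om_sq by (simp add: algebra_simps)
  finally show ?thesis by (simp only: RI)
qed

lemma R_minus: "u \<in> R \<Longrightarrow> - u \<in> R"
  using R_mult[OF R_of_int[of "- 1"], of u] by simp

lemma R_diff: "u \<in> R \<Longrightarrow> v \<in> R \<Longrightarrow> u - v \<in> R"
  using R_add[of u "- v"] R_minus[of v] by simp

lemma R_cnj: "u \<in> R \<Longrightarrow> cnj u \<in> R"
proof -
  assume "u \<in> R"
  then obtain a b where "u = of_int a + of_int b * om" unfolding R_def by blast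
  then have "cnj u = of_int (a + b * D) + of_int (- b) * om"
    by (simp add: cnj_om algebra_simps)
  then show ?thesis by (simp only: RI)
qed

lemma yc_R: "u \<in> R \<Longrightarrow> \<exists>y::int. yc u = of_int y"
  unfolding R_def using yc_om by blast

lemma nrm_eq: "(of_int e + of_int k * om) * cnj (of_int e + of_int k * om) = of_int (nrm e k)"
proof -
  have "(of_int e + of_int k * om) * cnj (of_int e + of_int k * om) =
      of_int e * of_int e + of_int e * of_int k * of_int D + of_int k * of_int k * (of_int D * om - om * om)"
    by (simp add: cnj_om algebra_simps)
  then show ?thesis unfolding om_sq nrm_def by (simp add: algebra_simps)
qed

lemma four_nrm: "4 * nrm e k = (2 * e + D * k)\<^sup>2 - D * k\<^sup>2"
proof -
  obtain m where m: "D * D - D = 4 * m" using D4 by blast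
  have "4 * nrm e k = 4 * (e * e) + 4 * (D * e * k) + k * k * (4 * m)"
    unfolding nrm_def m by (simp add: algebra_simps)
  then show ?thesis unfolding m[symmetric] by (simp add: algebra_simps power2_eq_square)
qed

text \<open>If a prime \<open>p\<close> of \<open>n\<close> divided the norm,
  \<open>four_nrm\<close> would make \<open>D * k\<^sup>2\<close> a square modulo \<open>p\<close>,
  and inverting \<open>k\<close> would make \<open>D\<close> one, which inertness forbids. So the
  numerator of every centre on the wall is invertible modulo \<open>n\<close>.\<close>

lemma coprime_nrm:
  assumes n: "n \<in> adm" and k: "coprime k (int n)"
  shows "coprime (nrm e k) (int n)"
proof (rule ccontr)
  assume "\<not> coprime (nrm e k) (int n)"
  then have "\<not> is_unit (gcd (nrm e k) (int n))" "gcd (nrm e k) (int n) \<noteq> 0"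
    using adm_pos[OF n] by (auto simp: is_unit_gcd)
  then obtain p where "p dvd gcd (nrm e k) (int n)" "prime p" using prime_divisor_exists by blast
  then have p: "prime p" "p dvd nrm e k" "p dvd int n" by (auto intro: dvd_trans)
  then have "\<not> p dvd k" using k not_prime_unit coprime_common_divisor by blast
  then have "coprime k p" using p prime_imp_coprime coprime_commute by blast
  then obtain v where v: "[k * v = 1] (mod p)" using cong_solve_coprime_int by blast
  have "p dvd ((2 * e + D * k)\<^sup>2 - D * k\<^sup>2) * v\<^sup>2" using p(2) four_nrm[of e k] by (metis dvd_mult dvd_mult2)
  then have "[((2 * e + D * k) * v)\<^sup>2 = D * (k * v)\<^sup>2] (mod p)"
    unfolding cong_iff_dvd_diff by (simp add: left_diff_distrib power_mult_distrib mult.assoc)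
  moreover have "[D * (k * v)\<^sup>2 = D * 1\<^sup>2] (mod p)" using v cong_pow cong_scalar_left by blast
  ultimately have "[((2 * e + D * k) * v)\<^sup>2 = D] (mod p)" using cong_trans by fastforce
  moreover obtain p' where p': "p = int p'" using prime_ge_0_int[OF p(1)] nonneg_int_cases by blast
  moreover have "prime p'" "p' dvd n" using p p' by auto
  moreover have "\<And>p. prime p \<Longrightarrow> p dvd n \<Longrightarrow> \<not> (\<exists>x. [x\<^sup>2 = D] (mod int p))"
    using n by (simp add: adm_def)
  ultimately show False by blast
qed

lemma finite_R_bounded: "finite {u \<in> R. cmod u \<le> B}"
proof (rule finite_subset)
  define M where "M = \<lceil>B + (B / q) * cmod om\<rceil>"
  define N where "N = \<lceil>B / q\<rceil>"
  show "{u \<in> R. cmod u \<le> B} \<subseteq> (\<lambda>(x, y). of_int x + of_int y * om) ` ({-M..M} \<times> {-N..N})"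
  proof
    fix u assume "u \<in> {u \<in> R. cmod u \<le> B}"
    then obtain x y where u: "u = of_int x + of_int y * om" "cmod u \<le> B"
      unfolding R_def by blast
    have "\<bar>q * of_int y\<bar> \<le> B" using u abs_Im_le_cmod[of u] by (simp add: om_def mult.commute)
    then have y: "\<bar>of_int y\<bar> \<le> B / q" using q_gt_1 by (simp add: abs_mult field_simps)
    have "cmod (of_int x :: complex) \<le> cmod u + cmod (of_int y * om)"
      unfolding u using norm_triangle_ineq4[of u "of_int y * om"] u(1) by simp
    also have "\<dots> \<le> B + (B / q) * cmod om"
      using u(2) mult_right_mono[OF y, of "cmod om"] by (simp add: norm_mult)
    finally have "\<bar>of_int x\<bar> \<le> B + (B / q) * cmod om" by simp
    then have "x \<in> {-M..M}" "y \<in> {-N..N}" using y unfolding M_def N_def by (auto simp: abs_le_iff) linarith+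
    then show "u \<in> (\<lambda>(x, y). of_int x + of_int y * om) ` ({-M..M} \<times> {-N..N})"
      using u(1) by force
  qed
qed auto

section \<open>The group over the order and its action on vertical planes\<close>

lemma SI: "a \<in> R \<Longrightarrow> b \<in> R \<Longrightarrow> c \<in> R \<Longrightarrow> d \<in> R \<Longrightarrow> a * d - b * c = 1 \<Longrightarrow> mat2 a b c d \<in> S"
  by (simp add: S_def forall_2 det_mat2)

lemma S_det: "A \<in> S \<Longrightarrow> det A = 1" and S_R: "A \<in> S \<Longrightarrow> A $ i $ j \<in> R"
  by (auto simp: S_def)

lemma S_mult: "A \<in> S \<Longrightarrow> B \<in> S \<Longrightarrow> A ** B \<in> S"
  unfolding S_def by (simp add: det_mul) (simp add: matrix_matrix_mult_def sum_2 R_add R_mult)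

lemma S_one: "mat 1 \<in> S"
  by (simp add: S_def mat_def det_2)

lemma S_inverse:
  assumes "A \<in> S"
  obtains B where "B \<in> S" "B ** A = mat 1" "A ** B = mat 1"
proof -
  define B where "B = mat2 (A$2$2) (- A$1$2) (- A$2$1) (A$1$1)"
  have d: "A$1$1 * A$2$2 - A$1$2 * A$2$1 = 1" using S_det[OF assms] by (simp add: det_2)
  have "B \<in> S" unfolding B_def using S_R[OF assms] d by (intro SI R_minus) (auto simp: algebra_simps)
  moreover have "B ** A = mat 1" "A ** B = mat 1"
    using d unfolding B_def by (auto simp: vec_eq_iff forall_2 matrix_matrix_mult_def sum_2 mat_def algebra_simps)
  ultimately show ?thesis using that by blast
qed

lemma S_minus: "A \<in> S \<Longrightarrow> - A \<in> S"
  unfolding S_def by (auto simp: det_2 R_minus)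

lemma S_posdef: "A \<in> S \<Longrightarrow> P \<in> posdef \<Longrightarrow> herm_act A P \<in> posdef"
  using posdef_herm_act S_det by blast

text \<open>With first row starting with \<open>a\<close> and bottom row \<open>(n, d)\<close>, the
  boundary map is z -> a/n - 1/(n (n z + d)); it takes the vertical plane through the pole -d/n to
  the one through a/n. Determinant 1 makes even the function values agree, so sides are kept as
  well.\<close>

lemma wall_transform:
  assumes P: "P \<in> posdef" and A: "det A = 1" "A$2$1 = of_nat n"
    and k: "yc (A$1$1) = of_int k'" "yc (A$2$2) = - of_int k"
  shows "wall_fun n k' (herm_act A P) = wall_fun n k P"
proof -
  let ?Q = "herm_act A P"
  have Q: "?Q \<in> posdef" using posdef_herm_act[OF P A(1)] by simp
  note p = posdefD[OF P]
  have d: "A$1$1 * A$2$2 - A$1$2 * of_nat n = 1" using A by (simp add: det_2)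
  have "of_nat n * ?Q$1$2 - A$1$1 * ?Q$2$2 =
     - (A$1$1 * A$2$2 - A$1$2 * of_nat n) * (P$2$1 * of_nat n + P$2$2 * cnj (A$2$2))"
    by (simp add: herm_act_nth A(2) algebra_simps)
  then have "of_nat n * ?Q$1$2 - A$1$1 * ?Q$2$2 = - (cnj (P$1$2) * of_nat n + P$2$2 * cnj (A$2$2))"
    unfolding d using p by simp
  then have "Im (of_nat n * ?Q$1$2 - A$1$1 * ?Q$2$2) = Im (- (cnj (P$1$2) * of_nat n + P$2$2 * cnj (A$2$2)))"
    by simp
  then have "real n * Im (?Q$1$2) - Im (A$1$1) * Re (?Q$2$2) = real n * Im (P$1$2) + Re (P$2$2) * Im (A$2$2)"
    using posdefD(6)[OF Q] p(6) by (simp add: algebra_simps)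
  then have "q * (real n * yc (?Q$1$2) - yc (A$1$1) * Re (?Q$2$2)) = q * (real n * yc (P$1$2) + Re (P$2$2) * yc (A$2$2))"
    unfolding Im_eq by (simp add: algebra_simps)
  then have "real n * yc (?Q$1$2) - yc (A$1$1) * Re (?Q$2$2) = real n * yc (P$1$2) + Re (P$2$2) * yc (A$2$2)"
    using q_gt_1 unfolding mult_cancel_left by simp
  then show ?thesis unfolding wall_fun_def k by (simp add: algebra_simps)
qed

text \<open>A unit has norm 1, while a nonzero coefficient of \<open>om\<close> would make four
  times the norm at least \<open>- D > 4\<close>.\<close>

lemma R_unit:
  assumes "a \<in> R" "d \<in> R" "a * d = 1"
  shows "d = 1 \<and> a = 1 \<or> d = - 1 \<and> a = - 1"
proof -
  obtain x y where d: "d = of_int x + of_int y * om" using assms unfolding R_def by blast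
  obtain x' y' where a: "a = of_int x' + of_int y' * om" using assms unfolding R_def by blast
  have "of_int (nrm x' y') * of_int (nrm x y) = (a * cnj a) * (d * cnj d)"
    unfolding nrm_eq[symmetric] a d ..
  also have "\<dots> = (a * d) * cnj (a * d)" by (simp add: algebra_simps)
  finally have "of_int (nrm x' y' * nrm x y) = (1::complex)" using assms by simp
  then have "nrm x' y' * nrm x y = 1" by (metis of_int_1 of_int_eq_iff)
  then have "nrm x y dvd 1" by (metis dvd_triv_right)
  then have "4 * nrm x y \<le> 4" by (auto dest: zdvd_imp_le)
  then have *: "(2 * x + D * y)\<^sup>2 - D * y\<^sup>2 \<le> 4" using four_nrm by simp
  have "y = 0"
  proof (rule ccontr)
    assume "y \<noteq> 0"
    then have "y\<^sup>2 \<ge> 1" by (simp add: int_one_le_iff_zero_less)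
    then have "- D * 1 \<le> - D * y\<^sup>2" using D by (intro mult_left_mono) auto
    then show False using * D zero_le_power2[of "2 * x + D * y"] by linarith
  qed
  then have "x\<^sup>2 \<le> 1" using * by (simp add: power_mult_distrib)
  then have "\<bar>x\<bar> \<le> 1" using abs_le_square_iff[of x 1] by simp
  moreover have "x \<noteq> 0" using assms(3) d \<open>y = 0\<close> by auto
  ultimately have "x = 1 \<or> x = - 1" by linarith
  then have "d = 1 \<or> d = - 1" using d \<open>y = 0\<close> by auto
  then show ?thesis using assms(3) by (auto simp: minus_equation_iff)
qed

text \<open>By \<open>R_unit\<close> such a matrix is, up to sign, a translation by a lattice
  element; \<open>j\<close> is the number of rows it shifts.\<close>

lemma wall_translate:
  assumes P: "P \<in> posdef" and A: "A \<in> S" "A$2$1 = 0"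
  shows "Re (herm_act A P $2$2) = Re (P$2$2)"
    and "\<exists>j::int. \<forall>n k. \<forall>Q\<in>posdef. wall_fun n (k + int n * j) (herm_act A Q) = wall_fun n k Q"
proof -
  have "A$1$1 * A$2$2 = 1" using S_det[OF A(1)] A(2) by (simp add: det_2)
  then have "A$2$2 = 1 \<and> A$1$1 = 1 \<or> A$2$2 = - 1 \<and> A$1$1 = - 1"
    using R_unit S_R[OF A(1)] by blast
  then obtain \<epsilon> :: int where e: "A$1$1 = of_int \<epsilon>" "A$2$2 = of_int \<epsilon>" "\<epsilon> * \<epsilon> = 1"
    using that[of 1] that[of "- 1"] by auto
  have ee: "of_int \<epsilon> * of_int \<epsilon> = (1::complex)" "of_int \<epsilon> * of_int \<epsilon> = (1::real)"
    using e(3) by (metis of_int_1 of_int_mult)+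
  have Q22: "herm_act A Q $2$2 = Q$2$2" for Q
  proof -
    have "herm_act A Q $2$2 = of_int \<epsilon> * of_int \<epsilon> * Q$2$2"
      unfolding herm_act_nth e A(2) by (simp add: algebra_simps)
    then show ?thesis by (simp only: ee mult_1)
  qed
  then show "Re (herm_act A P $2$2) = Re (P$2$2)" by simp
  obtain y :: int where y: "yc (A$1$2) = of_int y" using yc_R S_R[OF A(1)] by blast
  have "wall_fun n (k + int n * (\<epsilon> * y)) (herm_act A Q) = wall_fun n k Q" if Q: "Q \<in> posdef" for Q n k
  proof -
    have "herm_act A Q $1$2 = of_int \<epsilon> * of_int \<epsilon> * Q$1$2 + of_int \<epsilon> * (A$1$2 * Q$2$2)"
      unfolding herm_act_nth e A(2) by (simp add: algebra_simps)
    then have "Im (herm_act A Q $1$2) = Im (Q$1$2) + of_int \<epsilon> * (Im (A$1$2) * Re (Q$2$2))"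
      using posdefD(6)[OF Q] by (simp only: ee mult_1) simp
    then have "yc (herm_act A Q $1$2) = yc (Q$1$2) + of_int \<epsilon> * (of_int y * Re (Q$2$2))"
      using q_gt_1 unfolding y[symmetric] yc_def by (simp add: field_simps)
    then show ?thesis unfolding wall_fun_def Q22 by (simp add: algebra_simps)
  qed
  then show "\<exists>j::int. \<forall>n k. \<forall>Q\<in>posdef. wall_fun n (k + int n * j) (herm_act A Q) = wall_fun n k Q" by blast
qed

text \<open>The centre \<open>l / n\<close> with \<open>l = e + k * om\<close> is equivalent to
  infinity because \<open>l\<close> is invertible modulo \<open>n\<close>, with inverse
  \<open>u * cnj l\<close>. The conjugation and the sign of \<open>- l\<close> give the image plane
  the index \<open>u * k\<close>.\<close>

lemma hemisphere_step:
  assumes n: "n \<in> adm" and k: "coprime k (int n)" and u: "[u * nrm e k = 1] (mod int n)" and k': "[k' = u * k] (mod int n)"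
  obtains A where "A \<in> S" "A$2$1 = of_nat n" "A$2$2 = - (of_int e + of_int k * om)" "coprime k' (int n)"
    "\<And>P. P \<in> posdef \<Longrightarrow> wall_fun n k' (herm_act A P) = wall_fun n k P"
proof -
  define l where "l = of_int e + of_int k * om"
  obtain v where v: "u * nrm e k = 1 + int n * v" using u by (metis cong_iff_lin cong_sym)
  obtain j where j: "k' = u * k + int n * j" using k' by (metis cong_iff_lin cong_sym)
  \<comment> \<open>Any representative \<open>k'\<close> of \<open>u * k\<close> is reached: adding
    \<open>n * j * om\<close> shifts \<open>yc a\<close> by \<open>n * j\<close>, and
    \<open>b\<close> absorbs the change.\<close>
  define a where "a = - (of_int u * cnj l) + of_int (int n) * (of_int j * om)"
  define b where "b = of_int v - of_int j * om * l"
  have "a * (- l) - b * of_nat n = of_int u * (l * cnj l) - of_int v * of_int (int n)"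
    unfolding a_def b_def by (simp add: algebra_simps)
  also have "\<dots> = of_int (u * nrm e k - int n * v)"
    unfolding l_def nrm_eq by simp
  finally have d: "a * (- l) - b * of_nat n = 1" unfolding v by simp
  have jo: "of_int j * om \<in> R" using RI[of 0 j] by simp
  have l: "l \<in> R" by (auto simp: l_def)
  have R: "a \<in> R" "b \<in> R" "- l \<in> R" "of_nat n \<in> R"
    unfolding a_def b_def using l jo R_of_int[of "int n"]
    by (auto intro!: R_add R_diff R_minus R_mult R_cnj simp del: of_int_of_nat_eq) (simp_all add: R_of_int[of "int n", simplified])
  define A where "A = mat2 a b (of_nat n) (- l)"
  have A: "A \<in> S" unfolding A_def using R d by (intro SI) auto
  have ycl: "yc l = of_int k" unfolding l_def by (rule yc_om)
  have "yc (cnj l) = - of_int k" using ycl unfolding yc_def by simp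
  moreover have "yc (of_int j * om) = of_int j" using yc_om[of 0 j] by simp
  moreover have "yc a = - (of_int u * yc (cnj l)) + of_int (int n) * yc (of_int j * om)"
    unfolding a_def by (simp only: yc_add yc_of_int_mult yc_minus)
  ultimately have yca: "yc a = of_int k'"
    unfolding j by simp
  have "coprime (u * nrm e k) (int n)"
    using u by (metis cong_imp_coprime cong_sym coprime_1_left)
  then have "coprime (u * k) (int n)" using k by simp
  then have "coprime k' (int n)" using k' by (metis cong_imp_coprime cong_sym)
  moreover have "wall_fun n k' (herm_act A P) = wall_fun n k P" if "P \<in> posdef" for P
    using that yca ycl S_det[OF A] by (intro wall_transform) (auto simp: A_def yc_def)
  ultimately show ?thesis using that[of A] A by (simp add: A_def l_def)
qed

section \<open>Reduction along a wall and disjointness of walls\<close>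

text \<open>Geometrically, a point of the plane on or outside all hemispheres of radius
  \<open>1 / n\<close> centred at the points \<open>(e + k * om) / n\<close> below that
  plane.\<close>

definition reduced_at :: "nat \<Rightarrow> int \<Rightarrow> complex^2^2 \<Rightarrow> bool" where
  "reduced_at n k P \<longleftrightarrow> P \<in> posdef \<and> wall_fun n k P = 0 \<and>
     (\<forall>e::int. herm_form P (of_nat n) (- (of_int e + of_int k * om)) \<ge> Re (P$2$2))"

text \<open>Upper half-space coordinates: \<open>P$1$2 / s\<close> is the boundary coordinate and
  \<open>herm_det P / s\<^sup>2\<close> the squared height.\<close>

lemma normalized_form:
  assumes "P \<in> posdef"
  defines "s \<equiv> Re (P$2$2)"
  shows "herm_form P c \<delta> = s * ((cmod (c * (P$1$2 / of_real s) + \<delta>))\<^sup>2 + (cmod c)\<^sup>2 * (herm_det P / s\<^sup>2))"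
proof -
  have s: "s > 0" using posdefD[OF assms(1)] by (simp add: s_def)
  have "c * P$1$2 + \<delta> * of_real s = of_real s * (c * (P$1$2 / of_real s) + \<delta>)"
    using s by (simp add: field_simps)
  then have "(cmod (c * P$1$2 + \<delta> * of_real s))\<^sup>2 = s\<^sup>2 * (cmod (c * (P$1$2 / of_real s) + \<delta>))\<^sup>2"
    by (simp add: norm_mult power_mult_distrib)
  then have "s * herm_form P c \<delta> = s\<^sup>2 * (cmod (c * (P$1$2 / of_real s) + \<delta>))\<^sup>2 + (cmod c)\<^sup>2 * herm_det P"
    using herm_form_complete_square[of P c \<delta>] unfolding s_def by simp
  also have "\<dots> = s * (s * ((cmod (c * (P$1$2 / of_real s) + \<delta>))\<^sup>2 + (cmod c)\<^sup>2 * (herm_det P / s\<^sup>2)))"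
    using s by (simp add: field_simps power2_eq_square)
  finally show ?thesis using s by (simp only: mult_cancel_left) simp
qed

text \<open>A hemisphere reaching the floor above the wall is centred on the wall: all others are too small,
  because \<open>n < q\<close> and the hemispheres of radius \<open>1/n\<close> centred at \<open>(e + k \<omega>)/n\<close> already cover the wall.\<close>
lemma floor_over_wall:
  fixes z0 :: complex and r2 :: real
  assumes n: "n \<in> adm" and k: "coprime k (int n)" and z0: "real n * Im z0 = of_int k * q"
    and red: "\<And>e::int. (cmod (of_nat n * z0 - (of_int e + of_int k * om)))\<^sup>2 + (real n)\<^sup>2 * r2 \<ge> 1"
    and R: "c \<in> R" "\<delta> \<in> R" and le: "(cmod (c * z0 + \<delta>))\<^sup>2 + (cmod c)\<^sup>2 * r2 \<le> 1"
  shows "c = 0 \<or> (\<exists>(e::int) (m::int). (m = 1 \<or> m = - 1) \<and> c = of_int m * of_nat n \<and> \<delta> = - of_int m * (of_int e + of_int k * om))"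
proof -
  \<comment> \<open>\<open>t\<close> locates \<open>n * z0\<close> along the row of numerators of
    the centres, and \<open>e\<close> is the nearest one.\<close>
  define t where "t = real n * Re z0 - of_int k * of_int D / 2"
  define e where "e = round t"
  define \<tau> where "\<tau> = t - of_int e"
  define l where "l = of_int e + of_int k * om"
  have tau: "\<bar>\<tau>\<bar> \<le> 1 / 2" unfolding \<tau>_def e_def using of_int_round_abs_le[of t] by (simp add: abs_minus_commute)
  have nz: "of_nat n * z0 = l + of_real \<tau>"
    using z0 by (simp add: complex_eq_iff l_def om_def \<tau>_def t_def)
  have r: "\<tau>\<^sup>2 + (real n)\<^sup>2 * r2 \<ge> 1" using red[of e] nz by (simp add: l_def)
  have tau2: "\<tau>\<^sup>2 \<le> 1 / 4" using tau abs_le_square_iff[of \<tau> "1/2"] by (simp add: power2_eq_square)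
  obtain x y where c: "c = of_int x + of_int y * om" using R unfolding R_def by blast
  have lR: "l \<in> R" by (auto simp: l_def)
  have "of_nat n \<in> R" using R_of_int[of "int n"] by simp
  then have "c * l + of_nat n * \<delta> \<in> R" using R lR by (intro R_add R_mult) auto
  then obtain X Y where XY: "c * l + of_nat n * \<delta> = of_int X + of_int Y * om" unfolding R_def by blast
  \<comment> \<open>Multiplication by \<open>n\<close> splits \<open>c * z0 + \<delta>\<close> into
    the small multiple \<open>\<tau> * c\<close> and a lattice element in row
    \<open>Y\<close>.\<close>
  have ncz: "of_nat n * (c * z0 + \<delta>) = of_real \<tau> * c + (of_int X + of_int Y * om)"
    unfolding XY[symmetric] using nz by (simp add: algebra_simps)
  have im: "Im (of_nat n * (c * z0 + \<delta>)) = q * (of_int y * \<tau> + of_int Y)"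
  proof -
    have "Im (of_nat n * (c * z0 + \<delta>)) = Im (of_real \<tau> * c + (of_int X + of_int Y * om))" by (simp only: ncz)
    then show ?thesis unfolding c by (simp add: om_def algebra_simps)
  qed
  have n2: "(real n)\<^sup>2 < q\<^sup>2" by (rule adm_less_q[OF n])
  have "(real n)\<^sup>2 * ((cmod (c * z0 + \<delta>))\<^sup>2 + (cmod c)\<^sup>2 * r2) \<le> (real n)\<^sup>2 * 1"
    using le by (intro mult_left_mono) auto
  then have A: "(cmod (of_nat n * (c * z0 + \<delta>)))\<^sup>2 + (cmod c)\<^sup>2 * ((real n)\<^sup>2 * r2) \<le> (real n)\<^sup>2"
    by (simp only: norm_mult power_mult_distrib norm_of_nat) (simp add: algebra_simps)
  have "(Im (of_nat n * (c * z0 + \<delta>)))\<^sup>2 \<le> (cmod (of_nat n * (c * z0 + \<delta>)))\<^sup>2"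
    unfolding cmod_power2 by simp
  moreover have "(cmod c)\<^sup>2 * (1 - \<tau>\<^sup>2) \<le> (cmod c)\<^sup>2 * ((real n)\<^sup>2 * r2)"
    using r by (intro mult_left_mono) auto
  ultimately have B: "q\<^sup>2 * (of_int y * \<tau> + of_int Y)\<^sup>2 + (cmod c)\<^sup>2 * (1 - \<tau>\<^sup>2) \<le> (real n)\<^sup>2"
    using A unfolding im by (simp add: power_mult_distrib)
  have "(Im c)\<^sup>2 \<le> (cmod c)\<^sup>2" unfolding cmod_power2 by simp
  then have c2: "q\<^sup>2 * (of_int y)\<^sup>2 \<le> (cmod c)\<^sup>2" unfolding c by (simp add: om_def power_mult_distrib mult.commute)
  have "q\<^sup>2 * (of_int y)\<^sup>2 * (1 - \<tau>\<^sup>2) \<le> (cmod c)\<^sup>2 * (1 - \<tau>\<^sup>2)"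
    using c2 tau2 by (intro mult_right_mono) auto
  \<comment> \<open>Here \<open>n < q\<close> enters: the rows are \<open>q\<close> apart, so a
    single row would already exceed the bound \<open>n\<^sup>2\<close>.\<close>
  then have "q\<^sup>2 * ((of_int y * \<tau> + of_int Y)\<^sup>2 + (of_int y)\<^sup>2 * (1 - \<tau>\<^sup>2)) < q\<^sup>2 * 1"
    using B n2 by (simp add: algebra_simps)
  then have C: "(of_int y * \<tau> + of_int Y)\<^sup>2 + (of_int y)\<^sup>2 * (1 - \<tau>\<^sup>2) < 1"
    using q_gt_1 by (simp only: mult_less_cancel_left) (auto split: if_splits)
  have y0: "y = 0"
  proof (rule ccontr)
    assume "y \<noteq> 0"
    \<comment> \<open>For \<open>|y| = 1\<close> no integer \<open>Y\<close> brings
      \<open>y * \<tau> + Y\<close> below \<open>|\<tau>|\<close>, as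
      \<open>|\<tau>| \<le> 1/2\<close>; for \<open>|y| \<ge> 2\<close> the second summand alone is
      at least 3.\<close>
    then consider "\<bar>y\<bar> = 1" | "\<bar>y\<bar> \<ge> 2" by linarith
    then show False
    proof cases
      case 1
      then have y1: "(of_int y)\<^sup>2 = (1::real)" by (metis of_int_1 of_int_abs power2_abs power_one)
      have "\<bar>of_int y * \<tau>\<bar> = \<bar>\<tau>\<bar>" using 1 by (metis abs_mult mult_1 of_int_1 of_int_abs)
      then have "\<bar>\<tau>\<bar> \<le> \<bar>of_int y * \<tau> + of_int Y\<bar>"
      proof (cases "Y = 0")
        case False
        then have "(1::int) \<le> \<bar>Y\<bar>" by linarith
        then have "(1::real) \<le> \<bar>of_int Y\<bar>" by linarith
        then show ?thesis using tau \<open>\<bar>of_int y * \<tau>\<bar> = \<bar>\<tau>\<bar>\<close> by linarith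
      qed simp
      then have "\<tau>\<^sup>2 \<le> (of_int y * \<tau> + of_int Y)\<^sup>2" by (simp add: abs_le_square_iff)
      then show False using C y1 by simp
    next
      case 2
      then have "(2::int)\<^sup>2 \<le> y\<^sup>2" using abs_le_square_iff[of 2 y] by simp
      then have "4 \<le> (of_int y :: real)\<^sup>2" 
      proof -
        assume "(2::int)\<^sup>2 \<le> y\<^sup>2"
        then have "real_of_int (2\<^sup>2) \<le> of_int (y\<^sup>2)" by (simp only: of_int_le_iff)
        then show ?thesis by simp
      qed
      then have "4 * (3 / 4) \<le> (of_int y)\<^sup>2 * (1 - \<tau>\<^sup>2)" using tau2 by (intro mult_mono) auto
      then show False using C zero_le_power2[of "of_int y * \<tau> + of_int Y"] by linarith
    qed
  qed
  then have "(of_int Y)\<^sup>2 < (1::real)" using C by simp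
  then have Y0: "Y = 0" by (simp add: abs_square_less_1)
  have cx: "c = of_int x" using c y0 by simp
  obtain x' y' where d: "\<delta> = of_int x' + of_int y' * om" using R unfolding R_def by blast
  have "yc (c * l + of_nat n * \<delta>) = 0" using XY Y0 yc_om[of X Y] by simp
  moreover have "c * l + of_nat n * \<delta> = of_int (x * e + int n * x') + of_int (x * k + int n * y') * om"
    unfolding cx d l_def by (simp add: algebra_simps)
  ultimately have xk: "x * k + int n * y' = 0" using yc_om by (metis of_int_eq_0_iff)
  then have "int n dvd x * k" by (metis dvd_add_times_triv_right_iff dvd_0_right mult.commute)
  then have "int n dvd x" using k by (metis coprime_commute coprime_dvd_mult_left_iff)
  then obtain m where m: "x = int n * m" by blast
  have npos: "real n > 0" using adm_pos[OF n] by simp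
  have "(cmod c)\<^sup>2 * (1 - \<tau>\<^sup>2) \<le> (real n)\<^sup>2" 
  proof -
    have "0 \<le> q\<^sup>2 * (of_int y * \<tau> + of_int Y)\<^sup>2" by simp
    then show ?thesis using B by linarith
  qed
  moreover have "cmod c = real n * \<bar>of_int m\<bar>" unfolding cx m by (simp add: abs_mult norm_mult)
  ultimately have "(real n)\<^sup>2 * ((of_int m)\<^sup>2 * (1 - \<tau>\<^sup>2)) \<le> (real n)\<^sup>2 * 1" by (simp add: power_mult_distrib mult.assoc)
  then have m1: "(of_int m)\<^sup>2 * (1 - \<tau>\<^sup>2) \<le> 1" using npos by (simp only: mult_le_cancel_left) auto
  have "(of_int m)\<^sup>2 * (3 / 4) \<le> (of_int m)\<^sup>2 * (1 - \<tau>\<^sup>2)" using tau2 by (intro mult_left_mono) auto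
  then have "(of_int m)\<^sup>2 < (2::real)\<^sup>2" using m1 by (simp add: power2_eq_square)
  then have "\<bar>of_int m\<bar>\<^sup>2 < (2::real)\<^sup>2" by simp
  then have "\<bar>of_int m\<bar> < (2::real)" by (rule power_less_imp_less_base) simp
  then have "\<bar>m\<bar> < 2" by linarith
  then consider "m = 0" | "m = 1 \<or> m = - 1" by linarith
  then show ?thesis
  proof cases
    case 1
    then show ?thesis using cx m by simp
  next
    case 2
    have "int n * (m * k + y') = 0" using xk unfolding m by (simp add: algebra_simps)
    then have "y' = - m * k" using npos by simp
    then have "\<delta> = - of_int m * (of_int (- m * x') + of_int k * om)"
      using 2 d by auto
    then show ?thesis using 2 cx m by (intro disjI2 exI[of _ "- m * x'"] exI[of _ m]) (simp add: mult.commute)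
  qed
qed

lemma reduced_rows:
  assumes n: "n \<in> adm" and k: "coprime k (int n)" and P: "reduced_at n k P"
    and R: "c \<in> R" "\<delta> \<in> R" and le: "herm_form P c \<delta> \<le> Re (P$2$2)"
  shows "c = 0 \<or> (\<exists>(e::int) (m::int). (m = 1 \<or> m = - 1) \<and> c = of_int m * of_nat n \<and> \<delta> = - of_int m * (of_int e + of_int k * om))"
proof (rule floor_over_wall[OF n k _ _ R])
  define s where "s = Re (P$2$2)"
  have P': "P \<in> posdef" "wall_fun n k P = 0" using P by (auto simp: reduced_at_def)
  have s: "s > 0" using posdefD[OF P'(1)] by (simp add: s_def)
  have h: "herm_form P c \<delta> \<le> s \<longleftrightarrow> (cmod (c * (P$1$2 / of_real s) + \<delta>))\<^sup>2 + (cmod c)\<^sup>2 * (herm_det P / s\<^sup>2) \<le> 1" for c \<delta>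
    using normalized_form[OF P'(1), of c \<delta>] s unfolding s_def by simp
  have h': "s \<le> herm_form P c \<delta> \<longleftrightarrow> 1 \<le> (cmod (c * (P$1$2 / of_real s) + \<delta>))\<^sup>2 + (cmod c)\<^sup>2 * (herm_det P / s\<^sup>2)" for c \<delta>
    using normalized_form[OF P'(1), of c \<delta>] s unfolding s_def by simp
  show "real n * Im (P$1$2 / of_real s) = of_int k * q"
    using P'(2) s q_gt_1 unfolding wall_fun_def yc_def s_def[symmetric] by (simp add: field_simps Im_divide_of_real)
  show "(cmod (c * (P$1$2 / of_real s) + \<delta>))\<^sup>2 + (cmod c)\<^sup>2 * (herm_det P / s\<^sup>2) \<le> 1"
    using le h by (simp add: s_def)
  fix e :: int
  have "s \<le> herm_form P (of_nat n) (- (of_int e + of_int k * om))"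
    using P by (auto simp: reduced_at_def s_def)
  then show "1 \<le> (cmod (of_nat n * (P$1$2 / of_real s) - (of_int e + of_int k * om)))\<^sup>2 + (real n)\<^sup>2 * (herm_det P / s\<^sup>2)"
    unfolding h' by (simp only: diff_conv_add_uminus norm_of_nat)
qed

lemma herm_form_minus: "herm_form P (- c) (- d) = herm_form P c d"
  by (simp add: herm_form_def)

text \<open>A reduced point is a highest point of its orbit: by \<open>reduced_rows\<close> a row
  lowering the entry would be a translation or a hemisphere of the wall, and neither lowers
  it.\<close>

lemma reduced_minimal:
  assumes n: "n \<in> adm" and k: "coprime k (int n)" and P: "reduced_at n k P" and A: "A \<in> S"
  shows "Re (P$2$2) \<le> Re (herm_act A P$2$2)"
proof (rule ccontr)
  assume neg: "\<not> ?thesis"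
  have P': "P \<in> posdef" using P by (simp add: reduced_at_def)
  have le: "herm_form P (A$2$1) (A$2$2) < Re (P$2$2)" using neg herm_act_22[OF P', of A] by simp
  consider "A$2$1 = 0" | e m :: int where "m = 1 \<or> m = - 1" "A$2$1 = of_int m * of_nat n" "A$2$2 = - of_int m * (of_int e + of_int k * om)"
    using reduced_rows[OF n k P S_R[OF A] S_R[OF A]] le by (metis less_imp_le)
  then show False
  proof cases
    case 1
    then show ?thesis using wall_translate(1)[OF P' A] neg by simp
  next
    case 2
    have "herm_form P (A$2$1) (A$2$2) = herm_form P (of_nat n) (- (of_int e + of_int k * om))"
      using 2 herm_form_minus[of P "of_nat n" "- (of_int e + of_int k * om)"] by auto
    then show ?thesis using P le by (auto simp: reduced_at_def not_less[symmetric])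
  qed
qed

text \<open>Completing the square bounds \<open>c\<close> through the determinant and then
  \<open>d\<close>.\<close>

lemma finite_small_rows:
  assumes "P \<in> posdef"
  shows "finite {(c, d). c \<in> R \<and> d \<in> R \<and> herm_form P c d \<le> M}"
proof (rule finite_subset)
  define s where "s = Re (P$2$2)"
  define B where "B = sqrt (s * M / herm_det P)"
  define B' where "B' = (sqrt (s * M) + B * cmod (P$1$2)) / s"
  note p = posdefD[OF assms]
  have s: "s > 0" using p by (simp add: s_def)
  show "{(c, d). c \<in> R \<and> d \<in> R \<and> herm_form P c d \<le> M} \<subseteq> {c \<in> R. cmod c \<le> B} \<times> {d \<in> R. cmod d \<le> B'}"
  proof
    fix x assume "x \<in> {(c, d). c \<in> R \<and> d \<in> R \<and> herm_form P c d \<le> M}"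
    then obtain c d where x: "x = (c, d)" "c \<in> R" "d \<in> R" "herm_form P c d \<le> M" by auto
    have *: "(cmod (c * P$1$2 + d * of_real s))\<^sup>2 + (cmod c)\<^sup>2 * herm_det P \<le> s * M"
      using x(4) s herm_form_complete_square[of P c d] mult_left_mono[OF x(4), of s] by (simp add: s_def)
    have "(cmod c)\<^sup>2 * herm_det P \<le> s * M" using * zero_le_power2[of "cmod (c * P$1$2 + d * of_real s)"] by linarith
    then have "(cmod c)\<^sup>2 \<le> s * M / herm_det P" using p(3) by (simp add: field_simps)
    then have c: "cmod c \<le> B" unfolding B_def by (rule real_le_rsqrt)
    have "0 \<le> (cmod c)\<^sup>2 * herm_det P" using p(3) by simp
    then have "(cmod (c * P$1$2 + d * of_real s))\<^sup>2 \<le> s * M" using * by linarith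
    then have "cmod (c * P$1$2 + d * of_real s) \<le> sqrt (s * M)" by (rule real_le_rsqrt)
    moreover have "cmod (d * of_real s) \<le> cmod (c * P$1$2 + d * of_real s) + cmod (c * P$1$2)"
      using norm_triangle_ineq4[of "c * P$1$2 + d * of_real s" "c * P$1$2"] by simp
    moreover have "cmod (c * P$1$2) \<le> B * cmod (P$1$2)" using c by (simp add: norm_mult mult_right_mono)
    ultimately have "cmod (d * of_real s) \<le> sqrt (s * M) + B * cmod (P$1$2)" by linarith
    then have "cmod d \<le> B'" using s by (simp add: B'_def norm_mult field_simps)
    then show "x \<in> {c \<in> R. cmod c \<le> B} \<times> {d \<in> R. cmod d \<le> B'}" using c x by auto
  qed
qed (simp add: finite_R_bounded)

text \<open>Among the group elements carrying the wall to a vertical one with the same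
  \<open>n\<close>, one with the least lower right entry exists, since there are only finitely many
  small rows. Were the image of \<open>P\<close> below a hemisphere of its wall, composing with
  \<open>hemisphere_step\<close> would lower the entry further.\<close>

lemma exists_reduced:
  assumes n: "n \<in> adm" and k: "coprime k (int n)" and P: "P \<in> posdef" "wall_fun n k P = 0"
  shows "\<exists>A\<in>S. \<exists>k'. coprime k' (int n) \<and> (\<forall>Q\<in>posdef. wall_fun n k' (herm_act A Q) = wall_fun n k Q) \<and>
            reduced_at n k' (herm_act A P)"
proof -
  define T where "T = {A \<in> S. \<exists>k'. coprime k' (int n) \<and> (\<forall>Q\<in>posdef. wall_fun n k' (herm_act A Q) = wall_fun n k Q)}"
  define h where "h = (\<lambda>(c, d). herm_form P c d)"
  \<comment> \<open>The cut-off is the entry of \<open>P\<close> itself, attained by the row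
    \<open>(0, 1)\<close> of the identity, so \<open>U\<close> is finite and nonempty.\<close>
  define U where "U = (\<lambda>A. (A$2$1, A$2$2)) ` T \<inter> {(c, d). c \<in> R \<and> d \<in> R \<and> herm_form P c d \<le> herm_form P 0 1}"
  have "mat 1 \<in> T" unfolding T_def using S_one k by (auto simp: herm_act_one)
  then have "(0, 1) \<in> U" unfolding U_def by (auto simp: mat_def image_iff intro!: bexI[of _ "mat 1"])
  moreover have "finite U" unfolding U_def using finite_small_rows[OF P(1)] by auto
  ultimately obtain w where w: "w \<in> U" "\<And>v. v \<in> U \<Longrightarrow> h w \<le> h v"
    using ex_min_if_finite[of "h ` U"] by (metis (no_types, lifting) empty_iff finite_imageI image_iff linorder_not_le image_is_empty)
  then obtain A where A: "A \<in> T" "w = (A$2$1, A$2$2)" unfolding U_def by auto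
  have min: "h w \<le> herm_form P (B$2$1) (B$2$2)" if B: "B \<in> T" for B
  proof (cases "herm_form P (B$2$1) (B$2$2) \<le> herm_form P 0 1")
    case True
    have "B \<in> S" using B by (simp add: T_def)
    then have "(B$2$1, B$2$2) \<in> U" using True B S_R unfolding U_def by auto
    then show ?thesis using w(2) by (force simp: h_def)
  next
    case False
    then show ?thesis using w(2)[OF \<open>(0, 1) \<in> U\<close>] by (simp add: h_def)
  qed
  have AS: "A \<in> S" using A(1) by (simp add: T_def)
  obtain k' where k': "coprime k' (int n)" "\<And>Q. Q \<in> posdef \<Longrightarrow> wall_fun n k' (herm_act A Q) = wall_fun n k Q"
    using A(1) unfolding T_def by blast
  let ?P = "herm_act A P"
  have P': "?P \<in> posdef" using S_posdef[OF AS P(1)] .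
  have "reduced_at n k' ?P"
    unfolding reduced_at_def
  proof (intro conjI allI)
    show "?P \<in> posdef" by (rule P')
    show "wall_fun n k' ?P = 0" using k'(2) P by simp
    fix e :: int
    obtain u where u: "[u * nrm e k' = 1] (mod int n)"
      using coprime_nrm[OF n k'(1), of e] cong_solve_coprime_int by (metis mult.commute)
    obtain B where B: "B \<in> S" "B$2$1 = of_nat n" "B$2$2 = - (of_int e + of_int k' * om)" "coprime (u * k') (int n)"
      "\<And>Q. Q \<in> posdef \<Longrightarrow> wall_fun n (u * k') (herm_act B Q) = wall_fun n k' Q"
      using hemisphere_step[OF n k'(1) u cong_refl] by blast
    have "B ** A \<in> T"
      unfolding T_def using S_mult[OF B(1) AS] B(4,5) k'(2) S_posdef[OF AS]
      by (auto simp: herm_act_mult intro!: exI[of _ "u * k'"])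
    then have "h w \<le> herm_form P ((B ** A)$2$1) ((B ** A)$2$2)" by (rule min)
    also have "\<dots> = Re (herm_act (B ** A) P $2$2)" using herm_act_22[OF P(1)] by simp
    also have "\<dots> = herm_form ?P (B$2$1) (B$2$2)" using herm_act_22[OF P'] by (simp add: herm_act_mult)
    finally have "h w \<le> herm_form ?P (of_nat n) (- (of_int e + of_int k' * om))" using B by simp
    moreover have "h w = Re (?P$2$2)" using A(2) herm_act_22[OF P(1), of A] by (simp add: h_def)
    ultimately show "Re (?P$2$2) \<le> herm_form ?P (of_nat n) (- (of_int e + of_int k' * om))" by simp
  qed
  then show ?thesis using AS k' by blast
qed

text \<open>Up to sign, \<open>G\<close> has the bottom row of a matrix from
  \<open>hemisphere_step\<close>, so the two differ by a translation on the left.\<close>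

lemma row_match:
  assumes n: "n \<in> adm" and k: "coprime k (int n)" and G: "G \<in> S" and m: "m = 1 \<or> m = - 1"
    and row: "G$2$1 = of_int m * of_nat n" "G$2$2 = - of_int m * (of_int e + of_int k * om)"
  shows "\<exists>k'. coprime k' (int n) \<and> (\<forall>Q\<in>posdef. wall_fun n k' (herm_act G Q) = wall_fun n k Q)"
proof -
  define G' where "G' = (if m = 1 then G else - G)"
  have G': "G' \<in> S" "G'$2$1 = of_nat n" "G'$2$2 = - (of_int e + of_int k * om)" "herm_act G' Q = herm_act G Q" for Q
    using G m row S_minus[OF G] by (auto simp: G'_def herm_act_minus)
  obtain u where u: "[u * nrm e k = 1] (mod int n)"
    using coprime_nrm[OF n k, of e] cong_solve_coprime_int by (metis mult.commute)
  obtain B where B: "B \<in> S" "B$2$1 = of_nat n" "B$2$2 = - (of_int e + of_int k * om)" "coprime (u * k) (int n)"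
    "\<And>Q. Q \<in> posdef \<Longrightarrow> wall_fun n (u * k) (herm_act B Q) = wall_fun n k Q"
    using hemisphere_step[OF n k u cong_refl] by blast
  obtain N where N: "N \<in> S" "N ** B = mat 1" "B ** N = mat 1" using S_inverse[OF B(1)] by blast
  define T where "T = G' ** N"
  have T: "T \<in> S" unfolding T_def using G' N S_mult by blast
  have "T$2$1 = (B ** N)$2$1" unfolding T_def using G' B by (simp add: matrix_matrix_mult_def sum_2)
  then have "T$2$1 = 0" unfolding N by (simp add: mat_def)
  then obtain j where j: "\<And>n k Q. Q \<in> posdef \<Longrightarrow> wall_fun n (k + int n * j) (herm_act T Q) = wall_fun n k Q"
    using wall_translate(2)[OF _ T] by metis
  have GT: "herm_act G Q = herm_act T (herm_act B Q)" for Q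
    unfolding G'(4)[symmetric] T_def herm_act_mult[symmetric] by (simp add: matrix_mul_assoc[symmetric] N)
  have "wall_fun n (u * k + int n * j) (herm_act G Q) = wall_fun n k Q" if "Q \<in> posdef" for Q
    unfolding GT using j[OF S_posdef[OF B(1) that]] B(5)[OF that] by simp
  moreover have "coprime (u * k + int n * j) (int n)"
    using B(4) by (metis add.commute coprime_iff_gcd_eq_1 gcd.commute gcd_add_mult mult.commute)
  ultimately show ?thesis by blast
qed

lemma same_fraction:
  assumes "P \<in> posdef" "n > 0" "n' > 0" "coprime k (int n)" "coprime k' (int n')" "wall_fun n k P = 0" "wall_fun n' k' P = 0"
  shows "n = n' \<and> k = k'"
proof -
  have s: "Re (P$2$2) > 0" using posdefD assms by simp
  have "real n * yc (P$1$2) = of_int k * Re (P$2$2)" "real n' * yc (P$1$2) = of_int k' * Re (P$2$2)"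
    using assms by (simp_all add: wall_fun_def)
  then have "real n' * (of_int k * Re (P$2$2)) = real n * (of_int k' * Re (P$2$2))" by (metis mult.left_commute)
  then have "real n' * of_int k = real n * of_int k'" using s by simp
  then have "of_int (int n' * k) = (of_int (int n * k') :: real)" by simp
  then have e: "int n' * k = int n * k'" by (simp only: of_int_eq_iff)
  then have "int n dvd int n'" "int n' dvd int n"
    using assms(4,5) by (metis coprime_commute coprime_dvd_mult_left_iff dvd_triv_left)+
  then have "n = n'" by (simp add: dvd_antisym)
  then show ?thesis using e assms by simp
qed

text \<open>Two group elements bring the common point into reduced position, one for each wall. Both
  images are highest in the orbit, so the transition \<open>G\<close> keeps the height, and
  \<open>reduced_rows\<close> leaves for it a translation or a hemisphere of the first wall. In
  either case the first wall becomes a vertical one through the second reduced point, and a point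
  determines the reduced fraction of a vertical wall through it.\<close>

lemma walls_disjoint:
  assumes n: "n \<in> adm" "n' \<in> adm" and k: "coprime k (int n)" "coprime k' (int n')" and g: "g \<in> S" "g' \<in> S"
    and P: "P \<in> posdef" "wall_fun n k (herm_act g P) = 0" "wall_fun n' k' (herm_act g' P) = 0"
  shows "n = n' \<and> (\<forall>Q\<in>posdef. wall_fun n k (herm_act g Q) = wall_fun n' k' (herm_act g' Q))"
proof -
  obtain A k1 where A: "A \<in> S" "coprime k1 (int n)"
    "\<And>Q. Q \<in> posdef \<Longrightarrow> wall_fun n k1 (herm_act A Q) = wall_fun n k Q" "reduced_at n k1 (herm_act A (herm_act g P))"
    using exists_reduced[OF n(1) k(1) S_posdef[OF g(1) P(1)] P(2)] by blast
  obtain A' k1' where A': "A' \<in> S" "coprime k1' (int n')"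
    "\<And>Q. Q \<in> posdef \<Longrightarrow> wall_fun n' k1' (herm_act A' Q) = wall_fun n' k' Q" "reduced_at n' k1' (herm_act A' (herm_act g' P))"
    using exists_reduced[OF n(2) k(2) S_posdef[OF g(2) P(1)] P(3)] by blast
  define M where "M = A ** g"
  define M' where "M' = A' ** g'"
  have MS: "M \<in> S" "M' \<in> S" using A A' g S_mult by (auto simp: M_def M'_def)
  obtain N where N: "N \<in> S" "N ** M = mat 1" "M ** N = mat 1" using S_inverse[OF MS(1)] by blast
  obtain N' where N': "N' \<in> S" "N' ** M' = mat 1" "M' ** N' = mat 1" using S_inverse[OF MS(2)] by blast
  define G where "G = M' ** N"
  have GS: "G \<in> S" "M ** N' \<in> S" using MS N N' S_mult by (auto simp: G_def)
  have GM: "herm_act G (herm_act M Q) = herm_act M' Q" for Q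
    unfolding G_def herm_act_mult[symmetric] by (simp add: matrix_mul_assoc[symmetric] N)
  have GM': "herm_act (M ** N') (herm_act M' Q) = herm_act M Q" for Q
    unfolding herm_act_mult[symmetric] by (simp add: matrix_mul_assoc[symmetric] N')
  have rM: "reduced_at n k1 (herm_act M P)" and rM': "reduced_at n' k1' (herm_act M' P)"
    using A(4) A'(4) by (simp_all add: M_def M'_def herm_act_mult)
  have pM: "herm_act M P \<in> posdef" using S_posdef MS P by blast
  have "Re (herm_act M P$2$2) \<le> Re (herm_act M' P$2$2)" "Re (herm_act M' P$2$2) \<le> Re (herm_act M P$2$2)"
    using reduced_minimal[OF n(1) A(2) rM GS(1)] reduced_minimal[OF n(2) A'(2) rM' GS(2)] unfolding GM GM' by auto
  then have "Re (herm_act G (herm_act M P)$2$2) \<le> Re (herm_act M P$2$2)" unfolding GM by simp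
  then have "herm_form (herm_act M P) (G$2$1) (G$2$2) \<le> Re (herm_act M P$2$2)"
    unfolding herm_act_22[OF pM] by simp
  then consider "G$2$1 = 0" | e m :: int where "m = 1 \<or> m = - 1" "G$2$1 = of_int m * of_nat n" "G$2$2 = - of_int m * (of_int e + of_int k1 * om)"
    using reduced_rows[OF n(1) A(2) rM S_R[OF GS(1)] S_R[OF GS(1)]] by metis
  then obtain k2 where k2: "coprime k2 (int n)" "\<And>Q. Q \<in> posdef \<Longrightarrow> wall_fun n k2 (herm_act G Q) = wall_fun n k1 Q"
  proof cases
    case 1
    obtain j where j: "\<And>Q. Q \<in> posdef \<Longrightarrow> wall_fun n (k1 + int n * j) (herm_act G Q) = wall_fun n k1 Q"
      using wall_translate(2)[OF P(1) GS(1) 1] by blast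
    have "coprime (k1 + int n * j) (int n)"
      using A(2) by (metis add.commute coprime_iff_gcd_eq_1 gcd.commute gcd_add_mult mult.commute)
    then show ?thesis using j that by blast
  next
    case 2
    then show ?thesis using row_match[OF n(1) A(2) GS(1)] that by blast
  qed
  have "wall_fun n k2 (herm_act M' P) = 0" using k2(2)[OF pM] rM unfolding GM by (simp add: reduced_at_def)
  moreover have "wall_fun n' k1' (herm_act M' P) = 0" using rM' by (simp add: reduced_at_def)
  ultimately have eq: "n = n'" "k2 = k1'"
    using same_fraction[of "herm_act M' P" n n' k2 k1'] S_posdef[OF MS(2) P(1)] k2(1) A'(2) adm_pos n by auto
  have "wall_fun n k (herm_act g Q) = wall_fun n' k' (herm_act g' Q)" if Q: "Q \<in> posdef" for Q
  proof -
    have "wall_fun n k (herm_act g Q) = wall_fun n k1 (herm_act M Q)"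
      using A(3)[OF S_posdef[OF g(1) Q]] by (simp add: M_def herm_act_mult)
    also have "\<dots> = wall_fun n k2 (herm_act M' Q)" using k2(2)[OF S_posdef[OF MS(1) Q]] by (simp add: GM)
    also have "\<dots> = wall_fun n' k' (herm_act g' Q)"
      using A'(3)[OF S_posdef[OF g(2) Q]] by (simp add: eq M'_def herm_act_mult)
    finally show ?thesis .
  qed
  then show ?thesis using eq by blast
qed

definition high :: "complex^2^2 \<Rightarrow> bool" where
  "high P \<longleftrightarrow> P \<in> posdef \<and> (\<forall>c\<in>R. \<forall>d\<in>R. c \<noteq> 0 \<longrightarrow> herm_form P c d > Re (P$2$2))"

text \<open>Reducing a point on the wall cannot increase the entry, but above all hemispheres only
  translations avoid increasing it. So the reducing element is a translation and the wall was
  vertical already.\<close>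

lemma wall_through_high:
  assumes n: "n \<in> adm" and k: "coprime k (int n)" and g: "g \<in> S"
    and P: "high P" "wall_fun n k (herm_act g P) = 0"
  shows "\<exists>k'. coprime k' (int n) \<and> (\<forall>Q\<in>posdef. wall_fun n k (herm_act g Q) = wall_fun n k' Q)"
proof -
  have Pp: "P \<in> posdef" using P by (simp add: high_def)
  obtain A k1 where A: "A \<in> S" "coprime k1 (int n)"
    "\<And>Q. Q \<in> posdef \<Longrightarrow> wall_fun n k1 (herm_act A Q) = wall_fun n k Q" "reduced_at n k1 (herm_act A (herm_act g P))"
    using exists_reduced[OF n k S_posdef[OF g Pp] P(2)] by blast
  define M where "M = A ** g"
  have MS: "M \<in> S" using A g S_mult by (auto simp: M_def)
  obtain N where N: "N \<in> S" "N ** M = mat 1" "M ** N = mat 1" using S_inverse[OF MS] by blast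
  have "Re (herm_act M P$2$2) \<le> Re (herm_act N (herm_act M P)$2$2)"
    using reduced_minimal[OF n A(2) _ N(1)] A(4) by (simp add: M_def herm_act_mult)
  also have "herm_act N (herm_act M P) = P" unfolding herm_act_mult[symmetric] N by (rule herm_act_one)
  finally have "herm_form P (M$2$1) (M$2$2) \<le> Re (P$2$2)" using herm_act_22[OF Pp, of M] by simp
  then have "M$2$1 = 0" using P(1) S_R[OF MS] unfolding high_def by (metis not_less)
  then obtain j where j: "\<And>n k Q. Q \<in> posdef \<Longrightarrow> wall_fun n (k + int n * j) (herm_act M Q) = wall_fun n k Q"
    using wall_translate(2)[OF Pp MS] by blast
  have "wall_fun n k (herm_act g Q) = wall_fun n (k1 - int n * j) Q" if Q: "Q \<in> posdef" for Q
    using A(3)[OF S_posdef[OF g Q]] j[OF Q, of n "k1 - int n * j"] by (simp add: M_def herm_act_mult)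
  moreover have "coprime (k1 - int n * j) (int n)"
  proof -
    have "k1 - int n * j = (- j) * int n + k1" by simp
    then show ?thesis using A(2) by (metis coprime_iff_gcd_eq_1 gcd.commute gcd_add_mult)
  qed
  ultimately show ?thesis by blast
qed

text \<open>Every wall is the zero set of an indefinite Hermitian form with coefficients in
  lattices, and the group preserves its discriminant \<open>n\<^sup>2\<close>. Once the coefficients
  are bounded, only finitely many walls remain.\<close>

lemma wall_coefficients:
  assumes g: "g \<in> S"
  shows "\<exists>(A::int) (C::int) \<beta>. \<beta> \<in> R \<and>
     (\<forall>Q\<in>posdef. wall_fun n k (herm_act g Q) = of_int A * Re (Q$1$1) + Im (\<beta> * Q$1$2) / q + of_int C * Re (Q$2$2)) \<and>
     (cmod \<beta>)\<^sup>2 - 4 * q\<^sup>2 * (of_int A * of_int C) = (real n)\<^sup>2"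
proof -
  define a b c d where abcd: "a = g$1$1" "b = g$1$2" "c = g$2$1" "d = g$2$2"
  have RR: "a \<in> R" "b \<in> R" "c \<in> R" "d \<in> R" using S_R[OF g] by (auto simp: abcd)
  have det: "a * d - b * c = 1" using S_det[OF g] by (simp add: det_2 abcd)
  define r where "r = om - cnj om"
  have r: "r = Complex 0 (2 * q)" by (simp add: r_def om_def complex_eq_iff)
  have rR: "r \<in> R" unfolding r_def using RI[of 0 1] by (intro R_diff R_cnj) auto
  obtain x1 x2 y1 y2 where xy: "c = of_int x1 + of_int x2 * om" "d = of_int y1 + of_int y2 * om"
    using RR unfolding R_def by blast
  obtain A1 C1 :: int where A1: "yc (a * cnj c) = of_int A1" and C1: "yc (b * cnj d) = of_int C1"
    using yc_R R_mult R_cnj RR by meson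
  define A where "A = int n * A1 - k * nrm x1 x2"
  define C where "C = int n * C1 - k * nrm y1 y2"
  define \<beta> where "\<beta> = of_nat n * (a * cnj d - cnj b * c) - of_int k * r * c * cnj d"
  have bR: "\<beta> \<in> R"
    unfolding \<beta>_def using RR rR R_of_int[of "int n"] by (auto intro!: R_diff R_mult R_cnj simp del: of_int_of_nat_eq)
       (simp_all add: R_of_int[of "int n", simplified])
  have cc: "c * cnj c = of_int (nrm x1 x2)" "d * cnj d = of_int (nrm y1 y2)" using xy nrm_eq by auto
  have ccr: "(cmod c)\<^sup>2 = of_int (nrm x1 x2)" "(cmod d)\<^sup>2 = of_int (nrm y1 y2)"
    using cc by (metis complex_norm_square of_real_eq_iff of_real_of_int_eq)+
  have val: "wall_fun n k (herm_act g Q) = of_int A * Re (Q$1$1) + Im (\<beta> * Q$1$2) / q + of_int C * Re (Q$2$2)"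
    if Q: "Q \<in> posdef" for Q
  proof -
    define p z s where pzs: "p = Re (Q$1$1)" "z = Q$1$2" "s = Re (Q$2$2)"
    have Q': "Q$1$1 = of_real p" "Q$1$2 = z" "Q$2$1 = cnj z" "Q$2$2 = of_real s"
      using posdefD[OF Q] by (auto simp: pzs complex_eq_iff)
    have w12: "herm_act g Q$1$2 = of_real p * (a * cnj c) + a * z * cnj d + b * cnj z * cnj c + of_real s * (b * cnj d)"
      unfolding herm_act_nth Q' abcd by (simp add: algebra_simps)
    have w22: "Re (herm_act g Q$2$2) = (cmod c)\<^sup>2 * p + 2 * Re (c * z * cnj d) + (cmod d)\<^sup>2 * s"
      using herm_act_22[OF Q, of g] by (simp only: herm_form_def abcd pzs Re_complex_of_real)
    have "Im (herm_act g Q$1$2) = p * Im (a * cnj c) + Im (a * z * cnj d) + Im (b * cnj z * cnj c) + s * Im (b * cnj d)"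
      unfolding w12 by (simp add: algebra_simps)
    also have "Im (b * cnj z * cnj c) = - Im (cnj b * c * z)" by (simp add: algebra_simps)
    finally have i12: "Im (herm_act g Q$1$2) = q * (of_int A1 * p + of_int C1 * s) + Im ((a * cnj d - cnj b * c) * z)"
      using A1 C1 unfolding Im_eq[of "a * cnj c"] Im_eq[of "b * cnj d"] by (simp add: algebra_simps)
    have "Im (\<beta> * z) = real n * Im ((a * cnj d - cnj b * c) * z) - of_int k * Im (r * (c * z * cnj d))"
      unfolding \<beta>_def by (simp add: algebra_simps)
    also have "Im (r * (c * z * cnj d)) = 2 * q * Re (c * z * cnj d)"
      unfolding r by simp
    finally have bz: "Im (\<beta> * z) / q = real n * Im ((a * cnj d - cnj b * c) * z) / q - of_int k * (2 * Re (c * z * cnj d))"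
      using q_gt_1 by (simp add: field_simps)
    have "yc (herm_act g Q$1$2) = of_int A1 * p + of_int C1 * s + Im ((a * cnj d - cnj b * c) * z) / q"
      unfolding yc_def i12 using q_gt_1 by (simp add: field_simps)
    then show ?thesis
      unfolding wall_fun_def w22 ccr Q'(2) bz A_def C_def pzs(1,3)[symmetric] by (simp add: algebra_simps)
  qed
  \<comment> \<open>The factor \<open>r = om - cnj om = 2 * q * \<i>\<close> turns
    \<open>yc x\<close> into \<open>x - cnj x\<close>; the discriminant then reduces to the
    polynomial identity \<open>alg\<close>.\<close>
  have "r * of_int A = of_nat n * (r * of_real (yc (a * cnj c))) - of_int k * r * (c * cnj c)"
    unfolding A_def A1 cc by (simp add: algebra_simps)
  also have "r * of_real (yc (a * cnj c)) = a * cnj c - cnj a * c"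
    using q_gt_1 unfolding r yc_def by (simp add: complex_eq_iff)
  finally have rA: "r * of_int A = of_nat n * (a * cnj c - cnj a * c) - of_int k * r * (c * cnj c)" .
  have "r * of_int C = of_nat n * (r * of_real (yc (b * cnj d))) - of_int k * r * (d * cnj d)"
    unfolding C_def C1 cc by (simp add: algebra_simps)
  also have "r * of_real (yc (b * cnj d)) = b * cnj d - cnj b * d"
    using q_gt_1 unfolding r yc_def by (simp add: complex_eq_iff)
  finally have rC: "r * of_int C = of_nat n * (b * cnj d - cnj b * d) - of_int k * r * (d * cnj d)" .
  have alg: "(N * (a * d' - b' * c) - K * r * c * d') * (N * (a' * d - b * c') + K * r * c' * d)
      + (N * (a * c' - a' * c) - K * r * (c * c')) * (N * (b * d' - b' * d) - K * r * (d * d'))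
     = N * N * ((a * d - b * c) * (a' * d' - b' * c'))" for N K a' b' c' d' :: complex
    by (simp add: algebra_simps)
  have cb: "cnj \<beta> = of_nat n * (cnj a * d - b * cnj c) + of_int k * r * cnj c * d"
    unfolding \<beta>_def by (simp add: r_def algebra_simps)
  have "\<beta> * cnj \<beta> + (r * of_int A) * (r * of_int C) = of_nat n * of_nat n * ((a * d - b * c) * cnj (a * d - b * c))"
    unfolding cb rA rC unfolding \<beta>_def alg by simp
  also have "\<dots> = of_nat n * of_nat n" unfolding det by simp
  also have "(r * of_int A) * (r * of_int C) = - of_real (4 * q\<^sup>2 * (of_int A * of_int C))"
    unfolding r by (simp add: complex_eq_iff power2_eq_square)
  also have "\<beta> * cnj \<beta> = of_real ((cmod \<beta>)\<^sup>2)" by (rule complex_norm_square[symmetric])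
  finally have "of_real ((cmod \<beta>)\<^sup>2 - 4 * q\<^sup>2 * (of_int A * of_int C)) = (of_real ((real n)\<^sup>2) :: complex)"
    by (simp add: power2_eq_square)
  then have "(cmod \<beta>)\<^sup>2 - 4 * q\<^sup>2 * (of_int A * of_int C) = (real n)\<^sup>2" by (simp only: of_real_eq_iff)
  then show ?thesis using bR val by blast
qed

section \<open>The walls\<close>

text \<open>The value 0 outside \<open>posdef\<close> makes equality of functions equality on the
  cone. Functions are used in place of zero sets so that \<open>F\<close> and \<open>neg F\<close>
  can stand for the two sides.\<close>

definition wallf :: "nat \<Rightarrow> int \<Rightarrow> complex^2^2 \<Rightarrow> complex^2^2 \<Rightarrow> real" where
  "wallf n k g = (\<lambda>P. if P \<in> posdef then wall_fun n k (herm_act g P) else 0)"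

definition walls :: "(complex^2^2 \<Rightarrow> real) set" where
  "walls = {wallf n k g | n k g. n \<in> adm \<and> coprime k (int n) \<and> g \<in> S}"

definition neg :: "(complex^2^2 \<Rightarrow> real) \<Rightarrow> complex^2^2 \<Rightarrow> real" where
  "neg F = (\<lambda>P. - F P)"

definition HS :: "(complex^2^2 \<Rightarrow> real) set" where "HS = walls \<union> neg ` walls"

text \<open>Inclusion of positive sides, and of negative sides in the reverse direction; the
  symmetric form makes passage to opposites immediate.\<close>

definition hs_le :: "(complex^2^2 \<Rightarrow> real) \<Rightarrow> (complex^2^2 \<Rightarrow> real) \<Rightarrow> bool" where
  "hs_le F G \<longleftrightarrow> (\<forall>P\<in>posdef. (F P > 0 \<longrightarrow> G P > 0) \<and> (G P < 0 \<longrightarrow> F P < 0))"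

text \<open>The point over \<open>\<i> q y\<close> at height \<open>sqrt 2\<close>, above all hemispheres.\<close>
definition hp :: "real \<Rightarrow> complex^2^2" where
  "hp y = mat2 (of_real (q\<^sup>2 * y\<^sup>2 + 2)) (Complex 0 (q * y)) (Complex 0 (- (q * y))) 1"

lemma neg_neg [simp]: "neg (neg F) = F" by (simp add: neg_def)

lemma neg_apply: "neg F P = - F P" by (simp add: neg_def)

lemma hp_posdef: "hp y \<in> posdef" and hp_det: "herm_det (hp y) = 2"
proof -
  show *: "herm_det (hp y) = 2"
    by (simp add: herm_det_def hp_def cmod_power2 power_mult_distrib)
  show "hp y \<in> posdef" unfolding posdef_def using * by (simp add: hp_def complex_eq_iff)
qed

lemma hp_wall: "wall_fun n k (hp y) = real n * y - of_int k"
  using q_gt_1 by (simp add: wall_fun_def yc_def hp_def)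

lemma R_cmod_ge_1:
  assumes "c \<in> R" "c \<noteq> 0" shows "(cmod c)\<^sup>2 \<ge> 1"
proof -
  obtain x y where c: "c = of_int x + of_int y * om" using assms unfolding R_def by blast
  have e: "(cmod c)\<^sup>2 = of_int (nrm x y)"
    using nrm_eq[of x y] unfolding c[symmetric] by (metis complex_norm_square of_real_eq_iff of_real_of_int_eq)
  have "(cmod c)\<^sup>2 > 0" using assms by simp
  then have "nrm x y > 0" unfolding e by simp
  then show ?thesis unfolding e by simp
qed

text \<open>Nonzero elements of \<open>R\<close> have absolute value at least 1, so no hemisphere
  rises above height 1.\<close>

lemma highI:
  assumes "P \<in> posdef" "Re (P$2$2) = 1" "herm_det P > 1"
  shows "high P"
  unfolding high_def
proof (intro conjI ballI impI)
  fix c d assume "c \<in> R" "d \<in> R" "c \<noteq> 0"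
  then have "1 * herm_det P \<le> (cmod c)\<^sup>2 * herm_det P"
    using R_cmod_ge_1[of c] assms(3) by (intro mult_right_mono) auto
  then have "1 < (cmod (c * P$1$2 + d * of_real (Re (P$2$2))))\<^sup>2 + (cmod c)\<^sup>2 * herm_det P"
    using assms(3) zero_le_power2[of "cmod (c * P$1$2 + d * of_real (Re (P$2$2)))"] by linarith
  then show "Re (P$2$2) < herm_form P c d" using herm_form_complete_square[of P c d] assms(2) by simp
qed (rule assms)

lemma segment_posdef: "P \<in> posdef \<Longrightarrow> Q \<in> posdef \<Longrightarrow> 0 \<le> t \<Longrightarrow> t \<le> 1 \<Longrightarrow> (1 - t) *\<^sub>R P + t *\<^sub>R Q \<in> posdef"
  by (rule posdef_convex) auto

lemma hp_segment_high:
  assumes "0 \<le> t" "t \<le> 1"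
  shows "high ((1 - t) *\<^sub>R hp y + t *\<^sub>R hp y')"
proof (rule highI)
  let ?P = "(1 - t) *\<^sub>R hp y + t *\<^sub>R hp y'"
  show "?P \<in> posdef" using assms hp_posdef segment_posdef by blast
  show "Re (?P$2$2) = 1" by (simp add: hp_def)
  have "herm_det ?P = 2 + q\<^sup>2 * (t * (1 - t) * (y - y')\<^sup>2)"
    unfolding herm_det_def cmod_power2 by (simp add: hp_def algebra_simps power2_eq_square)
  moreover have "q\<^sup>2 * (t * (1 - t) * (y - y')\<^sup>2) \<ge> 0" using assms by simp
  ultimately show "herm_det ?P > 1" by linarith
qed

lemma hs_linear:
  assumes "F \<in> HS" "P \<in> posdef" "Q \<in> posdef" "0 \<le> t" "t \<le> 1"
  shows "F ((1 - t) *\<^sub>R P + t *\<^sub>R Q) = (1 - t) * F P + t * F Q"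
proof -
  have lin: "wallf n k g ((1 - t) *\<^sub>R P + t *\<^sub>R Q) = (1 - t) * wallf n k g P + t * wallf n k g Q" for n k g
    using segment_posdef[OF assms(2-5)] assms(2,3) unfolding wallf_def wall_fun_def yc_def herm_act_linear
    by (simp add: algebra_simps add_divide_distrib diff_divide_distrib)
  show ?thesis using assms(1) lin unfolding HS_def walls_def neg_def by (auto simp: algebra_simps)
qed

lemma hs_zero_on_segment:
  assumes "F \<in> HS" "P \<in> posdef" "Q \<in> posdef" "F P \<le> 0" "F Q \<ge> 0"
  obtains t where "0 \<le> t" "t \<le> 1" "F ((1 - t) *\<^sub>R P + t *\<^sub>R Q) = 0"
proof (cases "F P = 0")
  case True
  then show ?thesis using that[of 0] by simp
next
  case False
  define t where "t = F P / (F P - F Q)"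
  have t: "0 \<le> t" "t \<le> 1" using assms(4,5) False by (auto simp: t_def field_simps divide_nonpos_neg)
  have "(1 - t) * F P + t * F Q = F P - t * (F P - F Q)" by (simp add: algebra_simps)
  also have "\<dots> = 0" using assms(4,5) False by (simp add: t_def)
  finally show ?thesis using that[OF t] hs_linear[OF assms(1-3) t] by simp
qed

lemma neg_HS: "F \<in> HS \<Longrightarrow> neg F \<in> HS" by (auto simp: HS_def)

lemma walls_HS: "F \<in> walls \<Longrightarrow> F \<in> HS" by (simp add: HS_def)

lemma walls_common_zero:
  assumes "n \<in> adm" "n' \<in> adm" "coprime k (int n)" "coprime k' (int n')" "g \<in> S" "g' \<in> S"
    and "P \<in> posdef" "wallf n k g P = 0" "wallf n' k' g' P = 0"
  shows "n = n' \<and> wallf n k g = wallf n' k' g'"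
  using walls_disjoint[OF assms(1-7)] assms(7-9) unfolding wallf_def by auto

lemma hs_common_zero:
  assumes "F \<in> HS" "G \<in> HS" "P \<in> posdef" "F P = 0" "G P = 0"
  shows "F = G \<or> F = neg G"
proof -
  have *: "F = G" if "F \<in> walls" "G \<in> walls" "F P = 0" "G P = 0" for F G
    using that walls_common_zero assms(3) unfolding walls_def by blast
  obtain F' where F': "F' \<in> walls" "F = F' \<or> F = neg F'" "F' P = 0" using assms unfolding HS_def by (auto simp: neg_apply)
  obtain G' where G': "G' \<in> walls" "G = G' \<or> G = neg G'" "G' P = 0" using assms unfolding HS_def by (auto simp: neg_apply)
  have "F' = G'" using * F' G' by blast
  then show ?thesis using F' G' by auto
qed

lemma wall_point:
  assumes "n \<in> adm" "g \<in> S"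
  obtains P where "P \<in> posdef" "wallf n k g P = v"
proof -
  obtain B where B: "B \<in> S" "g ** B = mat 1" using S_inverse[OF assms(2)] by metis
  let ?P = "herm_act B (hp ((v + of_int k) / real n))"
  have P: "?P \<in> posdef" using S_posdef[OF B(1) hp_posdef] .
  have "wallf n k g ?P = wall_fun n k (hp ((v + of_int k) / real n))"
    using P unfolding wallf_def by (simp add: herm_act_mult[symmetric] B herm_act_one)
  also have "\<dots> = v" unfolding hp_wall using adm_pos[OF assms(1)] by simp
  finally show ?thesis using that P by blast
qed

lemma hs_point:
  assumes "F \<in> HS" obtains P where "P \<in> posdef" "F P = v"
proof -
  consider "F \<in> walls" | "neg F \<in> walls" using assms unfolding HS_def by auto
  then show ?thesis
  proof cases
    case 1
    then show ?thesis using wall_point that unfolding walls_def by auto metis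
  next
    case 2
    then obtain n k g where g: "neg F = wallf n k g" "n \<in> adm" "g \<in> S" unfolding walls_def by auto
    obtain P where "P \<in> posdef" "neg F P = - v" using wall_point[OF g(2,3)] g(1) by metis
    then show ?thesis using that by (simp add: neg_apply)
  qed
qed

text \<open>Well defined because two descriptions of one wall function share a zero, where
  \<open>walls_disjoint\<close> identifies the denominators.\<close>

definition wall_idx :: "(complex^2^2 \<Rightarrow> real) \<Rightarrow> nat" where
  "wall_idx F = (THE n. n \<in> adm \<and> (\<exists>k g. coprime k (int n) \<and> g \<in> S \<and> F = wallf n k g))"

lemma wall_idx: 
  assumes "n \<in> adm" "coprime k (int n)" "g \<in> S"
  shows "wall_idx (wallf n k g) = n"
  unfolding wall_idx_def
proof (rule the_equality)
  fix n' assume n': "n' \<in> adm \<and> (\<exists>k' g'. coprime k' (int n') \<and> g' \<in> S \<and> wallf n k g = wallf n' k' g')"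
  then obtain k' g' where k': "coprime k' (int n')" "g' \<in> S" "wallf n k g = wallf n' k' g'" by blast
  obtain P where "P \<in> posdef" "wallf n k g P = 0" using wall_point[OF assms(1,3)] by blast
  then show "n' = n" using walls_common_zero[of n n' k k' g g' P] assms n' k' by auto
qed (use assms in blast)

text \<open>The group never exchanges the sides of a wall, so signs of labels are consistent. A wall
  and its opposite have a common zero; if both were walls they would be equal, yet a wall function
  takes the value 1.\<close>

lemma neg_not_wall:
  assumes "F \<in> walls" shows "neg F \<notin> walls"
proof
  assume n: "neg F \<in> walls"
  obtain P where P: "P \<in> posdef" "F P = 0" using hs_point walls_HS[OF assms] by metis
  obtain n k g n' k' g' where e: "F = wallf n k g" "neg F = wallf n' k' g'" "n \<in> adm" "n' \<in> adm"
     "coprime k (int n)" "coprime k' (int n')" "g \<in> S" "g' \<in> S" using assms n unfolding walls_def by auto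
  have "F = neg F"
    using walls_common_zero[OF e(3-8) P(1)] P(2) e(1,2) by (metis neg_apply neg_equal_0_iff_equal)
  moreover obtain Q where "Q \<in> posdef" "F Q = 1" using hs_point walls_HS[OF assms] by metis
  ultimately have "neg F Q = 1" by simp
  then show False using \<open>F Q = 1\<close> by (simp add: neg_apply)
qed

lemma finite_adm: "finite adm"
proof (rule finite_subset)
  show "adm \<subseteq> {..nat (- D)}"
  proof
    fix n assume "n \<in> adm"
    then have "4 * (int n)\<^sup>2 < - D" by (simp add: adm_def)
    moreover have "int n * 1 \<le> int n * int n" by (cases n) (simp, intro mult_left_mono, auto)
    ultimately have "int n \<le> - D" unfolding power2_eq_square by linarith
    then show "n \<in> {..nat (- D)}" by (simp add: le_nat_iff)
  qed
qed auto

definition idx :: "nat \<Rightarrow> nat" where "idx = (SOME f. bij_betw f adm {..<card adm})"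

lemma idx_bij: "bij_betw idx adm {..<card adm}"
proof -
  have "\<exists>f. bij_betw f adm {..<card adm}"
    using ex_bij_betw_finite_nat[OF finite_adm] by (simp add: atLeast0LessThan)
  then show ?thesis unfolding idx_def by (rule someI_ex)
qed

definition hs_lab :: "(complex^2^2 \<Rightarrow> real) \<Rightarrow> nat \<times> bool" where
  "hs_lab F = (if F \<in> walls then (idx (wall_idx F), True) else (idx (wall_idx (neg F)), False))"

lemma hs_le_refl: "hs_le F F" by (simp add: hs_le_def)

lemma hs_le_neg: "hs_le F G \<Longrightarrow> hs_le (neg G) (neg F)" by (simp add: hs_le_def neg_apply)

lemma hs_not_le:
  assumes "\<not> hs_le F G" obtains P where "P \<in> posdef" "F P \<ge> 0" "G P \<le> 0"
  using assms unfolding hs_le_def by (metis less_imp_le not_le)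

text \<open>If all four quadrants were met, two segments would give points with \<open>G = 0\<close>
  and weakly opposite signs of \<open>F\<close>. On the segment joining them \<open>F\<close>
  vanishes as well, so the two walls coincide up to sign.\<close>

lemma hs_nested:
  assumes F: "F \<in> HS" and G: "G \<in> HS"
  shows "hs_le F G \<or> hs_le G F \<or> hs_le F (neg G) \<or> hs_le (neg G) F"
proof (rule ccontr)
  assume "\<not> ?thesis"
  then have n: "\<not> hs_le F G" "\<not> hs_le G F" "\<not> hs_le F (neg G)" "\<not> hs_le (neg G) F" by auto
  obtain p1 where p1: "p1 \<in> posdef" "F p1 \<ge> 0" "G p1 \<le> 0" using hs_not_le[OF n(1)] by metis
  obtain p2 where p2: "p2 \<in> posdef" "F p2 \<le> 0" "G p2 \<ge> 0" using hs_not_le[OF n(2)] by metis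
  obtain p3 where p3: "p3 \<in> posdef" "F p3 \<ge> 0" "G p3 \<ge> 0" using hs_not_le[OF n(3)] by (auto simp: neg_apply)
  obtain p4 where p4: "p4 \<in> posdef" "F p4 \<le> 0" "G p4 \<le> 0" using hs_not_le[OF n(4)] by (auto simp: neg_apply)
  obtain t where t: "0 \<le> t" "t \<le> 1" "G ((1 - t) *\<^sub>R p1 + t *\<^sub>R p3) = 0"
    using hs_zero_on_segment[OF G p1(1) p3(1)] p1 p3 by metis
  obtain u where u: "0 \<le> u" "u \<le> 1" "G ((1 - u) *\<^sub>R p4 + u *\<^sub>R p2) = 0"
    using hs_zero_on_segment[OF G p4(1) p2(1)] p4 p2 by metis
  define r1 where "r1 = (1 - t) *\<^sub>R p1 + t *\<^sub>R p3"
  define r2 where "r2 = (1 - u) *\<^sub>R p4 + u *\<^sub>R p2"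
  have r: "r1 \<in> posdef" "r2 \<in> posdef" using segment_posdef p1 p2 p3 p4 t u by (auto simp: r1_def r2_def)
  have "F r1 = (1 - t) * F p1 + t * F p3" unfolding r1_def using hs_linear[OF F p1(1) p3(1) t(1,2)] .
  then have r1: "F r1 \<ge> 0" using p1 p3 t by simp
  have "F r2 = (1 - u) * F p4 + u * F p2" unfolding r2_def using hs_linear[OF F p4(1) p2(1) u(1,2)] .
  moreover have "(1 - u) * F p4 \<le> 0" "u * F p2 \<le> 0" using p4 p2 u by (auto intro: mult_nonneg_nonpos)
  ultimately have r2: "F r2 \<le> 0" by linarith
  obtain v where v: "0 \<le> v" "v \<le> 1" "F ((1 - v) *\<^sub>R r2 + v *\<^sub>R r1) = 0"
    using hs_zero_on_segment[OF F r(2,1) r2 r1] by metis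
  have "G ((1 - v) *\<^sub>R r2 + v *\<^sub>R r1) = 0"
    using hs_linear[OF G r(2,1) v(1,2)] t(3) u(3) by (simp add: r1_def r2_def)
  then have "F = G \<or> F = neg G"
    using hs_common_zero[OF F G segment_posdef[OF r(2,1) v(1,2)] v(3)] by blast
  then show False using n hs_le_refl by auto
qed

sublocale hs: halfspaces HS neg hs_le hs_lab
proof
  fix h k l assume h: "h \<in> HS"
  show "neg h \<in> HS" using h by (rule neg_HS)
  show "neg (neg h) = h" by simp
  show "\<not> hs_le h (neg h)"
  proof
    assume le: "hs_le h (neg h)"
    obtain P where "P \<in> posdef" "h P = 1" using hs_point[OF h] by blast
    then show False using le by (auto simp: hs_le_def neg_apply)
  qed
  show "hs_le h h" by (rule hs_le_refl)
  show "hs_lab (neg h) = inv_letter (hs_lab h)"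
    using h neg_not_wall unfolding hs_lab_def inv_letter_def HS_def by auto
  assume k: "k \<in> HS"
  show "hs_le h k \<Longrightarrow> hs_le (neg k) (neg h)" by (rule hs_le_neg)
  show "hs_le h k \<or> hs_le k h \<or> hs_le h (neg k) \<or> hs_le (neg k) h" using hs_nested[OF h k] .
  show "hs_le h k \<Longrightarrow> hs_le k l \<Longrightarrow> hs_le h l" unfolding hs_le_def by blast
  assume le: "hs_le h k" "hs_le k h"
  obtain P where P: "P \<in> posdef" "h P = 0" using hs_point[OF h] by blast
  have "k P = 0" using le P unfolding hs_le_def by (metis less_irrefl linorder_neqE_linordered_idom)
  then have "h = k \<or> h = neg k" using hs_common_zero[OF h k P] by blast
  moreover obtain Q where "Q \<in> posdef" "h Q = 1" using hs_point[OF h] by blast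
  ultimately show "h = k" using le(1) by (auto simp: hs_le_def neg_apply)
qed

section \<open>Points as orientations and local finiteness of the walls\<close>

definition side :: "complex^2^2 \<Rightarrow> (complex^2^2 \<Rightarrow> real) set" where
  "side P = {F \<in> HS. F P > 0}"

definition offwall :: "complex^2^2 \<Rightarrow> bool" where
  "offwall P \<longleftrightarrow> P \<in> posdef \<and> (\<forall>F\<in>HS. F P \<noteq> 0)"

lemma side_orientation: "offwall P \<Longrightarrow> hs.orientation (side P)"
  unfolding hs.orientation_def side_def offwall_def using neg_HS
  by (auto simp: neg_apply hs_le_def neg_less_iff_less)

text \<open>Along the segment the determinant is bounded below and the entries are bounded. At a
  zero of the wall this bounds the coefficients \<open>A\<close>, \<open>\<beta>\<close> and
  \<open>C\<close> in turn, which leaves finitely many forms.\<close>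

lemma finite_walls_segment:
  assumes P0: "P0 \<in> posdef" and P1: "P1 \<in> posdef"
  shows "finite {F \<in> walls. \<exists>t. 0 \<le> t \<and> t \<le> 1 \<and> F ((1 - t) *\<^sub>R P0 + t *\<^sub>R P1) = 0}"
proof (rule finite_subset)
  define s0 where "s0 = min (Re (P0$2$2)) (Re (P1$2$2))"
  define s1 where "s1 = max (Re (P0$2$2)) (Re (P1$2$2))"
  define p1 where "p1 = Re (P0$1$1) + Re (P1$1$1)"
  define z1 where "z1 = cmod (P0$1$2) + cmod (P1$1$2)"
  \<comment> \<open>Half of the smaller determinant suffices because
    \<open>(1 - t)\<^sup>2 + t\<^sup>2 \<ge> 1/2\<close>.\<close>
  define dm where "dm = min (herm_det P0) (herm_det P1) / 2"
  define a0 where "a0 = s1 / sqrt dm"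
  define b0 where "b0 = 2 * q * ((s1 + a0 * z1) / s0)"
  define c0 where "c0 = (a0 * p1 + b0 * z1 / q) / s0"
  note D0 = posdefD[OF P0] and D1 = posdefD[OF P1]
  have pos: "s0 > 0" "dm > 0" "p1 > 0" "z1 \<ge> 0" "s1 > 0"
    using D0 D1 by (auto simp: s0_def dm_def p1_def z1_def s1_def)
  then have a0: "a0 > 0" by (simp add: a0_def)
  then have b0: "b0 > 0" using pos q_gt_1 by (auto simp: b0_def intro!: mult_pos_pos divide_pos_pos add_pos_nonneg)
  define E where "E = (\<lambda>(A::int, C::int, \<beta>::complex) Q. if Q \<in> posdef
     then of_int A * Re (Q$1$1) + Im (\<beta> * Q$1$2) / q + of_int C * Re (Q$2$2) else 0)"
  show "{F \<in> walls. \<exists>t. 0 \<le> t \<and> t \<le> 1 \<and> F ((1 - t) *\<^sub>R P0 + t *\<^sub>R P1) = 0}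
      \<subseteq> E ` ({-\<lceil>a0\<rceil>..\<lceil>a0\<rceil>} \<times> {-\<lceil>c0\<rceil>..\<lceil>c0\<rceil>} \<times> {\<beta> \<in> R. cmod \<beta> \<le> b0})"
  proof
    fix F assume "F \<in> {F \<in> walls. \<exists>t. 0 \<le> t \<and> t \<le> 1 \<and> F ((1 - t) *\<^sub>R P0 + t *\<^sub>R P1) = 0}"
    then obtain n k g t where F: "F = wallf n k g" "n \<in> adm" "g \<in> S" and t: "0 \<le> t" "t \<le> 1"
      and F0: "F ((1 - t) *\<^sub>R P0 + t *\<^sub>R P1) = 0" unfolding walls_def by blast
    obtain A C :: int and \<beta> where bR: "\<beta> \<in> R" and val: "\<And>Q. Q \<in> posdef \<Longrightarrow> wall_fun n k (herm_act g Q) =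
        of_int A * Re (Q$1$1) + Im (\<beta> * Q$1$2) / q + of_int C * Re (Q$2$2)"
      and disc: "(cmod \<beta>)\<^sup>2 - 4 * q\<^sup>2 * (of_int A * of_int C) = (real n)\<^sup>2"
      using wall_coefficients[OF F(3), of n k] by blast
    define Q where "Q = (1 - t) *\<^sub>R P0 + t *\<^sub>R P1"
    have Q: "Q \<in> posdef" unfolding Q_def using segment_posdef[OF P0 P1 t] .
    define p z s where pzs: "p = Re (Q$1$1)" "z = Q$1$2" "s = Re (Q$2$2)"
    have conv_le: "(1 - t) * x + t * y \<le> max x y" "min x y \<le> (1 - t) * x + t * y" for x y
    proof -
      have "(1 - t) * x + t * y \<le> (1 - t) * max x y + t * max x y" "(1 - t) * min x y + t * min x y \<le> (1 - t) * x + t * y"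
        using t by (intro add_mono mult_left_mono; simp)+
      then show "(1 - t) * x + t * y \<le> max x y" "min x y \<le> (1 - t) * x + t * y" by (simp_all add: algebra_simps)
    qed
    have sQ: "s = (1 - t) * Re (P0$2$2) + t * Re (P1$2$2)" "p = (1 - t) * Re (P0$1$1) + t * Re (P1$1$1)"
      "z = (1 - t) *\<^sub>R P0$1$2 + t *\<^sub>R P1$1$2" by (simp_all add: pzs Q_def)
    have s: "s0 \<le> s" "s \<le> s1" unfolding sQ s0_def s1_def using conv_le by auto
    have "(1 - t) * Re (P0$1$1) \<le> 1 * Re (P0$1$1)" "t * Re (P1$1$1) \<le> 1 * Re (P1$1$1)"
      using t D0(4) D1(4) by (intro mult_right_mono; simp)+
    then have p: "p \<le> p1" unfolding sQ p1_def by linarith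
    have "(1 - t) * cmod (P0$1$2) \<le> 1 * cmod (P0$1$2)" "t * cmod (P1$1$2) \<le> 1 * cmod (P1$1$2)"
      using t by (intro mult_right_mono; simp)+
    moreover have "cmod z \<le> (1 - t) * cmod (P0$1$2) + t * cmod (P1$1$2)"
      unfolding sQ using norm_triangle_ineq[of "(1 - t) *\<^sub>R P0$1$2" "t *\<^sub>R P1$1$2"] t by simp
    ultimately have z: "cmod z \<le> z1" unfolding z1_def by linarith
    have "1 / 2 \<le> (1 - t)\<^sup>2 + t\<^sup>2" using zero_le_power2[of "1 - 2 * t"] by (simp add: power2_eq_square algebra_simps)
    then have "(1 / 2) * (2 * dm) \<le> ((1 - t)\<^sup>2 + t\<^sup>2) * (2 * dm)" using pos by (intro mult_right_mono) auto
    also have "\<dots> = (1 - t)\<^sup>2 * (2 * dm) + t\<^sup>2 * (2 * dm)" by (simp add: algebra_simps)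
    also have "\<dots> \<le> (1 - t)\<^sup>2 * herm_det P0 + t\<^sup>2 * herm_det P1"
      unfolding dm_def by (intro add_mono mult_left_mono) auto
    also have "\<dots> \<le> herm_det Q" unfolding Q_def using t by (intro herm_det_convex P0 P1) auto
    finally have det: "dm \<le> herm_det Q" by simp
    have spos: "s > 0" "p > 0" using posdefD[OF Q] by (auto simp: pzs)
    have zero: "of_int A * p + Im (\<beta> * z) / q + of_int C * s = 0"
      using F0 val[OF Q] Q unfolding F(1) wallf_def Q_def[symmetric] pzs by simp
    define B where "B = \<beta> / (of_real (2 * q) * \<i>)"
    have LB: "Im (\<beta> * z) / q = 2 * Re (B * z)"
      using q_gt_1 unfolding B_def by (simp add: Re_divide Im_divide power2_eq_square field_simps)
    have nB: "cmod \<beta> = 2 * q * cmod B" using q_gt_1 by (simp add: B_def norm_divide norm_mult)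
    have d2: "4 * q\<^sup>2 * ((cmod B)\<^sup>2 - of_int A * of_int C) = (real n)\<^sup>2"
      using disc unfolding nB by (simp add: algebra_simps power_mult_distrib)
    \<comment> \<open>Completing the square where the form vanishes expresses a positive definite
      quantity through \<open>|B|\<^sup>2 - A * C = n\<^sup>2 / (4 * q\<^sup>2)\<close>, which is
      less than 1 as \<open>n < q\<close>.\<close>
    have "(of_int A)\<^sup>2 * herm_det Q + (cmod (of_int A * z + of_real s * cnj B))\<^sup>2 =
        of_int A * s * (of_int A * p + 2 * Re (B * z)) + s\<^sup>2 * (cmod B)\<^sup>2"
      unfolding herm_det_def pzs[symmetric] cmod_power2 by (simp add: algebra_simps power2_eq_square)
    also have "of_int A * p + 2 * Re (B * z) = - (of_int C * s)" using zero LB by linarith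
    finally have "(of_int A)\<^sup>2 * herm_det Q + (cmod (of_int A * z + of_real s * cnj B))\<^sup>2 =
        s\<^sup>2 * ((cmod B)\<^sup>2 - of_int A * of_int C)"
      by (simp add: algebra_simps power2_eq_square)
    moreover have "(cmod B)\<^sup>2 - of_int A * of_int C \<le> 1"
    proof -
      have "q\<^sup>2 * (4 * ((cmod B)\<^sup>2 - of_int A * of_int C)) \<le> q\<^sup>2 * 1"
        using d2 adm_less_q[OF F(2)] by (simp add: algebra_simps)
      then have "4 * ((cmod B)\<^sup>2 - of_int A * of_int C) \<le> 1" using q_gt_1 by (simp only: mult_le_cancel_left) auto
      moreover have "4 * X \<le> 1 \<Longrightarrow> X \<le> 1" for X :: real by simp
      ultimately show ?thesis by blast
    qed
    ultimately have key: "(of_int A)\<^sup>2 * herm_det Q + (cmod (of_int A * z + of_real s * cnj B))\<^sup>2 \<le> s\<^sup>2"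
      using mult_left_mono[of "(cmod B)\<^sup>2 - of_int A * of_int C" 1 "s\<^sup>2"] by simp
    have "(of_int A)\<^sup>2 * dm \<le> (of_int A)\<^sup>2 * herm_det Q" using det by (intro mult_left_mono) auto
    also have "\<dots> \<le> s\<^sup>2" using key zero_le_power2[of "cmod (of_int A * z + of_real s * cnj B)"] by linarith
    also have "\<dots> \<le> s1\<^sup>2" using s spos by (intro power_mono) auto
    finally have "(of_int A)\<^sup>2 \<le> s1\<^sup>2 / dm" using pos by (simp add: field_simps)
    also have "\<dots> = a0\<^sup>2" using pos by (simp add: a0_def power_divide)
    finally have "\<bar>of_int A\<bar>\<^sup>2 \<le> a0\<^sup>2" by simp
    then have A: "\<bar>of_int A\<bar> \<le> a0" by (rule power2_le_imp_le) (use a0 in simp)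
    have "(of_int A)\<^sup>2 * herm_det Q \<ge> 0" using posdefD(3)[OF Q] by simp
    then have "(cmod (of_int A * z + of_real s * cnj B))\<^sup>2 \<le> s\<^sup>2" using key by linarith
    then have "cmod (of_int A * z + of_real s * cnj B) \<le> s" by (rule power2_le_imp_le) (use spos in simp)
    moreover have "cmod (of_real s * cnj B) \<le> cmod (of_int A * z + of_real s * cnj B) + cmod (of_int A * z)"
      using norm_triangle_ineq4[of "of_int A * z + of_real s * cnj B" "of_int A * z"] by simp
    moreover have "cmod (of_int A * z) \<le> a0 * z1" unfolding norm_mult using A z a0 by (intro mult_mono) auto
    moreover have "s0 * cmod B \<le> s * cmod B" using s by (intro mult_right_mono) auto
    ultimately have "s0 * cmod B \<le> s1 + a0 * z1" using s spos by (simp add: norm_mult)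
    then have "cmod B \<le> (s1 + a0 * z1) / s0" using pos by (simp add: field_simps)
    then have B: "cmod \<beta> \<le> b0" unfolding nB b0_def using q_gt_1 by (intro mult_left_mono) auto
    have Cs: "of_int C * s = - (of_int A * p + Im (\<beta> * z) / q)" using zero by linarith
    have "\<bar>of_int C\<bar> * s = \<bar>of_int C * s\<bar>" using spos by (simp add: abs_mult)
    also have "\<dots> = \<bar>of_int A * p + Im (\<beta> * z) / q\<bar>" unfolding Cs by (rule abs_minus_cancel)
    also have "\<dots> \<le> \<bar>of_int A\<bar> * p + \<bar>Im (\<beta> * z)\<bar> / q"
      using spos q_gt_1 by (intro order_trans[OF abs_triangle_ineq]) (simp add: abs_mult)
    also have "\<dots> \<le> a0 * p1 + b0 * z1 / q"
    proof (intro add_mono mult_mono divide_right_mono)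
      have "\<bar>Im (\<beta> * z)\<bar> \<le> cmod \<beta> * cmod z" using abs_Im_le_cmod[of "\<beta> * z"] by (simp only: norm_mult)
      also have "\<dots> \<le> b0 * z1" using B z b0 by (intro mult_mono) auto
      finally show "\<bar>Im (\<beta> * z)\<bar> \<le> b0 * z1" .
    qed (use A p a0 spos q_gt_1 in auto)
    finally have "\<bar>of_int C\<bar> * s \<le> a0 * p1 + b0 * z1 / q" .
    moreover have "\<bar>of_int C\<bar> * s0 \<le> \<bar>of_int C :: real\<bar> * s" using s by (intro mult_left_mono) auto
    ultimately have "\<bar>of_int C\<bar> * s0 \<le> a0 * p1 + b0 * z1 / q" by linarith
    then have C: "\<bar>of_int C\<bar> \<le> c0" unfolding c0_def using pos by (simp add: field_simps)
    have iA: "A \<in> {-\<lceil>a0\<rceil>..\<lceil>a0\<rceil>}" using A by (auto simp: abs_le_iff) linarith+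
    have iC: "C \<in> {-\<lceil>c0\<rceil>..\<lceil>c0\<rceil>}" using C by (auto simp: abs_le_iff) linarith+
    have "F = E (A, C, \<beta>)" unfolding F(1) wallf_def E_def using val by auto
    then show "F \<in> E ` ({-\<lceil>a0\<rceil>..\<lceil>a0\<rceil>} \<times> {-\<lceil>c0\<rceil>..\<lceil>c0\<rceil>} \<times> {\<beta> \<in> R. cmod \<beta> \<le> b0})"
      using iA iC bR B by blast
  qed
  show "finite (E ` ({-\<lceil>a0\<rceil>..\<lceil>a0\<rceil>} \<times> {-\<lceil>c0\<rceil>..\<lceil>c0\<rceil>} \<times> {\<beta> \<in> R. cmod \<beta> \<le> b0}))"
    using finite_R_bounded by auto
qed

lemma finite_side_diff:
  assumes P: "P \<in> posdef" and Q: "Q \<in> posdef"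
  shows "finite (side Q - side P)"
proof (rule finite_subset)
  let ?W = "{F \<in> walls. \<exists>t. 0 \<le> t \<and> t \<le> 1 \<and> F ((1 - t) *\<^sub>R P + t *\<^sub>R Q) = 0}"
  show "side Q - side P \<subseteq> ?W \<union> neg ` ?W"
  proof
    fix F assume F: "F \<in> side Q - side P"
    then have FH: "F \<in> HS" "F P \<le> 0" "F Q \<ge> 0" by (auto simp: side_def)
    obtain t where t: "0 \<le> t" "t \<le> 1" "F ((1 - t) *\<^sub>R P + t *\<^sub>R Q) = 0"
      using hs_zero_on_segment[OF FH(1) P Q FH(2,3)] by blast
    consider "F \<in> walls" | G where "G \<in> walls" "F = neg G" using FH(1) unfolding HS_def by blast
    then show "F \<in> ?W \<union> neg ` ?W"
    proof cases
      case 1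
      then show ?thesis using t by blast
    next
      case 2
      then have "G ((1 - t) *\<^sub>R P + t *\<^sub>R Q) = 0" using t(3) by (simp add: neg_apply)
      then show ?thesis using 2 t by blast
    qed
  qed
qed (use finite_walls_segment[OF P Q] in auto)

section \<open>The group acting on half-spaces and paths\<close>

text \<open>Pullback along \<open>h\<close>, so that half-spaces move by the inverse of
  \<open>h\<close>; \<open>side_act\<close> matches this with the action on points.\<close>

definition mv :: "complex^2^2 \<Rightarrow> (complex^2^2 \<Rightarrow> real) \<Rightarrow> complex^2^2 \<Rightarrow> real" where
  "mv h F = (\<lambda>P. if P \<in> posdef then F (herm_act h P) else 0)"

lemma mv_wallf: "h \<in> S \<Longrightarrow> mv h (wallf n k g) = wallf n k (g ** h)"
  unfolding mv_def wallf_def using S_posdef by (auto simp: herm_act_mult)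

lemma mv_neg: "mv h (neg F) = neg (mv h F)"
  by (auto simp: mv_def neg_def)

lemma mv_walls: "h \<in> S \<Longrightarrow> F \<in> walls \<Longrightarrow> mv h F \<in> walls"
  unfolding walls_def using mv_wallf S_mult by blast

lemma mv_HS: "h \<in> S \<Longrightarrow> F \<in> HS \<Longrightarrow> mv h F \<in> HS"
  unfolding HS_def using mv_walls mv_neg by auto

lemma mv_mv:
  assumes "F \<in> HS" "g \<in> S" "h \<in> S" "g ** h = mat 1"
  shows "mv h (mv g F) = F"
proof -
  have "F P = 0" if "P \<notin> posdef" for P
    using assms(1) that unfolding HS_def walls_def wallf_def neg_def by auto
  then show ?thesis
    unfolding mv_def using S_posdef[OF assms(3)] assms(4) by (auto simp: herm_act_mult[symmetric] herm_act_one)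
qed

lemma mv_lab:
  assumes "h \<in> S" "F \<in> HS"
  shows "hs_lab (mv h F) = hs_lab F"
proof -
  have idx: "wall_idx (mv h F) = wall_idx F" if F: "F \<in> walls" for F
  proof -
    obtain n k g where F: "F = wallf n k g" "n \<in> adm" "coprime k (int n)" "g \<in> S" using F unfolding walls_def by blast
    then show ?thesis using wall_idx mv_wallf[OF assms(1)] S_mult assms(1) by metis
  qed
  consider "F \<in> walls" | G where "G \<in> walls" "F = neg G" using assms(2) unfolding HS_def by blast
  then show ?thesis
  proof cases
    case 1
    then show ?thesis using mv_walls[OF assms(1)] idx by (simp add: hs_lab_def)
  next
    case 2
    then show ?thesis using mv_walls[OF assms(1) 2(1)] idx[OF 2(1)] neg_not_wall
      by (simp add: hs_lab_def mv_neg)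
  qed
qed

lemma mv_le:
  assumes "h \<in> S"
  shows "hs_le (mv h F) (mv h G) \<longleftrightarrow> hs_le F G"
proof -
  obtain g where g: "g \<in> S" "h ** g = mat 1" using S_inverse[OF assms] by metis
  have "hs_le F G" if "hs_le (mv h F) (mv h G)"
    unfolding hs_le_def
  proof
    fix P assume P: "P \<in> posdef"
    have "herm_act h (herm_act g P) = P" by (simp add: herm_act_mult[symmetric] g herm_act_one)
    then show "(0 < F P \<longrightarrow> 0 < G P) \<and> (G P < 0 \<longrightarrow> F P < 0)"
      using that S_posdef[OF g(1) P] unfolding hs_le_def mv_def by (auto split: if_splits dest!: bspec[of _ _ "herm_act g P"])
  qed
  moreover have "hs_le (mv h F) (mv h G)" if "hs_le F G"
    using that S_posdef[OF assms] unfolding hs_le_def mv_def by auto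
  ultimately show ?thesis by blast
qed

lemma side_act:
  assumes "g \<in> S" "h \<in> S" "g ** h = mat 1" "P \<in> posdef"
  shows "side (herm_act g P) = mv h ` side P"
proof
  have hg: "h ** g = mat 1"
  proof -
    obtain g' where "g' \<in> S" "g ** g' = mat 1" "g' ** g = mat 1" using S_inverse[OF assms(1)] by metis
    then show ?thesis using assms(3) by (metis matrix_mul_assoc matrix_mul_lid matrix_mul_rid)
  qed
  have ev: "mv g F P = F (herm_act g P)" for F using assms(4) by (simp add: mv_def)
  show "side (herm_act g P) \<subseteq> mv h ` side P"
  proof
    fix F assume F: "F \<in> side (herm_act g P)"
    then have "mv g F \<in> side P" using mv_HS[OF assms(1)] by (auto simp: side_def ev)
    moreover have "F = mv h (mv g F)" using mv_mv[OF _ assms(1-3)] F by (simp add: side_def)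
    ultimately show "F \<in> mv h ` side P" by blast
  qed
  show "mv h ` side P \<subseteq> side (herm_act g P)"
  proof
    fix F assume "F \<in> mv h ` side P"
    then obtain G where G: "F = mv h G" "G \<in> side P" by blast
    have "mv h G (herm_act g P) = G P"
      using S_posdef[OF assms(1,4)] by (simp add: mv_def herm_act_mult[symmetric] hg herm_act_one)
    then show "F \<in> side (herm_act g P)" using G mv_HS[OF assms(2)] by (simp add: side_def)
  qed
qed

lemma offwall_act:
  assumes "offwall P" "g \<in> S"
  shows "offwall (herm_act g P)"
  unfolding offwall_def
proof (intro conjI ballI)
  have P: "P \<in> posdef" using assms by (simp add: offwall_def)
  then show "herm_act g P \<in> posdef" using S_posdef assms by blast
  fix F assume "F \<in> HS"
  then have "mv g F P \<noteq> 0" using mv_HS[OF assms(2)] assms(1) by (auto simp: offwall_def)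
  then show "F (herm_act g P) \<noteq> 0" using P by (simp add: mv_def)
qed

definition path :: "complex^2^2 \<Rightarrow> complex^2^2 \<Rightarrow> (nat \<times> bool) list" where
  "path P Q = hs.word (side P) (side Q)"

lemma path_comp:
  assumes "offwall P" "offwall Q" "offwall T"
  shows "path P T = foldr push_letter (path P Q) (path Q T)"
  unfolding path_def
  using assms finite_side_diff by (intro hs.word_cocycle side_orientation) (auto simp: offwall_def)

lemma path_act:
  assumes "offwall P" "offwall Q" "g \<in> S"
  shows "path (herm_act g P) (herm_act g Q) = path P Q"
proof -
  obtain h where h: "h \<in> S" "g ** h = mat 1" using S_inverse[OF assms(3)] by metis
  have P: "P \<in> posdef" "Q \<in> posdef" using assms by (auto simp: offwall_def)
  show ?thesis
    unfolding path_def side_act[OF assms(3) h P(1)] side_act[OF assms(3) h P(2)]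
    using mv_HS[OF h(1)] mv_lab[OF h(1)] mv_le[OF h(1)] side_orientation assms finite_side_diff[OF P]
    by (intro hs.word_image) auto
qed

lemma path_carrier:
  assumes "offwall P" "offwall Q"
  shows "path P Q \<in> carrier (free_group {..<card adm})"
proof -
  have PQ: "P \<in> posdef" "Q \<in> posdef" using assms by (auto simp: offwall_def)
  have l: "fst (hs_lab F) < card adm" if "F \<in> HS" for F
  proof -
    have *: "idx (wall_idx F) < card adm" if "F \<in> walls" for F
      using that idx_bij wall_idx unfolding walls_def bij_betw_def by force
    show ?thesis using that * unfolding hs_lab_def HS_def by auto
  qed
  have "path P Q \<in> {w. fst ` set w \<subseteq> {..<card adm}}"
    unfolding path_def
  proof (rule hs.word_closed[OF side_orientation[OF assms(1)] side_orientation[OF assms(2)] finite_side_diff[OF PQ]])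
    fix h w assume h: "h \<in> side Q - side P" and w: "w \<in> {w :: (nat \<times> bool) list. fst ` set w \<subseteq> {..<card adm}}"
    have "h \<in> HS" using h by (simp add: side_def)
    then show "push_letter (hs_lab h) w \<in> {w. fst ` set w \<subseteq> {..<card adm}}"
      using l w set_push_letter[of "hs_lab h" w] by fastforce
  qed auto
  then show ?thesis using hs.word_reduced by (simp add: free_group_def path_def)
qed

text \<open>The segment stays above every hemisphere, so by \<open>wall_through_high\<close> it
  meets vertical planes only, at fractions \<open>k / n\<close>.\<close>

lemma wall_on_hp_segment:
  assumes F: "F \<in> HS" "F (hp y) \<le> 0" "F (hp y') \<ge> 0"
  obtains n k t where "n \<in> adm" "coprime k (int n)" "F = wallf n k (mat 1) \<or> F = neg (wallf n k (mat 1))"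
    "0 \<le> t" "t \<le> 1" "real n * ((1 - t) * y + t * y') = of_int k"
proof -
  obtain t where t: "0 \<le> t" "t \<le> 1" "F ((1 - t) *\<^sub>R hp y + t *\<^sub>R hp y') = 0"
    using hs_zero_on_segment[OF F(1) hp_posdef hp_posdef F(2,3)] by blast
  let ?P = "(1 - t) *\<^sub>R hp y + t *\<^sub>R hp y'"
  have h: "high ?P" using hp_segment_high[OF t(1,2)] .
  then have P: "?P \<in> posdef" by (simp add: high_def)
  obtain G where G: "G \<in> walls" "F = G \<or> F = neg G" using F(1) unfolding HS_def by blast
  have G0: "G ?P = 0" using G t(3) by (auto simp: neg_apply)
  obtain n k g where W: "G = wallf n k g" "n \<in> adm" "coprime k (int n)" "g \<in> S" using G(1) unfolding walls_def by blast
  have "wall_fun n k (herm_act g ?P) = 0" using G0 P by (simp add: W wallf_def)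
  then obtain k' where k': "coprime k' (int n)" "\<And>Q. Q \<in> posdef \<Longrightarrow> wall_fun n k (herm_act g Q) = wall_fun n k' Q"
    using wall_through_high[OF W(2-4) h] by blast
  have Gv: "G = wallf n k' (mat 1)" unfolding W(1) wallf_def using k'(2) by (auto simp: herm_act_one)
  have lin: "G ?P = (1 - t) * G (hp y) + t * G (hp y')"
    using hs_linear[OF walls_HS[OF G(1)] hp_posdef hp_posdef t(1,2)] .
  have "G (hp x) = real n * x - of_int k'" for x
    unfolding Gv wallf_def using hp_posdef hp_wall by (simp add: herm_act_one)
  then have "(1 - t) * (real n * y - of_int k') + t * (real n * y' - of_int k') = 0" using G0 lin by simp
  then have "real n * ((1 - t) * y + t * y') = of_int k'" by (simp add: algebra_simps)
  then show ?thesis using that[OF W(2) k'(1) _ t(1,2)] G(2) Gv by blast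
qed

lemma wallf_hp: "wallf n k (mat 1) (hp y) = real n * y - of_int k"
  using hp_posdef hp_wall by (simp add: wallf_def herm_act_one)

lemma offwall_hp:
  assumes "\<And>m j. m \<in> adm \<Longrightarrow> real m * y \<noteq> of_int j"
  shows "offwall (hp y)"
  unfolding offwall_def
proof (intro conjI ballI notI)
  fix F assume F: "F \<in> HS" "F (hp y) = 0"
  then obtain n k t where "n \<in> adm" "real n * ((1 - t) * y + t * y) = of_int k"
    using wall_on_hp_segment[of F y y] by (metis order_refl)
  then show False using assms by (simp add: algebra_simps)
qed (rule hp_posdef)

end

section \<open>The image of the Bianchi group\<close>

text \<open>Pigeonhole: the squares and the values \<open>a - v\<^sup>2\<close> fill
  \<open>(p + 1) / 2\<close> residues each, too many to be disjoint.\<close>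

lemma sum_two_squares_mod_prime:
  fixes a :: int
  assumes "prime p" "odd (p::nat)"
  shows "\<exists>u v::int. [u\<^sup>2 + v\<^sup>2 = a] (mod int p)"
proof -
  define h where "h = (int p - 1) div 2"
  have ph: "int p = 2 * h + 1" using assms(2) unfolding h_def by presburger
  have p: "prime (int p)" using assms by simp
  have inj: "u = w" if "u \<in> {0..h}" "w \<in> {0..h}" "int p dvd u\<^sup>2 - w\<^sup>2" for u w
  proof -
    have "int p dvd (u - w) * (u + w)" using that(3) by (simp add: power2_eq_square algebra_simps)
    then consider "int p dvd u - w" | "int p dvd u + w" using p prime_dvd_mult_iff by blast
    then show ?thesis
    proof cases
      case 1
      have "\<bar>u - w\<bar> < int p" using that ph by auto
      then show ?thesis using 1 zdvd_not_zless[of "\<bar>u - w\<bar>" "int p"] by (cases "u = w") auto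
    next
      case 2
      have "u + w < int p" "0 \<le> u + w" using that ph by auto
      then have "u + w = 0" using 2 zdvd_not_zless[of "u + w" "int p"] by fastforce
      then show ?thesis using that by auto
    qed
  qed
  define A where "A = (\<lambda>u. u\<^sup>2 mod int p) ` {0..h}"
  define B where "B = (\<lambda>v. (a - v\<^sup>2) mod int p) ` {0..h}"
  have "inj_on (\<lambda>u. u\<^sup>2 mod int p) {0..h}"
    using inj by (intro inj_onI) (auto simp: mod_eq_dvd_iff)
  then have cA: "card A = nat (h + 1)" unfolding A_def by (simp add: card_image)
  have "inj_on (\<lambda>v. (a - v\<^sup>2) mod int p) {0..h}"
  proof (rule inj_onI)
    fix x y assume "x \<in> {0..h}" "y \<in> {0..h}" "(a - x\<^sup>2) mod int p = (a - y\<^sup>2) mod int p"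
    then have "int p dvd (a - x\<^sup>2) - (a - y\<^sup>2)" using mod_eq_dvd_iff by blast
    then have "int p dvd y\<^sup>2 - x\<^sup>2" by simp
    then show "x = y" using inj \<open>x \<in> _\<close> \<open>y \<in> _\<close> by metis
  qed
  then have cB: "card B = nat (h + 1)" unfolding B_def by (simp add: card_image)
  have "A \<union> B \<subseteq> {0..<int p}" unfolding A_def B_def using prime_gt_0_nat[OF assms(1)] by auto
  then have "card (A \<union> B) \<le> p" using card_mono[of "{0..<int p}" "A \<union> B"] by simp
  moreover have "finite A" "finite B" by (auto simp: A_def B_def)
  moreover have "card A + card B > p" using cA cB ph by simp
  ultimately have "A \<inter> B \<noteq> {}" using card_Un_disjoint[of A B] by linarith
  then obtain u v where "u\<^sup>2 mod int p = (a - v\<^sup>2) mod int p" unfolding A_def B_def by auto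
  then have "[u\<^sup>2 = a - v\<^sup>2] (mod int p)" by (simp add: cong_def)
  then have "[u\<^sup>2 + v\<^sup>2 = a - v\<^sup>2 + v\<^sup>2] (mod int p)" by (intro cong_add) auto
  then show ?thesis by auto
qed

lemma sum_two_squares_mod_squarefree:
  fixes a :: int
  assumes "squarefree n" "odd (n::nat)"
  shows "\<exists>u v::int. [u\<^sup>2 + v\<^sup>2 = a] (mod int n)"
  using assms
proof (induction n rule: less_induct)
  case (less n)
  show ?case
  proof (cases "n = 1")
    case False
    then obtain p where p: "prime p" "p dvd n" using prime_factor_nat by blast
    then obtain m where m: "n = p * m" by blast
    have "n > 0" using less.prems(2) by (auto intro: Nat.gr0I)
    then have "m < n" "odd m" "odd p" using m p prime_gt_1_nat[OF p(1)] less.prems(2) by auto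
    moreover have "squarefree m" using less.prems(1) m squarefree_mono[of m n] by auto
    ultimately obtain u v where uv: "[u\<^sup>2 + v\<^sup>2 = a] (mod int m)" using less.IH by blast
    obtain u' v' where uv': "[u'\<^sup>2 + v'\<^sup>2 = a] (mod int p)"
      using sum_two_squares_mod_prime[OF p(1) \<open>odd p\<close>] by blast
    have "\<not> p dvd m"
    proof
      assume "p dvd m"
      then have "p\<^sup>2 dvd n" using m by (simp add: power2_eq_square)
      then have "is_unit p" using less.prems(1) by (auto simp: squarefree_def)
      then show False using p by auto
    qed
    then have co: "coprime (int p) (int m)" using p prime_imp_coprime by simp
    obtain U where U: "[U = u'] (mod int p)" "[U = u] (mod int m)"
      using binary_chinese_remainder_int[OF co] by blast
    obtain V where V: "[V = v'] (mod int p)" "[V = v] (mod int m)"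
      using binary_chinese_remainder_int[OF co] by blast
    have "[U\<^sup>2 + V\<^sup>2 = a] (mod int p)" using U V uv' by (meson cong_add cong_pow cong_trans)
    moreover have "[U\<^sup>2 + V\<^sup>2 = a] (mod int m)" using U V uv by (meson cong_add cong_pow cong_trans)
    ultimately have "[U\<^sup>2 + V\<^sup>2 = a] (mod int p * int m)" using co by (rule coprime_cong_mult)
    then show ?thesis using m by auto
  qed auto
qed

context imaginary_quadratic_order
begin

text \<open>Completing the square turns the claim into writing \<open>2 * D\<close> as
  \<open>u\<^sup>2 + v\<^sup>2\<close> modulo \<open>n\<close>; \<open>c1\<close> and
  \<open>c2\<close> are recovered because 2 is invertible.\<close>

lemma opposite_norms:
  assumes n: "n \<in> adm"
  shows "\<exists>c1 c2. [nrm c1 1 + nrm c2 1 = 0] (mod int n)"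
proof -
  have odd: "odd n" "squarefree n" using n by (auto simp: adm_def)
  obtain u v where uv: "[u\<^sup>2 + v\<^sup>2 = 2 * D] (mod int n)" using sum_two_squares_mod_squarefree[OF odd(2,1)] by blast
  have co: "coprime 2 (int n)" using odd by simp
  have solve: "\<exists>c. [2 * c + D = w] (mod int n)" for w
  proof -
    obtain x where "[2 * x = 1] (mod int n)" using cong_solve_coprime_int[OF co] by blast
    then have "[(2 * x) * (w - D) = 1 * (w - D)] (mod int n)" by (rule cong_scalar_right)
    then have "[2 * (x * (w - D)) + D = (w - D) + D] (mod int n)" by (intro cong_add) (auto simp: mult.assoc)
    then show ?thesis by auto
  qed
  obtain c1 c2 where c: "[2 * c1 + D = u] (mod int n)" "[2 * c2 + D = v] (mod int n)" using solve by meson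
  have "4 * (nrm c1 1 + nrm c2 1) = (2 * c1 + D)\<^sup>2 + (2 * c2 + D)\<^sup>2 - 2 * D"
    using four_nrm[of c1 1] four_nrm[of c2 1] by simp
  moreover have "[(2 * c1 + D)\<^sup>2 + (2 * c2 + D)\<^sup>2 - 2 * D = 2 * D - 2 * D] (mod int n)"
    using c uv by (meson cong_add cong_pow cong_trans cong_diff cong_refl)
  ultimately have "[4 * (nrm c1 1 + nrm c2 1) = 0] (mod int n)" by simp
  then have "int n dvd (2 * 2) * (nrm c1 1 + nrm c2 1)" by (simp add: cong_0_iff)
  moreover have "coprime (2 * 2) (int n)" using co coprime_mult_left_iff by blast
  ultimately have "int n dvd nrm c1 1 + nrm c2 1" using coprime_dvd_mult_right_iff coprime_commute by blast
  then show ?thesis by (auto simp: cong_0_iff)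
qed

text \<open>For a centre with \<open>e = k * c\<close>, \<open>hemisphere_step\<close> sends the
  index \<open>k\<close> to the inverse of \<open>k * nrm c 1\<close> modulo \<open>n\<close>. Two
  steps, with \<open>c1\<close> and then \<open>c2\<close>, multiply \<open>k\<close> by
  \<open>nrm c1 1 / nrm c2 1 = - 1\<close>, and \<open>- k\<close> is \<open>k + 1\<close> modulo
  \<open>n\<close>.\<close>

lemma opposite_wall:
  assumes n: "n \<in> adm" and k: "int n = 2 * k + 1"
  obtains G where "G \<in> S" "coprime k (int n)" "coprime (k + 1) (int n)"
     "\<And>P. P \<in> posdef \<Longrightarrow> wall_fun n (k + 1) (herm_act G P) = wall_fun n k P"
proof -
  have ck: "coprime k (int n)" "coprime (k + 1) (int n)"
  proof -
    have "1 = int n + (- 2) * k" "1 = 2 * (k + 1) + (- 1) * int n" using k by auto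
    then show "coprime k (int n)" "coprime (k + 1) (int n)"
      by (metis coprimeI dvd_add dvd_mult)+
  qed
  obtain c1 c2 where c: "[nrm c1 1 + nrm c2 1 = 0] (mod int n)" using opposite_norms[OF n] by blast
  have sc: "nrm (k * e) k = k * k * nrm e 1" for k e
    unfolding nrm_def by (simp add: algebra_simps)
  obtain u1 where u1: "[u1 * nrm (k * c1) k = 1] (mod int n)"
    using coprime_nrm[OF n ck(1)] cong_solve_coprime_int by (metis mult.commute)
  define j where "j = u1 * k"
  obtain A where A: "A \<in> S" "coprime j (int n)" "\<And>P. P \<in> posdef \<Longrightarrow> wall_fun n j (herm_act A P) = wall_fun n k P"
    using hemisphere_step[OF n ck(1) u1] unfolding j_def by (metis cong_refl)
  obtain u2 where u2: "[u2 * nrm (j * c2) j = 1] (mod int n)"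
    using coprime_nrm[OF n A(2)] cong_solve_coprime_int by (metis mult.commute)
  define x where "x = j * nrm c2 1"
  have "[u2 * j * x = 1] (mod int n)" using u2 unfolding sc x_def by (simp add: mult.assoc mult.left_commute)
  moreover have "[(k + 1) * x = 1] (mod int n)"
  proof -
    have "int n dvd nrm c1 1 + nrm c2 1" using c by (simp add: cong_0_iff)
    then obtain w where w: "nrm c2 1 = int n * w - nrm c1 1" by (metis add_diff_cancel_left' dvdE)
    have "int n dvd u1 * nrm (k * c1) k - 1" using u1 by (simp add: cong_iff_dvd_diff)
    then obtain w' where w': "u1 * (k * k * nrm c1 1) - 1 = int n * w'" unfolding sc by blast
    have "(k + 1) * x - 1 = (int n - k) * j * (int n * w - nrm c1 1) - 1"
      unfolding x_def w using k by (simp add: algebra_simps)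
    also have "\<dots> = int n * (j * (int n * w - nrm c1 1) - k * j * w) + (u1 * (k * k * nrm c1 1) - 1)"
      unfolding j_def by (simp add: algebra_simps)
    also have "int n dvd \<dots>" unfolding w' by (intro dvd_add) auto
    finally show ?thesis by (simp add: cong_iff_dvd_diff)
  qed
  ultimately have "[u2 * j * x = (k + 1) * x] (mod int n)" by (metis cong_sym cong_trans)
  moreover have "coprime x (int n)"
    using \<open>[(k + 1) * x = 1] (mod int n)\<close> by (metis cong_imp_coprime cong_sym coprime_1_left coprime_mult_left_iff)
  ultimately have "[k + 1 = u2 * j] (mod int n)" using cong_mult_rcancel cong_sym by blast
  then obtain B where B: "B \<in> S" "\<And>P. P \<in> posdef \<Longrightarrow> wall_fun n (k + 1) (herm_act B P) = wall_fun n j P"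
    using hemisphere_step[OF n A(2) u2] by metis
  have "wall_fun n (k + 1) (herm_act (B ** A) P) = wall_fun n k P" if "P \<in> posdef" for P
    using B(2)[OF S_posdef[OF A(1) that]] A(3)[OF that] by (simp add: herm_act_mult)
  then show ?thesis using that[of "B ** A"] S_mult[OF B(1) A(1)] ck by blast
qed

section \<open>The homomorphism to the free group and its surjectivity\<close>

text \<open>Midway between the planes \<open>(n - 1) / (2 * n)\<close> and
  \<open>(n + 1) / (2 * n)\<close> for every \<open>n\<close>, and on no wall since
  \<open>m / 2\<close> is not an integer for odd \<open>m\<close>.\<close>

definition base_point :: "complex^2^2" where "base_point = hp (1 / 2)"

definition dev :: "complex^2^2 \<Rightarrow> (nat \<times> bool) list" where
  "dev g = path base_point (herm_act g base_point)"

abbreviation FG :: "(nat \<times> bool) list monoid" where "FG \<equiv> free_group {..<card adm}"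

lemma offwall_base: "offwall base_point"
  unfolding base_point_def
proof (rule offwall_hp)
  fix m j assume m: "m \<in> adm"
  show "real m * (1 / 2) \<noteq> of_int j"
  proof
    assume "real m * (1 / 2) = of_int j"
    then have "real_of_int (int m) = real_of_int (2 * j)" by simp
    then have "int m = 2 * j" by (simp only: of_int_eq_iff)
    then have "even (int m)" by simp
    then show False using m by (simp add: adm_def)
  qed
qed

lemma FG_group: "group FG" by (rule group_free_group)

lemma FG_mult: "x \<otimes>\<^bsub>FG\<^esub> y = foldr push_letter x y" by (simp add: free_group_def)

lemma dev_carrier: "g \<in> S \<Longrightarrow> dev g \<in> carrier FG"
  unfolding dev_def using path_carrier offwall_base offwall_act by blast

text \<open>The cocycle rule splits the path at the image of the base point under \<open>g\<close>,
  and invariance removes \<open>g\<close> from the second piece.\<close>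

lemma dev_mult: "g \<in> S \<Longrightarrow> h \<in> S \<Longrightarrow> dev (g ** h) = dev g \<otimes>\<^bsub>FG\<^esub> dev h"
  unfolding dev_def FG_mult herm_act_mult
  using path_comp[OF offwall_base, of "herm_act g base_point" "herm_act g (herm_act h base_point)"]
    path_act[OF offwall_base offwall_act[OF offwall_base, of h], of g] offwall_act[OF offwall_base] offwall_act
  by simp

lemma dev_minus: "dev (- g) = dev g" by (simp add: dev_def herm_act_minus)

lemma dev_subgroup: "subgroup (dev ` S) FG"
proof -
  interpret F: group FG by (rule FG_group)
  show ?thesis
  proof (rule F.subgroupI)
    show "dev ` S \<subseteq> carrier FG" using dev_carrier by blast
    show "dev ` S \<noteq> {}" using S_one by blast
    have one: "dev (mat 1) = \<one>\<^bsub>FG\<^esub>"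
      using dev_mult[OF S_one S_one] dev_carrier[OF S_one] F.l_cancel_one by simp
    fix a assume "a \<in> dev ` S"
    then obtain g where g: "a = dev g" "g \<in> S" by blast
    obtain h where h: "h \<in> S" "h ** g = mat 1" using S_inverse[OF g(2)] by metis
    have "dev h \<otimes>\<^bsub>FG\<^esub> a = \<one>\<^bsub>FG\<^esub>" using dev_mult[OF h(1) g(2)] one h(2) g(1) by simp
    then have "inv\<^bsub>FG\<^esub> a = dev h" using g h dev_carrier F.inv_equality by auto
    then show "inv\<^bsub>FG\<^esub> a \<in> dev ` S" using h by blast
    fix b assume "b \<in> dev ` S"
    then obtain g' where g': "b = dev g'" "g' \<in> S" by blast
    then have "a \<otimes>\<^bsub>FG\<^esub> b = dev (g ** g')" using g dev_mult by simp
    then show "a \<otimes>\<^bsub>FG\<^esub> b \<in> dev ` S" using g g' S_mult by blast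
  qed
qed

text \<open>Less than the distance from \<open>k / n\<close> to any other wall fraction
  \<open>j / m\<close>, which is at least \<open>1 / (n * m)\<close> with
  \<open>m < - D\<close>.\<close>

definition eps :: "nat \<Rightarrow> real" where "eps n = 1 / (real n * of_int (- D))"

lemma adm_less_D: "m \<in> adm \<Longrightarrow> real m < of_int (- D)"
proof -
  assume m: "m \<in> adm"
  then have "4 * (int m)\<^sup>2 < - D" by (simp add: adm_def)
  moreover have "int m * 1 \<le> int m * int m" by (cases m) (simp, intro mult_left_mono, auto)
  ultimately have "int m < - D" using adm_pos[OF m] unfolding power2_eq_square by linarith
  then show ?thesis by linarith
qed

lemma eps_pos: "n \<in> adm \<Longrightarrow> eps n > 0"
  unfolding eps_def using adm_pos[of n] D by (intro divide_pos_pos mult_pos_pos) auto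

lemma fraction_gap:
  assumes "n \<in> adm" "m \<in> adm" "\<bar>x\<bar> \<le> eps n" "real m * (of_int k / real n + x) = of_int j"
  shows "int m * k = int n * j" "x = 0"
proof -
  have n: "real n > 0" using adm_pos assms(1) by simp
  have m: "real m > 0" "real m < of_int (- D)" using adm_pos adm_less_D assms(2) by auto
  have e: "real m * of_int k - real n * of_int j = - (real m * real n * x)"
    using assms(4) n by (simp add: field_simps)
  have "\<bar>real m * real n * x\<bar> \<le> real m * real n * eps n"
    unfolding abs_mult using assms(3) by (intro mult_mono) auto
  also have "\<dots> = real m / of_int (- D)" using n by (simp add: eps_def)
  also have "\<dots> < 1" using m D by (subst divide_less_eq_1_pos) auto
  finally have "\<bar>real_of_int (int m * k - int n * j)\<bar> < 1" using e by simp
  then have z: "int m * k - int n * j = 0" by linarith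
  then show "int m * k = int n * j" by simp
  have "real_of_int (int m * k - int n * j) = 0" unfolding z by simp
  then have "real m * real n * x = 0" using e by simp
  then show "x = 0" using n m by simp
qed

lemma same_fraction_int:
  assumes "n > 0" "m > 0" "coprime k (int n)" "coprime j (int m)" "int m * k = int n * j"
  shows "m = n \<and> j = k"
proof -
  have "int n dvd int m" "int m dvd int n"
    using assms(3-5) by (metis coprime_commute coprime_dvd_mult_left_iff dvd_triv_left)+
  then have "m = n" by (simp add: dvd_antisym)
  then show ?thesis using assms by auto
qed

lemma offwall_near:
  assumes "n \<in> adm" "x = eps n \<or> x = - eps n"
  shows "offwall (hp (of_int k / real n + x))"
proof (rule offwall_hp, rule notI)
  fix m j assume "m \<in> adm" "real m * (of_int k / real n + x) = of_int j"
  then have "x = 0" using fraction_gap(2)[of n m x k j] assms eps_pos[OF assms(1)] by auto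
  then show False using assms eps_pos[OF assms(1)] by auto
qed

lemma near_wall:
  assumes n: "n \<in> adm" and k: "coprime k (int n)" and F: "F \<in> HS"
    and x: "\<bar>x\<bar> \<le> eps n" "\<bar>x'\<bar> \<le> eps n"
    and s: "F (hp (of_int k / real n + x)) \<le> 0" "F (hp (of_int k / real n + x')) \<ge> 0"
  shows "F = wallf n k (mat 1) \<or> F = neg (wallf n k (mat 1))"
proof -
  obtain m j t where *: "m \<in> adm" "coprime j (int m)" "F = wallf m j (mat 1) \<or> F = neg (wallf m j (mat 1))"
    "0 \<le> t" "t \<le> 1" "real m * ((1 - t) * (of_int k / real n + x) + t * (of_int k / real n + x')) = of_int j"
    using wall_on_hp_segment[OF F s] by metis
  have "\<bar>(1 - t) * x + t * x'\<bar> \<le> \<bar>(1 - t) * x\<bar> + \<bar>t * x'\<bar>" by (rule abs_triangle_ineq)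
  also have "\<dots> = (1 - t) * \<bar>x\<bar> + t * \<bar>x'\<bar>" using *(4,5) by (simp add: abs_mult)
  also have "\<dots> \<le> (1 - t) * eps n + t * eps n" using x *(4,5) by (intro add_mono mult_left_mono) auto
  finally have "\<bar>(1 - t) * x + t * x'\<bar> \<le> eps n" by (simp add: algebra_simps)
  moreover have "real m * (of_int k / real n + ((1 - t) * x + t * x')) = of_int j"
  proof -
    have "(1 - t) * (K + x) + t * (K + x') = K + ((1 - t) * x + t * x')" for K :: real
      by (simp add: algebra_simps)
    then show ?thesis using *(6) by simp
  qed
  ultimately have "int m * k = int n * j" using fraction_gap(1)[OF n *(1)] by blast
  then have "m = n \<and> j = k" using same_fraction_int adm_pos n *(1,2) k by blast
  then show ?thesis using *(3) by blast
qed

lemma side_diff_hp: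
  assumes F: "F \<in> side (hp y') - side (hp y)" and off: "offwall (hp y)"
  obtains m j t where "m \<in> adm" "coprime j (int m)" "F = wallf m j (mat 1) \<or> F = neg (wallf m j (mat 1))"
    "0 < t" "t < 1" "real m * ((1 - t) * y + t * y') = of_int j"
proof -
  have FH: "F \<in> HS" "F (hp y) < 0" "F (hp y') > 0"
    using F off by (auto simp: side_def offwall_def)
  then obtain m j t where *: "m \<in> adm" "coprime j (int m)" "F = wallf m j (mat 1) \<or> F = neg (wallf m j (mat 1))"
    "0 \<le> t" "t \<le> 1" "real m * ((1 - t) * y + t * y') = of_int j"
    using wall_on_hp_segment[of F y y'] by (metis less_imp_le)
  have "t \<noteq> 0" using * FH by (auto simp: wallf_hp neg_apply)
  moreover have "t \<noteq> 1" using * FH by (auto simp: wallf_hp neg_apply)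
  ultimately have "0 < t" "t < 1" using *(4,5) by auto
  then show ?thesis using that[OF *(1-3) _ _ *(6)] by blast
qed

lemma lab_wallf: "n \<in> adm \<Longrightarrow> coprime k (int n) \<Longrightarrow> hs_lab (wallf n k (mat 1)) = (idx n, True)"
  and lab_neg_wallf: "n \<in> adm \<Longrightarrow> coprime k (int n) \<Longrightarrow> hs_lab (neg (wallf n k (mat 1))) = (idx n, False)"
proof -
  assume *: "n \<in> adm" "coprime k (int n)"
  then have w: "wallf n k (mat 1) \<in> walls" using S_one unfolding walls_def by blast
  show "hs_lab (wallf n k (mat 1)) = (idx n, True)" "hs_lab (neg (wallf n k (mat 1))) = (idx n, False)"
    using w neg_not_wall[OF w] wall_idx[OF * S_one] by (auto simp: hs_lab_def)
qed

lemma path_hp_in_subgroup: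
  assumes I: "subgroup I FG" and off: "offwall (hp y)" "offwall (hp y')"
    and L: "\<And>m j t b. m \<in> adm \<Longrightarrow> 0 < t \<Longrightarrow> t < 1 \<Longrightarrow> real m * ((1 - t) * y + t * y') = of_int j \<Longrightarrow> [(idx m, b)] \<in> I"
  shows "path (hp y) (hp y') \<in> I"
  unfolding path_def
proof (rule hs.word_closed[OF side_orientation[OF off(1)] side_orientation[OF off(2)] finite_side_diff[OF hp_posdef hp_posdef]])
  show "[] \<in> I" using subgroup.one_closed[OF I] by (simp add: free_group_def)
  fix F w assume F: "F \<in> side (hp y') - side (hp y)" and w: "w \<in> I"
  obtain m j t where *: "m \<in> adm" "coprime j (int m)" "F = wallf m j (mat 1) \<or> F = neg (wallf m j (mat 1))"
    "0 < t" "t < 1" "real m * ((1 - t) * y + t * y') = of_int j"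
    using side_diff_hp[OF F off(1)] by metis
  then have "[hs_lab F] \<in> I" using L[OF *(1,4,5,6)] lab_wallf[OF *(1,2)] lab_neg_wallf[OF *(1,2)] by auto
  then have "[hs_lab F] \<otimes>\<^bsub>FG\<^esub> w \<in> I" using subgroup.m_closed[OF I] w by blast
  then show "push_letter (hs_lab F) w \<in> I" by (simp add: FG_mult)
qed

text \<open>\<open>G\<close> carries the plane at \<open>k / n\<close>, below 1/2, to the one at
  \<open>(k + 1) / n\<close>, above. The path from the base point to its image is cut at
  \<open>c\<close> and \<open>c'\<close>, on the two sides of the upper plane, and at the image of
  \<open>a\<close>, a point just above the lower plane. The crossing from \<open>c\<close> to
  \<open>c'\<close> is the letter of \<open>n\<close>; the outer pieces cross only larger
  denominators, so the letter can be solved for.\<close>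

lemma letter_in_image:
  assumes n: "n \<in> adm" and IH: "\<And>m b. m \<in> adm \<Longrightarrow> m > n \<Longrightarrow> [(idx m, b)] \<in> dev ` S"
  shows "[(idx n, b)] \<in> dev ` S"
proof -
  interpret F: group FG by (rule FG_group)
  note I = dev_subgroup
  have "odd (int n)" using n by (simp add: adm_def)
  then obtain k where k: "int n = 2 * k + 1" by (elim oddE)
  obtain G where G: "G \<in> S" "coprime k (int n)" "coprime (k + 1) (int n)"
     "\<And>P. P \<in> posdef \<Longrightarrow> wall_fun n (k + 1) (herm_act G P) = wall_fun n k P"
    using opposite_wall[OF n k] by blast
  have npos: "real n > 0" using adm_pos[OF n] by simp
  have nk: "real n = 2 * of_int k + 1" using k by (metis of_int_1 of_int_add of_int_mult of_int_numeral of_int_of_nat_eq)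
  define e where "e = eps n"
  have e: "e > 0" using eps_pos[OF n] by (simp add: e_def)
  have "real n * 2 < real n * of_int (- D)" using npos D by (intro mult_strict_left_mono) auto
  then have e2: "e < 1 / (2 * real n)" using npos unfolding e_def eps_def by (intro frac_less2) (auto simp: mult.commute)
  have near: "wallf n j (mat 1) (hp (of_int j / real n + x)) = real n * x" for j x
    unfolding wallf_hp using npos by (simp add: field_simps)
  have ne0: "real n * e > 0" using npos e by simp
  define y0 y1 where "y0 = of_int k / real n" and "y1 = of_int (k + 1) / real n"
  have y0: "y0 = 1 / 2 - 1 / (2 * real n)" and y1: "y1 = 1 / 2 + 1 / (2 * real n)"
    using npos nk unfolding y0_def y1_def by (simp_all add: field_simps)
  define a where "a = hp (y0 + e)"
  define c where "c = hp (y1 + - e)"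
  define c' where "c' = hp (y1 + e)"
  have off: "offwall a" "offwall c" "offwall c'"
    unfolding a_def c_def c'_def y0_def y1_def e_def using offwall_near[OF n] by blast+
  have ga: "offwall (herm_act G a)" "offwall (herm_act G base_point)" using offwall_act off offwall_base G by auto
  \<comment> \<open>A crossing within \<open>1 / (2 * n)\<close> of 1/2 with
    \<open>m \<le> n\<close> would give \<open>|2 * j - m| < 1\<close>, impossible for odd
    \<open>m\<close>.\<close>
  have between: "m > n" if m: "m \<in> adm" and t: "0 < t" "t < 1" and y: "\<bar>y - 1 / 2\<bar> < 1 / (2 * real n)"
     and eq: "real m * ((1 - t) * (1/2) + t * y) = of_int j" for m t y j
  proof (rule ccontr)
    assume "\<not> m > n"
    define x where "x = t * (y - 1 / 2)"
    have "\<bar>x\<bar> \<le> \<bar>y - 1 / 2\<bar>" unfolding x_def abs_mult using t by (simp add: mult_left_le_one_le)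
    then have x: "\<bar>x\<bar> < 1 / (2 * real n)" using y by simp
    have eqx: "2 * of_int j - real m = 2 * (real m * x)" 
    proof -
      have "(1 - t) * (1/2) + t * y = 1 / 2 + x" unfolding x_def by (simp add: algebra_simps diff_divide_distrib)
      then have "real m * (1 / 2 + x) = of_int j" using eq by simp
      then show ?thesis by (simp add: algebra_simps)
    qed
    have "\<bar>real m * x\<bar> = real m * \<bar>x\<bar>" by (simp add: abs_mult)
    also have "\<dots> \<le> real n * \<bar>x\<bar>" using \<open>\<not> m > n\<close> by (intro mult_right_mono) auto
    also have "\<dots> < 1 / 2" using x npos by (simp add: field_simps)
    finally have "\<bar>real_of_int (2 * j - int m)\<bar> < 1" using eqx by simp
    then have "int m = 2 * j" by linarith
    then have "even (int m)" by simp
    then show False using m by (simp add: adm_def)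
  qed
  have w1: "path base_point c \<in> dev ` S"
    unfolding base_point_def c_def
  proof (rule path_hp_in_subgroup[OF I])
    fix m j t b assume *: "m \<in> adm" "0 < t" "t < 1" "real m * ((1 - t) * (1/2) + t * (y1 + - e)) = of_int j"
    have "\<bar>(y1 + - e) - 1 / 2\<bar> < 1 / (2 * real n)" using e e2 unfolding y1 by simp
    then show "[(idx m, b)] \<in> dev ` S" using between[OF *(1-3) _ *(4)] IH *(1) by blast
  qed (use offwall_base off in \<open>auto simp: base_point_def c_def\<close>)
  have w0: "path base_point a \<in> dev ` S"
    unfolding base_point_def a_def
  proof (rule path_hp_in_subgroup[OF I])
    fix m j t b assume *: "m \<in> adm" "0 < t" "t < 1" "real m * ((1 - t) * (1/2) + t * (y0 + e)) = of_int j"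
    have "\<bar>(y0 + e) - 1 / 2\<bar> < 1 / (2 * real n)" using e e2 unfolding y0 by simp
    then show "[(idx m, b)] \<in> dev ` S" using between[OF *(1-3) _ *(4)] IH *(1) by blast
  qed (use offwall_base off in \<open>auto simp: base_point_def a_def\<close>)
  have w2: "path c c' = [(idx n, True)]"
  proof -
    have "side c' - side c = {wallf n (k + 1) (mat 1)}"
    proof
      have "wallf n (k + 1) (mat 1) \<in> HS" using n G S_one walls_HS unfolding walls_def by blast
      then show "{wallf n (k + 1) (mat 1)} \<subseteq> side c' - side c"
        using ne0 by (simp only: side_def c_def c'_def y1_def near mem_Collect_eq Diff_iff insert_subset empty_subsetI) simp
      show "side c' - side c \<subseteq> {wallf n (k + 1) (mat 1)}"
      proof
        fix F assume F: "F \<in> side c' - side c"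
        then have FH: "F \<in> HS" "F c' > 0" "F c \<le> 0" by (auto simp: side_def)
        have "F = wallf n (k + 1) (mat 1) \<or> F = neg (wallf n (k + 1) (mat 1))"
          using FH e unfolding c_def c'_def y1_def e_def by (intro near_wall[OF n G(3) FH(1), of "- eps n" "eps n"]) auto
        moreover have "wallf n (k + 1) (mat 1) c' > 0"
          unfolding c'_def y1_def near by (rule ne0)
        ultimately show "F \<in> {wallf n (k + 1) (mat 1)}" using FH by (auto simp: neg_apply)
      qed
    qed
    moreover have "hs.greatest {wallf n (k + 1) (mat 1)} = wallf n (k + 1) (mat 1)"
      using n G S_one walls_HS unfolding walls_def by (intro hs.greatest_eq) (blast, blast, simp add: hs_le_refl)
    ultimately show ?thesis unfolding path_def hs.word_def by (simp add: lab_wallf[OF n G(3)])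
  qed
  \<comment> \<open>Both points are next to the wall \<open>W\<close>, on its positive side. A
    separating \<open>F\<close> keeps its sign up to \<open>W\<close> at either end, so it changes
    sign between the points \<open>P\<close> and \<open>P'\<close> of \<open>W\<close> and would
    meet \<open>W\<close> there.\<close>
  have w3: "path c' (herm_act G a) = []"
  proof -
    have "side (herm_act G a) - side c' = {}"
    proof (rule ccontr)
      assume "side (herm_act G a) - side c' \<noteq> {}"
      then obtain F where "F \<in> side (herm_act G a) - side c'" by blast
      then have F: "F \<in> HS" "F (herm_act G a) > 0" "F c' \<le> 0" by (auto simp: side_def not_less)
      define W where "W = wallf n (k + 1) (mat 1)"
      have WH: "W \<in> HS" using n G S_one walls_HS unfolding W_def walls_def by blast
      have Wp: "W c' > 0" unfolding W_def c'_def y1_def near by (rule ne0)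
      have Wg: "W (herm_act G (hp y)) = real n * y - of_int k" for y
        using G(4)[OF hp_posdef, of y] S_posdef[OF G(1) hp_posdef] hp_wall
        unfolding W_def wallf_def by (simp add: herm_act_one)
      have Wga: "W (herm_act G a) > 0" unfolding a_def Wg y0_def using near[of k e, unfolded wallf_hp] ne0 by simp
      have ne: "F \<noteq> W" "F \<noteq> neg W" using F Wp Wga by (auto simp: neg_apply)
      define P where "P = herm_act G (hp y0)"
      define P' where "P' = hp y1"
      have pp: "P \<in> posdef" "P' \<in> posdef" using S_posdef[OF G(1) hp_posdef] hp_posdef by (auto simp: P_def P'_def)
      have WP: "W P = 0" "W P' = 0" unfolding P_def P'_def Wg using npos by (simp_all add: W_def wallf_hp y0_def y1_def del: of_int_add)
      have "F P > 0"
      proof (rule ccontr)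
        assume "\<not> F P > 0"
        then have m: "mv G F (hp y0) \<le> 0" "mv G F a \<ge> 0"
          using F hp_posdef by (auto simp: P_def mv_def a_def)
        have "mv G F = wallf n k (mat 1) \<or> mv G F = neg (wallf n k (mat 1))"
          using m e unfolding y0_def a_def e_def by (intro near_wall[OF n G(2) mv_HS[OF G(1) F(1)], of 0 "eps n"]) auto
        then have "mv G F (hp y0) = 0" using npos by (auto simp: wallf_hp neg_apply y0_def)
        then have "F P = 0" using hp_posdef by (simp add: mv_def P_def)
        then show False using hs_common_zero[OF F(1) WH pp(1) _ WP(1)] ne by blast
      qed
      moreover have "F P' < 0"
      proof (rule ccontr)
        assume "\<not> F P' < 0"
        then have "F = W \<or> F = neg W"
          using F e unfolding P'_def W_def y1_def c'_def e_def by (intro near_wall[OF n G(3) F(1), of "eps n" 0]) auto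
        then show False using ne by blast
      qed
      ultimately obtain t where t: "0 \<le> t" "t \<le> 1" "F ((1 - t) *\<^sub>R P' + t *\<^sub>R P) = 0"
        using hs_zero_on_segment[OF F(1) pp(2,1)] by (metis less_imp_le)
      moreover have "W ((1 - t) *\<^sub>R P' + t *\<^sub>R P) = 0"
        using hs_linear[OF WH pp(2,1) t(1,2)] WP by simp
      ultimately show False using hs_common_zero[OF F(1) WH segment_posdef[OF pp(2,1) t(1,2)]] ne by blast
    qed
    then show ?thesis unfolding path_def hs.word_def by (simp only: card.empty hs.chain_word.simps)
  qed
  have w4: "path (herm_act G a) (herm_act G base_point) = inv\<^bsub>FG\<^esub> (path base_point a)"
  proof -
    have "path base_point a \<otimes>\<^bsub>FG\<^esub> path a base_point = path base_point base_point"
      unfolding FG_mult using path_comp[OF offwall_base off(1) offwall_base] by simp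
    also have "\<dots> = \<one>\<^bsub>FG\<^esub>" unfolding path_def hs.word_def by (simp add: free_group_def)
    finally have "path a base_point = inv\<^bsub>FG\<^esub> (path base_point a)"
      using path_carrier offwall_base off by (metis F.inv_equality F.inv_inv)
    then show ?thesis using path_act[OF off(1) offwall_base G(1)] by simp
  qed
  have "dev G = path base_point c \<otimes>\<^bsub>FG\<^esub> (path c c' \<otimes>\<^bsub>FG\<^esub> (path c' (herm_act G a) \<otimes>\<^bsub>FG\<^esub> path (herm_act G a) (herm_act G base_point)))"
    unfolding dev_def FG_mult using path_comp offwall_base off ga by metis
  then have dG: "dev G = path base_point c \<otimes>\<^bsub>FG\<^esub> ([(idx n, True)] \<otimes>\<^bsub>FG\<^esub> inv\<^bsub>FG\<^esub> (path base_point a))"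
    unfolding w2 w3 w4 by (simp add: FG_mult)
  have ic: "idx n < card adm" using idx_bij n unfolding bij_betw_def by blast
  have xc: "[(idx n, v)] \<in> carrier FG" for v using ic by (simp add: free_group_def reduced_word_def)
  have cc: "path base_point c \<in> carrier FG" "path base_point a \<in> carrier FG"
    using path_carrier offwall_base off by auto
  have "[(idx n, True)] = inv\<^bsub>FG\<^esub> (path base_point c) \<otimes>\<^bsub>FG\<^esub> (dev G \<otimes>\<^bsub>FG\<^esub> path base_point a)"
    unfolding dG using cc xc[of True] by (simp add: F.m_assoc F.inv_solve_left)
  then have T: "[(idx n, True)] \<in> dev ` S"
    using subgroup.m_closed[OF I] subgroup.m_inv_closed[OF I] w1 w0 G(1) by (metis imageI)
  have "[(idx n, False)] \<otimes>\<^bsub>FG\<^esub> [(idx n, True)] = \<one>\<^bsub>FG\<^esub>"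
    by (simp add: FG_mult free_group_def inv_letter_def)
  then have "[(idx n, False)] = inv\<^bsub>FG\<^esub> [(idx n, True)]" using xc F.inv_equality by metis
  then have "[(idx n, False)] \<in> dev ` S" using T subgroup.m_inv_closed[OF I] by simp
  then show ?thesis using T by (cases b) auto
qed

lemma dev_surj: "dev ` S = carrier FG"
proof
  show "dev ` S \<subseteq> carrier FG" using dev_carrier by blast
  have letters: "[(idx n, b)] \<in> dev ` S" if "n \<in> adm" for n b
    using that
  proof (induction "nat (- D) - n" arbitrary: n b rule: less_induct)
    case less
    show ?case
    proof (rule letter_in_image[OF less.prems])
      fix m b assume "m \<in> adm" "m > n"
      moreover have "m < nat (- D)" using adm_less_D[OF \<open>m \<in> adm\<close>] by linarith
      ultimately show "[(idx m, b)] \<in> dev ` S" using less.hyps by simp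
    qed
  qed
  show "carrier FG \<subseteq> dev ` S"
  proof
    fix w assume "w \<in> carrier FG"
    then show "w \<in> dev ` S"
    proof (induction w)
      case Nil
      then show ?case using subgroup.one_closed[OF dev_subgroup] by (simp add: free_group_def)
    next
      case (Cons a w)
      then have w: "w \<in> carrier FG" "fst a < card adm" "reduced_word (a # w)"
        by (auto simp: free_group_def reduced_Cons)
      have "fst a \<in> idx ` adm" using idx_bij w(2) unfolding bij_betw_def by simp
      then obtain n where "n \<in> adm" "idx n = fst a" by (metis imageE)
      then have "[a] \<in> dev ` S" using letters[of n "snd a"] by simp
      moreover have "w \<in> dev ` S" using Cons.IH w by blast
      ultimately have "[a] \<otimes>\<^bsub>FG\<^esub> w \<in> dev ` S" using subgroup.m_closed[OF dev_subgroup] by blast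
      then show ?case using push_letter_reduced_Cons[OF w(3)] by (simp add: FG_mult)
    qed
  qed
qed

theorem Bianchi_group_free_quotient:
  assumes R: "quadratic_integers D = R"
  shows "\<exists>\<phi>. \<phi> \<in> epi (Bianchi_group D) FG"
proof -
  define N where "N = {mat 1, - mat 1 :: complex^2^2}"
  have SL: "carrier (SL2 R) = S" by (simp add: SL2_def S_def)
  have G: "group (SL2 R)" using R_add R_mult R_minus by (intro group_SL2) auto
  then interpret normal N "SL2 R"
    unfolding N_def using R_minus[OF R_1] by (intro normal_center_SL2) auto
  have coset: "N #>\<^bsub>SL2 R\<^esub> A = {A, - A}" for A
    unfolding N_def r_coset_def by (auto simp: SL2_def minus_matrix_mult)
  \<comment> \<open>A coset is \<open>{A, - A}\<close> and \<open>dev\<close> agrees on both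
    members, so any representative will do.\<close>
  define \<phi> where "\<phi> X = dev (SOME A. A \<in> X)" for X
  have phi: "\<phi> (N #>\<^bsub>SL2 R\<^esub> A) = dev A" for A
  proof -
    have "(SOME B. B \<in> {A, - A}) \<in> {A, - A}" by (rule someI[of _ A]) simp
    then show ?thesis unfolding \<phi>_def coset using dev_minus by auto
  qed
  have B: "Bianchi_group D = SL2 R Mod N" by (simp add: Bianchi_group_def PSL2_def R N_def)
  have carr: "carrier (Bianchi_group D) = (\<lambda>A. N #>\<^bsub>SL2 R\<^esub> A) ` S"
    unfolding B by (auto simp: FactGroup_def RCOSETS_def SL)
  have "\<phi> \<in> hom (Bianchi_group D) FG"
  proof (rule homI)
    fix X Y assume "X \<in> carrier (Bianchi_group D)" "Y \<in> carrier (Bianchi_group D)"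
    then obtain A A' where A: "X = N #>\<^bsub>SL2 R\<^esub> A" "Y = N #>\<^bsub>SL2 R\<^esub> A'" "A \<in> S" "A' \<in> S" unfolding carr by blast
    show "\<phi> X \<in> carrier FG" using A phi dev_carrier by simp
    have "X \<otimes>\<^bsub>Bianchi_group D\<^esub> Y = N #>\<^bsub>SL2 R\<^esub> (A \<otimes>\<^bsub>SL2 R\<^esub> A')"
      unfolding B using A rcos_sum SL by (simp add: FactGroup_def)
    then show "\<phi> (X \<otimes>\<^bsub>Bianchi_group D\<^esub> Y) = \<phi> X \<otimes>\<^bsub>FG\<^esub> \<phi> Y"
      using A phi dev_mult by (simp add: SL2_def)
  qed
  moreover have "\<phi> ` carrier (Bianchi_group D) = carrier FG"
    unfolding carr image_image phi by (rule dev_surj)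
  ultimately show ?thesis by (auto simp: epi_def)
qed

end

section \<open>Fundamental discriminants\<close>

lemma algebraic_int_quadratic:
  fixes z :: complex
  assumes "z * z = of_int a * z - of_int b"
  shows "algebraic_int z"
proof (rule algebraic_int.intros)
  show "lead_coeff [:of_int b, - of_int a, 1 :: complex:] = 1" by simp
  show "\<forall>i. Polynomial.coeff [:of_int b, - of_int a, 1 :: complex:] i \<in> \<int>"
    by (auto simp: coeff_pCons split: nat.splits)
  show "poly [:of_int b, - of_int a, 1:] z = 0" using assms by (simp add: algebra_simps)
qed

lemma csqrt_neg_int: "d < 0 \<Longrightarrow> csqrt (of_int d) = Complex 0 (sqrt (of_int (- d)))"
proof -
  assume d: "d < 0"
  have "csqrt (of_int d) = csqrt (- of_real (of_int (- d)))" by simp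
  also have "\<dots> = \<i> * csqrt (of_real (of_int (- d)))" using d by (intro csqrt_minus) auto
  finally show ?thesis using d by (simp add: csqrt_of_real_nonneg complex_eq_iff)
qed

lemma quadratic_integers_norm: 
  assumes "d < 0" "z \<in> quadratic_integers d" shows "z * cnj z \<in> \<int>"
  using assms bounded_denominators_norm quadratic_integers_iff by blast

locale fundamental_data =
  fixes d :: int and w1 w2 :: complex
  assumes d: "d < 0"
    and O: "quadratic_integers d = {of_int x * w1 + of_int y * w2 | x y. True}"
    and disc: "of_int d = (w1 * cnj w2 - w2 * cnj w1)\<^sup>2"

text \<open>The discriminant is the square of a rational multiple of the root of \<open>m\<close>,
  so the roots of \<open>d\<close> and of \<open>m\<close> generate the same field; the basis can be
  referred to \<open>d\<close> alone.\<close>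

lemma fundamental_dataI:
  assumes "negative_fundamental_discriminant d"
  shows "\<exists>w1 w2. fundamental_data d w1 w2"
proof -
  obtain K m w1 w2 where d: "d < 0" and m: "m < 0" "K = quadratic_field m" and ib: "integral_basis K w1 w2"
    and disc: "of_int d = (w1 * cnj w2 - w2 * cnj w1)\<^sup>2"
    using assms unfolding negative_fundamental_discriminant_def imaginary_quadratic_field_def is_discriminant_def
    by blast
  have O: "ring_of_integers (quadratic_field m) = {of_int x * w1 + of_int y * w2 | x y. True}"
    using ib m(2) unfolding integral_basis_def by (elim conjE) simp
  have "of_int 1 * w1 + of_int 0 * w2 \<in> ring_of_integers (quadratic_field m)"
    "of_int 0 * w1 + of_int 1 * w2 \<in> ring_of_integers (quadratic_field m)" unfolding O by blast+
  then have "w1 \<in> quadratic_field m" "w2 \<in> quadratic_field m" by (auto simp: ring_of_integers_def)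
  then obtain a1 b1 a2 b2 where w: "w1 = of_rat a1 + of_rat b1 * csqrt (of_int m)" "w2 = of_rat a2 + of_rat b2 * csqrt (of_int m)"
    unfolding quadratic_field_def by blast
  define r where "r = csqrt (of_int m)"
  define \<rho> where "\<rho> = 2 * (b1 * a2 - a1 * b2)"
  have cr: "cnj r = - r" using csqrt_neg_int[OF m(1)] by (simp add: r_def complex_eq_iff)
  have cq: "cnj (of_rat x) = of_rat x" for x by (simp add: complex_eq_iff)
  have "w1 * cnj w2 - w2 * cnj w1 = of_rat \<rho> * r"
    unfolding w r_def[symmetric] \<rho>_def by (simp add: cr cq of_rat_mult of_rat_diff algebra_simps)
  then have "(csqrt (of_int d))\<^sup>2 = (of_rat \<rho> * r)\<^sup>2" using disc by simp
  then obtain \<sigma> where s: "csqrt (of_int d) = of_rat \<sigma> * r"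
    unfolding power2_eq_iff using that[of \<rho>] that[of "- \<rho>"] by (auto simp: of_rat_minus)
  have "csqrt (of_int d) \<noteq> 0" using d by simp
  then have s0: "\<sigma> \<noteq> 0" using s by auto
  have "quadratic_field d = quadratic_field m"
  proof
    show "quadratic_field d \<subseteq> quadratic_field m"
    proof
      fix z assume "z \<in> quadratic_field d"
      then obtain a b where "z = of_rat a + of_rat b * csqrt (of_int d)" unfolding quadratic_field_def by blast
      then have "z = of_rat a + of_rat (b * \<sigma>) * csqrt (of_int m)" using s by (simp add: of_rat_mult r_def)
      then show "z \<in> quadratic_field m" unfolding quadratic_field_def by blast
    qed
    show "quadratic_field m \<subseteq> quadratic_field d"
    proof
      fix z assume "z \<in> quadratic_field m"
      then obtain a b where "z = of_rat a + of_rat b * csqrt (of_int m)" unfolding quadratic_field_def by blast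
      then have "z = of_rat a + of_rat (b / \<sigma>) * csqrt (of_int d)" using s s0 by (simp add: of_rat_divide r_def)
      then show "z \<in> quadratic_field d" unfolding quadratic_field_def by blast
    qed
  qed
  then show ?thesis
    using d O disc unfolding fundamental_data_def quadratic_integers_def by metis
qed

context fundamental_data
begin

lemma w_in: "w1 \<in> quadratic_integers d" "w2 \<in> quadratic_integers d"
proof -
  have "of_int 1 * w1 + of_int 0 * w2 \<in> quadratic_integers d" "of_int 0 * w1 + of_int 1 * w2 \<in> quadratic_integers d"
    unfolding O by blast+
  then show "w1 \<in> quadratic_integers d" "w2 \<in> quadratic_integers d" by simp_all
qed

text \<open>Stickelberger's argument: \<open>d = t\<^sup>2 - 4 * n1 * n2\<close> with
  \<open>t\<close> the trace of \<open>w1 * cnj w2\<close> and \<open>n1\<close>, \<open>n2\<close>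
  the norms of the basis.\<close>

lemma disc_mod_4: "4 dvd d * d - d"
proof -
  have "w1 * cnj w1 \<in> \<int>" "w2 * cnj w2 \<in> \<int>" "(w1 + w2) * cnj (w1 + w2) \<in> \<int>"
    using quadratic_integers_norm[OF d] w_in quadratic_integers_add[OF d] by blast+
  then obtain n1 n2 n3 where n: "w1 * cnj w1 = of_int n1" "w2 * cnj w2 = of_int n2" "(w1 + w2) * cnj (w1 + w2) = of_int n3"
    unfolding Ints_def by blast
  define t where "t = n3 - n1 - n2"
  have "w1 * cnj w2 + w2 * cnj w1 = (w1 + w2) * cnj (w1 + w2) - w1 * cnj w1 - w2 * cnj w2"
    by (simp add: algebra_simps)
  then have t: "w1 * cnj w2 + w2 * cnj w1 = of_int t" unfolding n t_def by simp
  have "of_int d = (w1 * cnj w2 + w2 * cnj w1)\<^sup>2 - 4 * (w1 * cnj w1) * (w2 * cnj w2)"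
    unfolding disc by (simp add: power2_eq_square algebra_simps)
  also have "\<dots> = of_int (t\<^sup>2 - 4 * n1 * n2)" unfolding t n by simp
  finally have dd: "d = t\<^sup>2 - 4 * n1 * n2" by (simp only: of_int_eq_iff)
  show ?thesis
  proof (cases "even t")
    case True
    then obtain s where "t = 2 * s" by blast
    then have "d = 4 * (s\<^sup>2 - n1 * n2)" using dd by (simp add: power2_eq_square algebra_simps)
    then show ?thesis by (metis dvd_diff dvd_mult2 dvd_triv_left)
  next
    case False
    then obtain s where "t = 2 * s + 1" by (elim oddE)
    then have "d - 1 = 4 * (s\<^sup>2 + s - n1 * n2)" using dd by (simp add: power2_eq_square algebra_simps)
    moreover have "d * d - d = d * (d - 1)" by (simp add: algebra_simps)
    ultimately show ?thesis by (metis dvd_mult dvd_triv_left)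
  qed
qed

text \<open>The element is half of \<open>e\<close> plus a square root of \<open>e\<close>, with
  trace \<open>e\<close> and norm \<open>(e\<^sup>2 - e) / 4\<close>. For \<open>p = 1\<close> it is
  \<open>om\<close>; for \<open>p > 1\<close> it is too fine for a ring of discriminant
  \<open>d\<close>, which excludes such factorizations.\<close>

lemma generator_in:
  assumes e: "d = p * p * e" "p > 0" "4 dvd e * e - e"
  shows "(of_int e + csqrt (of_int d) / of_int p) / 2 \<in> quadratic_integers d" (is "?z \<in> _")
proof -
  obtain b where b: "e * e - e = 4 * b" using e(3) by blast
  have "?z * ?z = (of_int e * of_int e + 2 * of_int e * (csqrt (of_int d) / of_int p) + csqrt (of_int d) * csqrt (of_int d) / (of_int p * of_int p)) / 4"
  proof -
    have "((E + X) / 2) * ((E + X) / 2) = (E * E + 2 * E * X + X * X) / 4" for E X :: complex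
      by (simp add: field_simps)
    then show ?thesis by simp
  qed
  also have "csqrt (of_int d) * csqrt (of_int d) / (of_int p * of_int p) = of_int e"
    unfolding csqrt_sq using e by simp
  also have "(of_int e * of_int e + 2 * of_int e * (csqrt (of_int d) / of_int p) + of_int e) / 4 = of_int e * ?z - of_int (e * e - e) / 4"
    using e(2) by (simp add: field_simps)
  also have "\<dots> = of_int e * ?z - of_int b" unfolding b by simp
  finally have "algebraic_int ?z" by (rule algebraic_int_quadratic)
  moreover have "?z = of_rat (of_int e / 2) + of_rat (1 / (2 * of_int p)) * csqrt (of_int d)"
    by (simp add: of_rat_divide of_rat_mult field_simps)
  then have "?z \<in> quadratic_field d" unfolding quadratic_field_def by blast
  ultimately show ?thesis by (simp add: quadratic_integers_def ring_of_integers_def)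
qed

end

lemma (in imaginary_quadratic_order) om_csqrt: "om = (of_int D + csqrt (of_int D)) / 2"
  using D csqrt_neg_int[of D] by (simp add: om_def q_def complex_eq_iff)

theorem fundamental_order:
  assumes "negative_fundamental_discriminant d" "d < - 4"
  shows "imaginary_quadratic_order d" "quadratic_integers d = imaginary_quadratic_order.R d"
proof -
  obtain w1 w2 where "fundamental_data d w1 w2" using fundamental_dataI[OF assms(1)] by blast
  then interpret f: fundamental_data d w1 w2 .
  show "imaginary_quadratic_order d" using assms(2) f.disc_mod_4 by unfold_locales
  then interpret i: imaginary_quadratic_order d .
  have omO: "i.om \<in> quadratic_integers d"
    unfolding i.om_csqrt using f.generator_in[of 1 d] f.disc_mod_4 by simp
  have "i.R \<subseteq> quadratic_integers d"
    unfolding i.R_def using omO quadratic_integers_add[OF f.d] quadratic_integers_mult[OF f.d] quadratic_integers_of_int[OF f.d]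
    by blast
  moreover have "quadratic_integers d \<subseteq> i.R"
  proof -
    have "of_int 1 \<in> quadratic_integers d" using quadratic_integers_of_int[OF f.d] by blast
    then obtain x y where xy: "1 = of_int x * w1 + of_int y * w2" unfolding f.O by auto
    obtain u v where uv: "i.om = of_int u * w1 + of_int v * w2" using omO unfolding f.O by auto
    \<comment> \<open>The determinant of \<open>1\<close>, \<open>om\<close> in terms of
      \<open>w1\<close>, \<open>w2\<close>. Both pairs have discriminant \<open>d\<close>, so it is
      1 or -1 and Cramer's rule inverts the change of basis over the integers.\<close>
    define \<mu> where "\<mu> = x * v - y * u"
    have "cnj i.om - i.om = (of_int x * w1 + of_int y * w2) * cnj i.om - i.om * cnj (of_int x * w1 + of_int y * w2)"
      unfolding xy[symmetric] by simp
    also have "\<dots> = of_int \<mu> * (w1 * cnj w2 - w2 * cnj w1)"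
      unfolding uv \<mu>_def by (simp add: algebra_simps)
    finally have "(cnj i.om - i.om)\<^sup>2 = (of_int \<mu>)\<^sup>2 * of_int d" unfolding f.disc by (simp add: power_mult_distrib)
    moreover have "(cnj i.om - i.om)\<^sup>2 = of_int d"
    proof -
      have "cnj i.om - i.om = - csqrt (of_int d)" unfolding i.cnj_om unfolding i.om_csqrt by (simp add: field_simps)
      then show ?thesis by simp
    qed
    ultimately have "of_int d = (of_int (\<mu>\<^sup>2 * d) :: complex)" by simp
    then have "d = \<mu>\<^sup>2 * d" by (simp only: of_int_eq_iff)
    then have mu: "\<mu> * \<mu> = 1" using f.d by (simp add: power2_eq_square)
    have "of_int v - of_int y * i.om = of_int v * (of_int x * w1 + of_int y * w2) - of_int y * i.om" unfolding xy[symmetric] by simp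
    also have "\<dots> = of_int \<mu> * w1" unfolding uv \<mu>_def by (simp add: algebra_simps)
    finally have "of_int \<mu> * of_int \<mu> * w1 = of_int \<mu> * (of_int v - of_int y * i.om)" by simp
    then have w1: "w1 = of_int \<mu> * (of_int v - of_int y * i.om)" using mu by (metis mult_1 of_int_1 of_int_mult)
    have "of_int x * i.om - of_int u = of_int x * i.om - of_int u * (of_int x * w1 + of_int y * w2)" unfolding xy[symmetric] by simp
    also have "\<dots> = of_int \<mu> * w2" unfolding uv \<mu>_def by (simp add: algebra_simps)
    finally have "of_int \<mu> * of_int \<mu> * w2 = of_int \<mu> * (of_int x * i.om - of_int u)" by simp
    then have w2: "w2 = of_int \<mu> * (of_int x * i.om - of_int u)" using mu by (metis mult_1 of_int_1 of_int_mult)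
    have "i.om \<in> i.R" using i.RI[of 0 1] by simp
    then have "w1 \<in> i.R" "w2 \<in> i.R" unfolding w1 w2 by (auto intro!: i.R_mult i.R_diff)
    then show ?thesis unfolding f.O by (auto intro!: i.R_add i.R_mult)
  qed
  ultimately show "quadratic_integers d = i.R" by blast
qed

lemma fundamental_no_square:
  assumes "negative_fundamental_discriminant d" "d < - 4" "d = p * p * e" "p > 1"
  shows "\<not> 4 dvd e * e - e"
proof
  assume e4: "4 dvd e * e - e"
  obtain w1 w2 where "fundamental_data d w1 w2" using fundamental_dataI[OF assms(1)] by blast
  then interpret f: fundamental_data d w1 w2 .
  interpret i: imaginary_quadratic_order d using fundamental_order(1)[OF assms(1,2)] .
  have "(of_int e + csqrt (of_int d) / of_int p) / 2 \<in> i.R"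
    using f.generator_in[OF assms(3) _ e4] assms(4) fundamental_order(2)[OF assms(1,2)] by simp
  then obtain x y where xy: "(of_int e + csqrt (of_int d) / of_int p) / 2 = of_int x + of_int y * i.om"
    unfolding i.R_def by blast
  have "csqrt (of_int d) = Complex 0 (2 * i.q)" unfolding csqrt_neg_int[OF f.d] i.q_def by simp
  then have "Im ((of_int e + csqrt (of_int d) / of_int p) / 2) = i.q / of_int p" by (simp add: Im_divide power2_eq_square)
  then have "i.q / of_int p = of_int y * i.q" unfolding xy by (simp add: i.om_def)
  then have "of_int (y * p) = (1::real)" using i.q_gt_1 assms(4) by (simp add: field_simps)
  then have "y * p = 1" by (simp only: of_int_eq_1_iff)
  then have "p dvd 1" by (metis dvd_triv_right)
  then show False using assms(4) by simp
qed

theorem fundamental_odd_part: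
  assumes "negative_fundamental_discriminant d" "d < - 4"
  obtains e d' where "d = - (2 ^ e * int d')" "odd d'" "squarefree d'" "e = 0 \<or> e = 2 \<or> e = 3"
proof -
  interpret i: imaginary_quadratic_order d using fundamental_order(1)[OF assms] .
  have odd_sq: "\<not> p * p dvd d" if p: "odd p" "p > 1" for p
  proof
    assume "p * p dvd d"
    then obtain e where e: "d = p * p * e" by blast
    obtain s where s: "p = 2 * s + 1" using p(1) by (elim oddE)
    \<comment> \<open>From \<open>p\<^sup>2 - 1 = 4 * (s\<^sup>2 + s)\<close>: for odd
      \<open>p\<close> the condition modulo 4 passes from \<open>d\<close> to
      \<open>e\<close>.\<close>
    define K where "K = (s * s + s) * (e * e * (p * p + 1) - e)"
    have "d * d - d = (e * e - e) + 4 * K"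
      unfolding e s K_def by (simp add: algebra_simps)
    then have "4 dvd (e * e - e) + 4 * K" using i.D4 by simp
    then have "4 dvd e * e - e" by (simp add: dvd_add_left_iff)
    then show False using fundamental_no_square[OF assms e p(2)] by blast
  qed
  have sqf: "squarefree d'" if d': "int d' dvd d" "odd d'" for d'
    unfolding squarefree_def
  proof (intro allI impI)
    fix x assume x: "x\<^sup>2 dvd d'"
    then have "odd x" using d'(2) by (metis dvd_trans even_power pos2)
    have "(int x)\<^sup>2 dvd int d'" using x by (metis int_dvd_int_iff of_nat_power)
    then have "int x * int x dvd d" using d'(1) by (metis dvd_trans power2_eq_square)
    then have "\<not> int x > 1" using odd_sq[of "int x"] \<open>odd x\<close> by auto
    then show "is_unit x" using \<open>odd x\<close> by (cases x) auto
  qed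
  show ?thesis
  proof (cases "odd d")
    case True
    define d' where "d' = nat (- d)"
    have "d = - (2 ^ 0 * int d')" "odd d'" using assms(2) True by (auto simp: d'_def even_nat_iff)
    then show ?thesis using that[of 0 d'] sqf[of d'] by auto
  next
    case False
    then have "odd (d - 1)" by simp
    then have "coprime 4 (d - 1)" by (metis coprime_commute coprime_left_2_iff_odd coprime_mult_right_iff mult_2 numeral_Bit0 coprime_power_left_iff)
    moreover have "4 dvd (d - 1) * d" using i.D4 by (simp add: algebra_simps)
    ultimately have "4 dvd d" using coprime_dvd_mult_right_iff by blast
    then obtain m where m: "d = 2 * 2 * m" by auto
    have n4: "\<not> 4 dvd m * m - m" using fundamental_no_square[OF assms m] by simp
    show ?thesis
    proof (cases "odd m")
      case True
      define d' where "d' = nat (- m)"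
      have "int d' = - m" using assms(2) m by (simp add: d'_def)
      then have "d = - (2 ^ 2 * int d')" "odd d'" using True m by (auto simp flip: even_of_nat_iff) (metis True even_minus even_of_nat)
      then show ?thesis using that[of 2 d'] sqf[of d'] m \<open>int d' = - m\<close> by auto
    next
      case False
      then obtain m' where m': "m = 2 * m'" by blast
      have "odd m'"
      proof
        assume "even m'"
        then obtain m'' where "m' = 2 * m''" by blast
        then have "m * m - m = 4 * (m'' * (m - 1))" unfolding m' by (simp add: algebra_simps)
        then show False using n4 by simp
      qed
      define d' where "d' = nat (- m')"
      have i: "int d' = - m'" using assms(2) m m' by (simp add: d'_def)
      then have "odd d'" using \<open>odd m'\<close> by (metis even_minus even_of_nat)
      moreover have "d = - (2 ^ 3 * int d')" using i m m' by simp
      ultimately show ?thesis using that[of 3 d'] sqf[of d'] i m m' by auto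
    qed
  qed
qed

section \<open>Jacobi symbols\<close>

lemma Legendre_cases: "Legendre a p = 0 \<or> Legendre a p = 1 \<or> Legendre a p = - 1"
  by (simp add: Legendre_def)

lemma Legendre_eq_0_iff: "Legendre a p = 0 \<longleftrightarrow> p dvd a"
  by (simp add: Legendre_def cong_0_iff)

lemma Legendre_cong: "[a = b] (mod p) \<Longrightarrow> Legendre a p = Legendre b p"
proof -
  assume ab: "[a = b] (mod p)"
  then have "[y = a] (mod p) \<longleftrightarrow> [y = b] (mod p)" for y using cong_trans cong_sym by blast
  moreover have "[a = 0] (mod p) \<longleftrightarrow> [b = 0] (mod p)" using ab cong_trans cong_sym by blast
  ultimately show ?thesis by (simp add: Legendre_def QuadRes_def)
qed

lemma small_cong_eq:
  fixes x y :: int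
  assumes "[x = y] (mod int p)" "p > 2" "x = 0 \<or> x = 1 \<or> x = - 1" "y = 0 \<or> y = 1 \<or> y = - 1"
  shows "x = y"
proof -
  have "int p dvd x - y" using assms(1) by (simp add: cong_iff_dvd_diff)
  moreover have "\<bar>x - y\<bar> < int p" using assms by auto
  ultimately show ?thesis using zdvd_not_zless[of "\<bar>x - y\<bar>" "int p"] by (cases "x = y") auto
qed

lemma Legendre_mult:
  assumes "prime p" "p > 2"
  shows "Legendre (a * b) (int p) = Legendre a (int p) * Legendre b (int p)"
proof -
  let ?e = "(p - 1) div 2"
  have "[Legendre (a * b) (int p) = (a * b) ^ ?e] (mod int p)"
    using euler_criterion[OF assms] .
  moreover have "[Legendre a (int p) * Legendre b (int p) = a ^ ?e * b ^ ?e] (mod int p)"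
    using euler_criterion[OF assms] cong_mult by blast
  ultimately have "[Legendre (a * b) (int p) = Legendre a (int p) * Legendre b (int p)] (mod int p)"
    by (metis cong_sym cong_trans power_mult_distrib)
  then show ?thesis
    by (rule small_cong_eq) (use assms Legendre_cases[of a "int p"] Legendre_cases[of b "int p"] Legendre_cases[of "a * b" "int p"] in auto)
qed

definition jacobi :: "int \<Rightarrow> nat \<Rightarrow> int" where
  "jacobi a n = (\<Prod>p\<in>#prime_factorization n. Legendre a (int p))"

lemma jacobi_1 [simp]: "jacobi a 1 = 1" "jacobi a (Suc 0) = 1"
  by (simp_all add: jacobi_def)

lemma jacobi_prime: "prime p \<Longrightarrow> jacobi a p = Legendre a (int p)"
  by (simp add: jacobi_def prime_factorization_prime)

lemma jacobi_mult_right: "m > 0 \<Longrightarrow> n > 0 \<Longrightarrow> jacobi a (m * n) = jacobi a m * jacobi a n"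
  by (simp add: jacobi_def prime_factorization_mult)

lemma odd_factor_induct [consumes 1, case_names one factor]:
  assumes "odd (n::nat)" "P 1" "\<And>p m. prime p \<Longrightarrow> odd p \<Longrightarrow> odd m \<Longrightarrow> P m \<Longrightarrow> P (p * m)"
  shows "P n"
  using assms(1)
proof (induction n rule: prime_divisors_induct)
  case (factor p x)
  then show ?case using assms(3) by simp
qed (use assms(2) in auto)

lemma odd_prime_gt_2: "prime p \<Longrightarrow> odd (p::nat) \<Longrightarrow> p > 2"
  using prime_ge_2_nat[of p] by (cases "p = 2") auto

lemma jacobi_cases:
  assumes "odd n" shows "jacobi a n = 0 \<or> jacobi a n = 1 \<or> jacobi a n = - 1"
  using assms
proof (induction rule: odd_factor_induct)
  case (factor p m)
  then have "jacobi a (p * m) = Legendre a (int p) * jacobi a m"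
    by (simp add: jacobi_mult_right jacobi_prime odd_pos)
  then show ?case using factor Legendre_cases[of a "int p"] by auto
qed simp

lemma jacobi_mult_left:
  assumes "odd n" shows "jacobi (a * b) n = jacobi a n * jacobi b n"
  using assms
proof (induction rule: odd_factor_induct)
  case (factor p m)
  then show ?case
    using Legendre_mult[OF factor(1) odd_prime_gt_2[OF factor(1,2)], of a b]
    by (simp add: jacobi_mult_right jacobi_prime odd_pos)
qed simp

lemma jacobi_cong:
  assumes "odd n" "[a = b] (mod int n)" shows "jacobi a n = jacobi b n"
  using assms
proof (induction rule: odd_factor_induct)
  case (factor p m)
  then have "[a = b] (mod int p)" "[a = b] (mod int m)"
    by (auto simp: cong_iff_dvd_diff intro: dvd_trans[of "int p" "int p * int m"] dvd_trans[of "int m" "int p * int m"])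
  then show ?case using factor Legendre_cong
    by (simp add: jacobi_mult_right jacobi_prime odd_pos)
qed simp

lemma jacobi_eq_0_iff:
  assumes "odd n" shows "jacobi a n = 0 \<longleftrightarrow> \<not> coprime a (int n)"
  using assms
proof (induction rule: odd_factor_induct)
  case (factor p m)
  have "int p dvd a \<longleftrightarrow> \<not> coprime a (int p)"
    using factor(1) prime_imp_coprime[of "int p" a] not_prime_unit coprime_absorb_right
    by (metis coprime_commute coprime_common_divisor dvd_refl prime_nat_int_transfer)
  then show ?case using factor by (auto simp: jacobi_mult_right jacobi_prime odd_pos Legendre_eq_0_iff)
qed simp

lemma jacobi_one_left: "odd n \<Longrightarrow> jacobi 1 n = 1"
proof (induction rule: odd_factor_induct)
  case (factor p m)
  have "Legendre 1 (int p) = 1"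
  proof -
    have "\<not> int p dvd 1" using factor(1) by auto
    moreover have "QuadRes (int p) 1" unfolding QuadRes_def by (intro exI[of _ 1]) simp
    ultimately show ?thesis by (simp add: Legendre_def cong_0_iff)
  qed
  then show ?case using factor by (simp add: jacobi_mult_right jacobi_prime odd_pos)
qed simp

text \<open>\<open>(m * n - 1) div 2\<close> and \<open>(m - 1) div 2 + (n - 1) div 2\<close> differ
  by an even number. This carries the sign of reciprocity from primes to products.\<close>

lemma sign_mult:
  assumes "odd m" "odd (n::nat)"
  shows "(-1::int) ^ ((m * n - 1) div 2 * e) = (-1) ^ ((m - 1) div 2 * e) * (-1) ^ ((n - 1) div 2 * e)"
proof -
  obtain a b where ab: "m = 2 * a + 1" "n = 2 * b + 1" using assms by (meson oddE)
  have "(m * n - 1) div 2 = 2 * a * b + a + b" unfolding ab by (simp add: algebra_simps)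
  then have "(m * n - 1) div 2 * e = 2 * (a * b * e) + (a * e + b * e)" by (simp add: algebra_simps)
  then have "(-1::int) ^ ((m * n - 1) div 2 * e) = (-1) ^ (a * e) * (-1) ^ (b * e)"
    by (simp add: power_add)
  then show ?thesis unfolding ab by simp
qed

lemma jacobi_reciprocity_prime:
  assumes "odd m" "prime q" "odd q" "coprime m q"
  shows "jacobi (int m) q * jacobi (int q) m = (-1) ^ ((m - 1) div 2 * ((q - 1) div 2))"
  using assms(1,4)
proof (induction rule: odd_factor_induct)
  case one
  then show ?case using assms by (simp add: jacobi_one_left)
next
  case (factor p m)
  have pq: "p \<noteq> q" using factor(5) assms(2) by auto
  have "Legendre (int p) (int q) * Legendre (int q) (int p) = (-1::int) ^ ((p - 1) div 2 * ((q - 1) div 2))"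
    using Quadratic_Reciprocity[OF factor(1) odd_prime_gt_2[OF factor(1,2)] assms(2) odd_prime_gt_2[OF assms(2,3)] pq] .
  moreover have "jacobi (int m) q * jacobi (int q) m = (-1) ^ ((m - 1) div 2 * ((q - 1) div 2))"
    using factor by simp
  moreover have "jacobi (int (p * m)) q * jacobi (int q) (p * m) =
     (Legendre (int p) (int q) * Legendre (int q) (int p)) * (jacobi (int m) q * jacobi (int q) m)"
  proof -
    have "jacobi (int (p * m)) q = Legendre (int p) (int q) * jacobi (int m) q"
      using jacobi_mult_left[OF assms(3), of "int p" "int m"] jacobi_prime[OF assms(2), of "int p"] by simp
    moreover have "jacobi (int q) (p * m) = Legendre (int q) (int p) * jacobi (int q) m"
      using factor by (simp add: jacobi_mult_right jacobi_prime odd_pos)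
    ultimately show ?thesis by simp
  qed
  ultimately show ?case using sign_mult[OF factor(2,3)] by metis
qed

lemma jacobi_reciprocity:
  assumes "odd n" "odd m" "coprime m n"
  shows "jacobi (int m) n * jacobi (int n) m = (-1) ^ ((m - 1) div 2 * ((n - 1) div 2))"
  using assms(1,3)
proof (induction rule: odd_factor_induct)
  case one
  then show ?case using assms by (simp add: jacobi_one_left)
next
  case (factor p n)
  have "jacobi (int m) p * jacobi (int p) m = (-1) ^ ((m - 1) div 2 * ((p - 1) div 2))"
    using jacobi_reciprocity_prime[OF assms(2) factor(1,2)] factor(5) by simp
  moreover have "jacobi (int m) n * jacobi (int n) m = (-1) ^ ((m - 1) div 2 * ((n - 1) div 2))"
    using factor by simp
  moreover have "jacobi (int m) (p * n) * jacobi (int (p * n)) m =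
     (jacobi (int m) p * jacobi (int p) m) * (jacobi (int m) n * jacobi (int n) m)"
    using factor assms by (simp add: jacobi_mult_right jacobi_mult_left odd_pos)
  moreover have "(-1::int) ^ ((m - 1) div 2 * ((p * n - 1) div 2)) =
     (-1) ^ ((m - 1) div 2 * ((p - 1) div 2)) * (-1) ^ ((m - 1) div 2 * ((n - 1) div 2))"
    using sign_mult[OF factor(2,3), of "(m - 1) div 2"] by (simp add: mult.commute)
  ultimately show ?case by simp
qed

lemma jacobi_minus_one:
  assumes "odd n" shows "jacobi (- 1) n = (- 1) ^ ((n - 1) div 2)"
  using assms
proof (induction rule: odd_factor_induct)
  case (factor p m)
  have p: "p > 2" by (rule odd_prime_gt_2[OF factor(1,2)])
  have "[Legendre (- 1) (int p) = (- 1) ^ ((p - 1) div 2)] (mod int p)"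
    using euler_criterion[OF factor(1) p] .
  then have "Legendre (- 1) (int p) = (- 1) ^ ((p - 1) div 2)"
    by (rule small_cong_eq) (use p Legendre_cases in \<open>auto simp: minus_one_power_iff\<close>)
  then show ?case using factor sign_mult[OF factor(2,3), of 1]
    by (simp add: jacobi_mult_right jacobi_prime odd_pos)
qed simp

text \<open>Since \<open>-2 \<equiv> n\<close> modulo \<open>n + 2\<close> and \<open>2 \<equiv> n + 2\<close> modulo \<open>n\<close>, reciprocity relates the symbols of 2
  modulo \<open>n + 2\<close> and modulo \<open>n\<close>.\<close>
lemma jacobi_two_step:
  assumes "odd n" shows "jacobi 2 (n + 2) = (- 1) ^ ((n + 1) div 2) * jacobi 2 n"
proof -
  have o: "odd (n + 2)" using assms by simp
  have "jacobi 2 (n + 2) = jacobi (- 1) (n + 2) * jacobi (- 2) (n + 2)"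
    using jacobi_mult_left[OF o, of "- 1" "- 2"] by simp
  also have "jacobi (- 2) (n + 2) = jacobi (int n) (n + 2)"
  proof (rule jacobi_cong[OF o])
    have "- 2 - int n = int (n + 2) * (- 1)" by simp
    then show "[- 2 = int n] (mod int (n + 2))" unfolding cong_iff_dvd_diff by (metis dvd_triv_left)
  qed
  also have "jacobi (- 1) (n + 2) = (- 1) ^ ((n + 1) div 2)" using jacobi_minus_one[OF o] by simp
  finally have 1: "jacobi 2 (n + 2) = (- 1) ^ ((n + 1) div 2) * jacobi (int n) (n + 2)" .
  obtain i where i: "n = 2 * i + 1" using assms by (elim oddE)
  have "coprime n 2" using assms by simp
  then have "coprime n (n + 2)" by (metis add.commute coprime_iff_gcd_eq_1 gcd_add2)
  then have "jacobi (int n) (n + 2) * jacobi (int (n + 2)) n = (- 1) ^ (i * (i + 1))"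
    using jacobi_reciprocity[OF o assms] i by simp
  also have "(- 1 :: int) ^ (i * (i + 1)) = 1" by (auto simp: minus_one_power_iff)
  finally have "jacobi (int n) (n + 2) * jacobi (int (n + 2)) n = 1" .
  moreover have "jacobi (int (n + 2)) n = jacobi 2 n"
    by (rule jacobi_cong[OF assms]) (simp add: cong_iff_dvd_diff)
  ultimately have "jacobi (int n) (n + 2) = jacobi 2 n"
    using jacobi_cases[OF assms, of 2] by auto
  then show ?thesis using 1 by simp
qed

text \<open>Over four steps the signs of \<open>jacobi_two_step\<close> cancel.\<close>

lemma jacobi_two: "jacobi 2 (8 * k + 1) = 1"
proof (induction k)
  case (Suc k)
  have "jacobi 2 (8 * k + 1 + 2 + 2 + 2 + 2) = jacobi 2 (8 * k + 1)"
    by (subst jacobi_two_step, simp)+ (simp add: minus_one_power_iff)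
  moreover have "8 * Suc k + 1 = 8 * k + 1 + 2 + 2 + 2 + 2" by simp
  ultimately show ?case using Suc by (simp only:)
qed simp

text \<open>Reciprocity without signs moves the fixed discriminant to the bottom: as a function of
  \<open>n\<close> the symbol becomes a character of odd squarefree modulus, to which Gauss sums
  apply.\<close>

lemma jacobi_one_mod_8:
  assumes n: "n mod 8 = 1" and d: "d = - (2 ^ e * int d')" "odd d'"
  shows "jacobi d n = jacobi (int n) d'"
proof -
  obtain k where k: "n = 8 * k + 1" using n by (metis mult.commute div_mult_mod_eq)
  have o: "odd n" using k by simp
  have "jacobi (2 ^ e) n = 1" by (induction e) (use jacobi_two[of k] k o in \<open>auto simp: jacobi_mult_left jacobi_one_left\<close>)
  moreover have "jacobi (- 1) n = 1" using jacobi_minus_one[OF o] k by (simp add: minus_one_power_iff)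
  moreover have "jacobi d n = jacobi (- 1) n * (jacobi (2 ^ e) n * jacobi (int d') n)"
    using d(1) jacobi_mult_left[OF o] by (metis mult_minus1)
  ultimately have "jacobi d n = jacobi (int d') n" by simp
  also have "\<dots> = jacobi (int n) d'"
  proof (cases "coprime d' n")
    case True
    have "jacobi (int d') n * jacobi (int n) d' = (- 1) ^ ((d' - 1) div 2 * ((n - 1) div 2))"
      using jacobi_reciprocity[OF o d(2) True] .
    also have "\<dots> = 1" using k by (simp add: minus_one_power_iff)
    finally show ?thesis using jacobi_cases[OF o, of "int d'"] by auto
  next
    case False
    then have "jacobi (int d') n = 0" "jacobi (int n) d' = 0"
      using jacobi_eq_0_iff o d(2) by (auto simp: coprime_commute)
    then show ?thesis by simp
  qed
  finally show ?thesis .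
qed

section \<open>Gauss sums\<close>

lemma sum_residues_shift:
  fixes f :: "int \<Rightarrow> 'a::comm_monoid_add"
  assumes q: "q > 0" and per: "\<And>x. f (x mod q) = f x" and u: "coprime u q"
  shows "(\<Sum>x\<in>{0..<q}. f (u * x + v)) = (\<Sum>x\<in>{0..<q}. f x)"
proof -
  have inj: "inj_on (\<lambda>x. (u * x + v) mod q) {0..<q}"
  proof (rule inj_onI)
    fix x y assume xy: "x \<in> {0..<q}" "y \<in> {0..<q}" "(u * x + v) mod q = (u * y + v) mod q"
    then have "q dvd u * (x - y)" by (simp add: mod_eq_dvd_iff right_diff_distrib)
    then have "q dvd x - y" using u by (metis coprime_commute coprime_dvd_mult_right_iff)
    then have "x mod q = y mod q" by (simp add: mod_eq_dvd_iff)
    then show "x = y" using xy by simp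
  qed
  have "(\<lambda>x. (u * x + v) mod q) ` {0..<q} = {0..<q}"
    using q by (intro endo_inj_surj inj) auto
  then have "(\<Sum>x\<in>{0..<q}. f x) = (\<Sum>x\<in>(\<lambda>x. (u * x + v) mod q) ` {0..<q}. f x)" by simp
  also have "\<dots> = (\<Sum>x\<in>{0..<q}. f ((u * x + v) mod q))" by (simp add: sum.reindex[OF inj])
  finally show ?thesis by (simp add: per)
qed

lemma sum_rotate:
  "(\<Sum>i\<in>A. \<Sum>j\<in>B. \<Sum>k\<in>C. F i j k) = (\<Sum>k\<in>C. \<Sum>i\<in>A. \<Sum>j\<in>B. F i j k)"
proof -
  have "(\<Sum>i\<in>A. \<Sum>j\<in>B. \<Sum>k\<in>C. F i j k) = (\<Sum>i\<in>A. \<Sum>k\<in>C. \<Sum>j\<in>B. F i j k)"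
    by (intro sum.cong refl) (rule sum.swap)
  also have "\<dots> = (\<Sum>k\<in>C. \<Sum>i\<in>A. \<Sum>j\<in>B. F i j k)" by (rule sum.swap)
  finally show ?thesis .
qed

locale gauss_sum =
  fixes m :: nat
  assumes m: "odd m" "squarefree m"
begin

definition e :: "int \<Rightarrow> complex" where "e k = cis (2 * pi * of_int k / real m)"

definition psi :: "int \<Rightarrow> complex" where "psi k = of_int (jacobi k m)"

definition G :: "int \<Rightarrow> complex" where "G k = (\<Sum>a\<in>{0..<int m}. psi a * e (a * k))"

lemma m_pos: "m > 0" using m by (simp add: odd_pos)

lemma e_add: "e (a + b) = e a * e b"
  by (simp add: e_def cis_mult add_divide_distrib distrib_left)

lemma e_cnj: "cnj (e a) = e (- a)"
  by (simp add: e_def cis_cnj)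

lemma e_m: "e (int m * k) = 1"
proof -
  have "2 * pi * of_int (int m * k) / real m = 2 * pi * of_int k" using m_pos by simp
  then show ?thesis unfolding e_def by (metis cis_multiple_2pi Ints_of_int)
qed

lemma e_cong: "[a = b] (mod int m) \<Longrightarrow> e a = e b"
proof -
  assume "[a = b] (mod int m)"
  then obtain k where "b = a + int m * k" by (metis cong_iff_lin)
  then show ?thesis by (simp add: e_add e_m)
qed

lemma e_norm: "norm (e a) = 1" by (simp add: e_def)

lemma e_mod: "e (x mod int m * k) = e (x * k)"
  by (rule e_cong) (metis cong_mod_left cong_refl cong_scalar_right)

lemma psi_mod: "psi (x mod int m) = psi x"
  unfolding psi_def using jacobi_cong[OF m(1), of "x mod int m" x] by (simp add: cong_mod_left)

lemma psi_mult: "psi (a * b) = psi a * psi b"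
  by (simp add: psi_def jacobi_mult_left[OF m(1)])

lemma psi_square: "coprime a (int m) \<Longrightarrow> psi a * psi a = 1"
proof -
  assume "coprime a (int m)"
  then have "jacobi a m = 1 \<or> jacobi a m = - 1" using jacobi_eq_0_iff[OF m(1)] jacobi_cases[OF m(1)] by blast
  then show ?thesis by (auto simp: psi_def)
qed

lemma psi_cnj: "cnj (psi a) = psi a" by (simp add: psi_def)

lemma sum_e: "(\<Sum>a\<in>{0..<int m}. e (a * k)) = (if int m dvd k then of_nat m else 0)"
proof (cases "int m dvd k")
  case True
  then obtain j where j: "k = int m * j" by blast
  have "e (a * k) = 1" for a unfolding j using e_m[of "a * j"] by (simp add: mult.left_commute)
  then show ?thesis using True by simp
next
  case False
  have ne: "e k \<noteq> 1"
  proof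
    assume "e k = 1"
    then have "cos (2 * pi * of_int k / real m) = 1" by (metis e_def cis.simps(1) one_complex.simps(1))
    then obtain j :: int where "2 * pi * of_int k / real m = of_int j * (2 * pi)" by (auto simp: cos_one_2pi_int)
    then have "of_int k = (of_int (int m * j) :: real)" using m_pos by (simp add: field_simps)
    then have "k = int m * j" by (simp only: of_int_eq_iff)
    then show False using False by simp
  qed
  let ?s = "\<Sum>a\<in>{0..<int m}. e (a * k)"
  have "?s = (\<Sum>a\<in>{0..<int m}. e ((1 * a + 1) * k))"
    using sum_residues_shift[of "int m" "\<lambda>x. e (x * k)" 1 1] m_pos e_mod by simp
  also have "\<dots> = (\<Sum>a\<in>{0..<int m}. e k * e (a * k))"
    by (intro sum.cong refl) (simp add: distrib_right e_add)
  also have "\<dots> = e k * ?s" by (simp only: sum_distrib_left)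
  finally have "(1 - e k) * ?s = 0" by (simp add: algebra_simps)
  then show ?thesis using ne False by simp
qed

text \<open>Primitivity of the character. By the Chinese remainder theorem \<open>u\<close> is a
  nonresidue modulo \<open>p\<close> and 1 modulo \<open>m / p\<close>; squarefreeness makes these
  moduli coprime.\<close>

lemma twist:
  assumes p: "prime p" "p dvd m"
  shows "\<exists>u. coprime u (int m) \<and> psi u = - 1 \<and> int m dvd (u - 1) * int p"
proof -
  have po: "odd p" using p m(1) by (metis dvd_trans)
  obtain h where h: "p = 2 * h + 1" using po by (elim oddE)
  have "h > 0" using odd_prime_gt_2[OF p(1) po] h by simp
  have "\<exists>g. \<not> int p dvd g \<and> \<not> QuadRes (int p) g"
  proof (rule ccontr)
    assume "\<not> ?thesis"
    then have all: "QuadRes (int p) g" if "\<not> int p dvd g" for g using that by blast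
    \<comment> \<open>If every unit were a square, the squares of \<open>0..h\<close>, at most
      \<open>h + 1 < p\<close> residues, would exhaust all residues.\<close>
    have "{0..<int p} \<subseteq> (\<lambda>x. x\<^sup>2 mod int p) ` {0..int h}"
    proof
      fix g assume g: "g \<in> {0..<int p}"
      have "QuadRes (int p) g"
      proof (cases "int p dvd g")
        case True
        then have "[0\<^sup>2 = g] (mod int p)" by (simp add: cong_0_iff cong_sym_eq[of 0])
        then show ?thesis unfolding QuadRes_def by blast
      qed (rule all)
      then obtain y where y: "[y\<^sup>2 = g] (mod int p)" unfolding QuadRes_def by blast
      define z where "z = y mod int p"
      have z: "0 \<le> z" "z < int p" "[z = y] (mod int p)" using prime_gt_0_nat[OF p(1)] by (auto simp: z_def)
      define w where "w = (if z \<le> int h then z else int p - z)"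
      have w: "w \<in> {0..int h}" using z h by (auto simp: w_def)
      have "[w\<^sup>2 = z\<^sup>2] (mod int p)"
        by (auto simp: w_def cong_iff_dvd_diff power2_eq_square algebra_simps)
      also have "[z\<^sup>2 = y\<^sup>2] (mod int p)" using z(3) by (rule cong_pow)
      also note y
      finally have "w\<^sup>2 mod int p = g" using g by (simp add: cong_def)
      then show "g \<in> (\<lambda>x. x\<^sup>2 mod int p) ` {0..int h}" using w by blast
    qed
    then have "card {0..<int p} \<le> card {0..int h}" by (rule surj_card_le[rotated]) simp
    then show False using h \<open>h > 0\<close> by simp
  qed
  then obtain g where g: "\<not> int p dvd g" "\<not> QuadRes (int p) g" by blast
  obtain r where r: "m = p * r" using p(2) by blast
  have "\<not> p dvd r"
  proof
    assume "p dvd r"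
    then have "p\<^sup>2 dvd m" using r by (simp add: power2_eq_square)
    then have "is_unit p" using m(2) by (auto simp: squarefree_def)
    then show False using p by auto
  qed
  then have co: "coprime (int p) (int r)" using p(1) prime_imp_coprime by simp
  obtain u where u: "[u = g] (mod int p)" "[u = 1] (mod int r)"
    using binary_chinese_remainder_int[OF co] by blast
  have ro: "odd r" using m(1) r by simp
  have "Legendre u (int p) = - 1" using Legendre_cong[OF u(1)] g by (simp add: Legendre_def cong_0_iff)
  moreover have "jacobi u r = 1" using jacobi_cong[OF ro u(2)] jacobi_one_left[OF ro] by simp
  ultimately have j: "jacobi u m = - 1"
    unfolding r using p(1) ro by (simp add: jacobi_mult_right jacobi_prime prime_gt_0_nat odd_pos)
  then have "coprime u (int m)" using jacobi_eq_0_iff[OF m(1), of u] by auto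
  moreover have "int r dvd u - 1" using u(2) by (simp add: cong_iff_dvd_diff)
  then have "int m dvd (u - 1) * int p" unfolding r by (simp add: mult.commute)
  ultimately show ?thesis using j by (auto simp: psi_def)
qed

text \<open>For \<open>k\<close> coprime to \<open>m\<close> this is a substitution. Otherwise
  multiplication by the \<open>u\<close> of \<open>twist\<close> fixes every exponential and flips
  the character, so \<open>G k = 0\<close>.\<close>

lemma G_eq: "G k = psi k * G 1"
proof (cases "coprime k (int m)")
  case True
  have "psi k * G k = (\<Sum>a\<in>{0..<int m}. psi (k * a) * e ((k * a) * 1))"
    unfolding G_def by (simp add: sum_distrib_left psi_mult mult_ac)
  also have "\<dots> = (\<Sum>a\<in>{0..<int m}. psi (k * a + 0) * e ((k * a + 0) * 1))" by simp
  also have "\<dots> = G 1"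
    unfolding G_def using m_pos True psi_mod e_mod[of _ 1]
    by (intro sum_residues_shift[of "int m" "\<lambda>x. psi x * e (x * 1)"]) auto
  finally have "psi k * (psi k * G k) = psi k * G 1" by simp
  then show ?thesis using psi_square[OF True] by (metis mult.assoc mult_1)
next
  case False
  then have "gcd k (int m) \<noteq> 0" "\<not> is_unit (gcd k (int m))" using m_pos by (auto simp: is_unit_gcd)
  then obtain p' where p': "prime p'" "p' dvd k" "p' dvd int m"
    using prime_divisor_exists by (meson dvd_trans gcd_dvd1 gcd_dvd2)
  then obtain p where p: "p' = int p" "prime p" "p dvd m" "int p dvd k"
    by (metis int_dvd_int_iff nonneg_int_cases prime_ge_0_int prime_nat_int_transfer)
  obtain u where u: "coprime u (int m)" "psi u = - 1" "int m dvd (u - 1) * int p" using twist[OF p(2,3)] by blast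
  have eu: "e (u * a * k) = e (a * k)" for a
  proof (rule e_cong)
    have "int m dvd (u - 1) * k" using u(3) p(4) by (metis dvd_trans mult_dvd_mono dvd_refl)
    then have "int m dvd a * ((u - 1) * k)" by simp
    then show "[u * a * k = a * k] (mod int m)" by (simp add: cong_iff_dvd_diff algebra_simps)
  qed
  have "G k = (\<Sum>a\<in>{0..<int m}. psi (u * a + 0) * e ((u * a + 0) * k))"
    unfolding G_def using m_pos u(1) psi_mod e_mod[of _ k]
    by (intro sum_residues_shift[of "int m" "\<lambda>x. psi x * e (x * k)", symmetric]) auto
  also have "\<dots> = psi u * G k"
    unfolding G_def sum_distrib_left by (simp only: psi_mult eu[unfolded mult.assoc] add_0_right mult.assoc)
  finally have "G k = 0" using u(2) by simp
  moreover have "psi k = 0" using False jacobi_eq_0_iff[OF m(1)] by (simp add: psi_def)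
  ultimately show ?thesis by simp
qed

text \<open>Summing the squared modulus of \<open>G k\<close> over all \<open>k\<close> gives
  \<open>m * C\<close> by orthogonality and \<open>C\<close> times that of \<open>G 1\<close> by
  \<open>G_eq\<close>, where \<open>C\<close> counts the units.\<close>

lemma G_norm: "(norm (G 1))\<^sup>2 = real m"
proof -
  define C where "C = (\<Sum>a\<in>{0..<int m}. psi a * cnj (psi a))"
  have "(\<Sum>k\<in>{0..<int m}. G k * cnj (G k)) =
      (\<Sum>k\<in>{0..<int m}. \<Sum>a\<in>{0..<int m}. \<Sum>b\<in>{0..<int m}. psi a * psi b * e (k * (a - b)))"
    unfolding G_def cnj_sum sum_product
    by (simp add: psi_cnj e_cnj mult_ac right_diff_distrib e_add[of "_ * _" "- (_ * _)", symmetric] algebra_simps)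
  also have "\<dots> = (\<Sum>a\<in>{0..<int m}. \<Sum>b\<in>{0..<int m}. \<Sum>k\<in>{0..<int m}. psi a * psi b * e (k * (a - b)))"
    by (rule sum_rotate[symmetric])
  also have "\<dots> = (\<Sum>a\<in>{0..<int m}. \<Sum>b\<in>{0..<int m}. if a = b then of_nat m * (psi a * psi b) else 0)"
  proof (intro sum.cong refl)
    fix a b assume ab: "a \<in> {0..<int m}" "b \<in> {0..<int m}"
    have "int m dvd a - b \<longleftrightarrow> a = b" using ab by (metis atLeastLessThan_iff mod_eq_dvd_iff mod_pos_pos_trivial)
    then show "(\<Sum>k\<in>{0..<int m}. psi a * psi b * e (k * (a - b))) = (if a = b then of_nat m * (psi a * psi b) else 0)"
      unfolding sum_distrib_left[symmetric] sum_e by auto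
  qed
  also have "\<dots> = of_nat m * C" unfolding C_def psi_cnj by (simp add: sum_distrib_left)
  finally have 1: "(\<Sum>k\<in>{0..<int m}. G k * cnj (G k)) = of_nat m * C" .
  have "(\<Sum>k\<in>{0..<int m}. G k * cnj (G k)) = C * (G 1 * cnj (G 1))"
    unfolding C_def sum_distrib_right by (intro sum.cong refl) (subst (1 2) G_eq, simp add: mult_ac)
  with 1 have e: "C * (G 1 * cnj (G 1)) = C * of_nat m" by (simp add: mult.commute)
  have Cr: "C = of_real (\<Sum>a\<in>{0..<int m}. (cmod (psi a))\<^sup>2)" unfolding C_def by (simp only: of_real_sum complex_norm_square)
  have "C \<noteq> 0"
  proof
    assume "C = 0"
    then have "(\<Sum>a\<in>{0..<int m}. (cmod (psi a))\<^sup>2) = 0" using Cr by (metis of_real_eq_0_iff)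
    then have "\<forall>a\<in>{0..<int m}. (cmod (psi a))\<^sup>2 = 0" by (subst (asm) sum_nonneg_eq_0_iff) auto
    moreover have "1 mod int m \<in> {0..<int m}" using m_pos by simp
    ultimately have "psi (1 mod int m) = 0" by fastforce
    then show False using psi_mod[of 1] jacobi_one_left[OF m(1)] by (simp add: psi_def)
  qed
  then have "G 1 * cnj (G 1) = of_nat m" using e by simp
  then show ?thesis by (metis complex_norm_square of_real_eq_iff of_real_of_nat_eq)
qed

text \<open>The double sum has Fejer weights, which have nonnegative Fourier coefficients; this spares the
  logarithm of the Polya-Vinogradov inequality.\<close>
theorem double_sum_bound:
  assumes c: "coprime c (int m)" and H: "H \<le> m"
  shows "\<bar>\<Sum>i<H. \<Sum>j<H. jacobi (c * (int i - int j) + r) m\<bar> \<le> real H * sqrt (real m)"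
proof -
  define T where "T = (\<Sum>i<H. \<Sum>j<H. psi (c * (int i - int j) + r))"
  define E where "E a = (\<Sum>i<H. e (a * c * int i))" for a
  \<comment> \<open>Multiplying by \<open>G 1\<close> expands the character into exponentials, and
    the double sum factors into the nonnegative weights \<open>E a * cnj (E a)\<close>.\<close>
  have "G 1 * T = (\<Sum>i<H. \<Sum>j<H. G (c * (int i - int j) + r))"
    unfolding T_def by (simp add: sum_distrib_left G_eq[of "_ + _"] mult.commute)
  also have "\<dots> = (\<Sum>i<H. \<Sum>j<H. \<Sum>a\<in>{0..<int m}. psi a * e (a * r) * (e (a * c * int i) * cnj (e (a * c * int j))))"
    unfolding G_def by (simp add: e_cnj e_add[symmetric] mult.assoc algebra_simps)
  also have "\<dots> = (\<Sum>a\<in>{0..<int m}. \<Sum>i<H. \<Sum>j<H. psi a * e (a * r) * (e (a * c * int i) * cnj (e (a * c * int j))))"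
    by (rule sum_rotate)
  also have "\<dots> = (\<Sum>a\<in>{0..<int m}. psi a * e (a * r) * (E a * cnj (E a)))"
    unfolding E_def cnj_sum sum_product by (simp add: sum_distrib_left)
  finally have GT: "G 1 * T = (\<Sum>a\<in>{0..<int m}. psi a * e (a * r) * (E a * cnj (E a)))" .
  have psi1: "norm (psi a) \<le> 1" for a using jacobi_cases[OF m(1), of a] by (auto simp: psi_def)
  have "norm (G 1 * T) \<le> (\<Sum>a\<in>{0..<int m}. norm (psi a * e (a * r) * (E a * cnj (E a))))"
    unfolding GT by (rule norm_sum)
  also have "\<dots> \<le> (\<Sum>a\<in>{0..<int m}. (cmod (E a))\<^sup>2)"
    using psi1 by (intro sum_mono) (simp add: norm_mult e_norm power2_eq_square mult_left_le_one_le)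
  finally have 1: "norm (G 1 * T) \<le> (\<Sum>a\<in>{0..<int m}. (cmod (E a))\<^sup>2)" .
  have "of_real (\<Sum>a\<in>{0..<int m}. (cmod (E a))\<^sup>2) = (\<Sum>a\<in>{0..<int m}. E a * cnj (E a))"
    by (simp only: of_real_sum complex_norm_square)
  also have "\<dots> = (\<Sum>a\<in>{0..<int m}. \<Sum>i<H. \<Sum>j<H. e (a * (c * (int i - int j))))"
    unfolding E_def cnj_sum sum_product by (simp add: e_cnj e_add[symmetric] algebra_simps)
  also have "\<dots> = (\<Sum>i<H. \<Sum>j<H. \<Sum>a\<in>{0..<int m}. e (a * (c * (int i - int j))))"
    by (rule sum_rotate[symmetric])
  \<comment> \<open>Since \<open>H \<le> m\<close>, distinct \<open>i\<close> and \<open>j\<close>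
    are incongruent and only the diagonal survives.\<close>
  also have "\<dots> = (\<Sum>i<H. \<Sum>j<H. if i = j then of_nat m else 0)"
  proof (intro sum.cong refl)
    fix i j assume ij: "i \<in> {..<H}" "j \<in> {..<H}"
    have "int m dvd c * (int i - int j) \<longleftrightarrow> int m dvd int i - int j"
      using c by (metis coprime_commute coprime_dvd_mult_right_iff)
    also have "\<dots> \<longleftrightarrow> int i mod int m = int j mod int m" by (simp add: mod_eq_dvd_iff)
    also have "\<dots> \<longleftrightarrow> i = j" using ij H by simp
    finally show "(\<Sum>a\<in>{0..<int m}. e (a * (c * (int i - int j)))) = (if i = j then of_nat m else 0)"
      unfolding sum_e by simp
  qed
  also have "\<dots> = of_real (real H * real m)" by simp
  finally have 2: "(\<Sum>a\<in>{0..<int m}. (cmod (E a))\<^sup>2) = real H * real m" by (simp only: of_real_eq_iff)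
  have "norm (G 1) = sqrt (real m)" using G_norm by (metis norm_ge_zero real_sqrt_unique)
  then have "sqrt (real m) * norm T \<le> real H * (sqrt (real m) * sqrt (real m))"
    using 1 2 by (simp add: norm_mult)
  then have "sqrt (real m) * norm T \<le> sqrt (real m) * (real H * sqrt (real m))" by (simp only: mult_ac)
  then have "norm T \<le> real H * sqrt (real m)" using m_pos by (simp only: mult_le_cancel_left) auto
  moreover have "T = of_real (of_int (\<Sum>i<H. \<Sum>j<H. jacobi (c * (int i - int j) + r) m))"
    by (simp add: T_def psi_def)
  ultimately show ?thesis by (simp only: norm_of_real)
qed

end

section \<open>A weighted sieve\<close>

text \<open>An error decaying like \<open>m powr (- \<alpha>)\<close> makes truncating the sieve
  unnecessary: the errors of all products of sieving primes sum to an Euler product.\<close>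

locale weighted_sieve =
  fixes I :: "'x set" and \<nu> :: "'x \<Rightarrow> nat" and M E \<alpha> :: real and \<epsilon> :: "nat \<Rightarrow> real"
  assumes fin: "finite I" and pos: "\<And>x. x \<in> I \<Longrightarrow> \<nu> x > 0"
    and M: "M \<ge> 0" and \<alpha>: "\<alpha> > 0"
    and W: "\<And>m. odd m \<Longrightarrow> \<bar>real (card {x \<in> I. m dvd \<nu> x}) - M / real m\<bar> \<le> E * real m powr (- \<alpha>)"
    and \<epsilon>: "\<And>p. \<epsilon> p = 0 \<or> \<epsilon> p = - 1"
begin

definition F :: "nat set \<Rightarrow> nat \<Rightarrow> real" where
  "F P n = (\<Prod>p\<in>P. \<epsilon> p ^ multiplicity p n)"

text \<open>The mean of \<open>\<epsilon> p ^ multiplicity p n\<close>: exponent \<open>k\<close>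
  has density \<open>(1 - 1/p) / p ^ k\<close>, and the geometric series is summed.\<close>

definition kap :: "nat \<Rightarrow> real" where "kap p = (1 - 1 / real p) / (1 - \<epsilon> p / real p)"

text \<open>With \<open>x = p powr (- \<alpha>)\<close> this is
  \<open>1 + 2 * (x + x\<^sup>2 + ...)\<close>: each positive power of \<open>p\<close> contributes
  its error twice, the zeroth power once.\<close>

definition lam :: "nat \<Rightarrow> real" where "lam p = (1 + real p powr (- \<alpha>)) / (1 - real p powr (- \<alpha>))"

lemma kap_mult: "p > 1 \<Longrightarrow> kap p * (1 - \<epsilon> p / real p) = 1 - 1 / real p"
proof -
  assume "p > 1"
  then have "1 - \<epsilon> p / real p > 0" using \<epsilon>[of p] by (auto intro: add_pos_pos)
  then have "1 - \<epsilon> p / real p \<noteq> 0" by linarith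
  then show ?thesis unfolding kap_def by (simp only: times_divide_eq_left nonzero_mult_div_cancel_right not_False_eq_True)
qed

lemma kap_bounds: "p > 1 \<Longrightarrow> 0 \<le> kap p \<and> kap p \<le> 1"
  using \<epsilon>[of p] by (auto simp: kap_def divide_le_eq_1 intro!: divide_nonneg_pos add_pos_pos)

lemma kap_rec: "p > 1 \<Longrightarrow> kap p = (1 - 1 / real p) + \<epsilon> p * (kap p / real p)"
  using kap_mult[of p] by (simp add: algebra_simps)

lemma powr_lt_1: "p > 1 \<Longrightarrow> real p powr (- \<alpha>) < 1"
  using \<alpha> powr_less_one[of "real p" "- \<alpha>"] by simp

lemma lam_ge: "p > 1 \<Longrightarrow> lam p \<ge> 1"
  using powr_lt_1[of p] by (simp add: lam_def field_simps)

lemma lam_rec: "p > 1 \<Longrightarrow> lam p = 1 + real p powr (- \<alpha>) + real p powr (- \<alpha>) * lam p"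
proof -
  assume "p > 1"
  then have "lam p * (1 - real p powr (- \<alpha>)) = 1 + real p powr (- \<alpha>)"
    using powr_lt_1[of p] \<alpha> by (simp add: lam_def)
  then show ?thesis by (simp add: algebra_simps)
qed

text \<open>Adding a prime \<open>p\<close> replaces a sum \<open>G 0\<close> by \<open>G 0 - G 1 + \<epsilon> p (G 1 - G 2) + \<dots>\<close>, where \<open>G k\<close> is restricted to the
  multiples of \<open>p ^ k\<close>; all error terms stay summable because they carry the power \<open>- \<alpha>\<close>.\<close>
lemma sieve_aux:
  assumes P: "finite P" "\<And>p. p \<in> P \<Longrightarrow> prime p \<and> odd p"
    and m: "odd m" "\<And>p. p \<in> P \<Longrightarrow> \<not> p dvd m"
  shows "\<bar>(\<Sum>x\<in>{x \<in> I. m dvd \<nu> x}. F P (\<nu> x)) - M / real m * (\<Prod>p\<in>P. kap p)\<bar>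
           \<le> E * real m powr (- \<alpha>) * (\<Prod>p\<in>P. lam p)"
  using P m
proof (induction P arbitrary: m rule: finite_induct)
  case empty
  then show ?case using W[of m] by (simp add: F_def)
next
  case (insert p P)
  have p: "prime p" "odd p" using insert.prems(1) by auto
  have p1: "p > 1" using prime_gt_1_nat[OF p(1)] .
  define K where "K = (\<Prod>p\<in>P. kap p)"
  define L where "L = (\<Prod>p\<in>P. lam p)"
  define G where "G k = (\<Sum>x\<in>{x \<in> I. m * p ^ k dvd \<nu> x}. F P (\<nu> x))" for k
  \<comment> \<open>The sum over multiples of \<open>p ^ k\<close> with \<open>k\<close> of the
    factors \<open>\<epsilon> p\<close> removed; \<open>U 0\<close> is the sum wanted.\<close>
  define U where "U k = (\<Sum>x\<in>{x \<in> I. m * p ^ k dvd \<nu> x}. F P (\<nu> x) * \<epsilon> p ^ (multiplicity p (\<nu> x) - k))" for k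
  define A where "A k = E * real (m * p ^ k) powr (- \<alpha>) * L" for k
  have K: "0 \<le> K" unfolding K_def using insert.prems(1) kap_bounds prime_gt_1_nat by (intro prod_nonneg) auto
  have Gb: "\<bar>G k - M / real (m * p ^ k) * K\<bar> \<le> A k" for k
    unfolding G_def A_def K_def L_def
  proof (rule insert.IH)
    show "odd (m * p ^ k)" using insert.prems p by simp
    fix r assume r: "r \<in> P"
    then have "prime r" "r \<noteq> p" using insert.prems insert.hyps by auto
    then show "\<not> r dvd m * p ^ k" using insert.prems(3)[of r] r p(1)
      by (metis insertI2 prime_dvd_mult_iff prime_dvd_power primes_dvd_imp_eq)
  qed (use insert.prems in auto)
  have A_pos: "A k \<ge> 0" for k using Gb[of k] by linarith
  have A_Suc: "A (Suc k) = A k * real p powr (- \<alpha>)" for k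
  proof -
    have "real (m * p ^ Suc k) = real (m * p ^ k) * real p" by simp
    then show ?thesis unfolding A_def by (simp only: powr_mult of_nat_0_le_iff) (simp add: mult_ac)
  qed
  have pm: "\<not> p dvd m" using insert.prems(3)[of p] by simp
  have dvd_iff: "m * p ^ k dvd \<nu> x \<longleftrightarrow> m dvd \<nu> x \<and> k \<le> multiplicity p (\<nu> x)" if "x \<in> I" for k x
  proof -
    have "coprime m (p ^ k)" using prime_imp_coprime[OF p(1) pm] by (simp add: coprime_commute)
    then have "m * p ^ k dvd \<nu> x \<longleftrightarrow> m dvd \<nu> x \<and> p ^ k dvd \<nu> x"
      by (meson divides_mult dvd_mult_left dvd_mult_right)
    also have "p ^ k dvd \<nu> x \<longleftrightarrow> k \<le> multiplicity p (\<nu> x)"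
      using pos[OF that] p by (intro power_dvd_iff_le_multiplicity) auto
    finally show ?thesis .
  qed
  have rec: "U k = (G k - G (Suc k)) + \<epsilon> p * U (Suc k)" for k
  proof -
    let ?A = "{x \<in> I. m * p ^ k dvd \<nu> x}" and ?B = "{x \<in> I. m * p ^ Suc k dvd \<nu> x}"
    have BA: "?B \<subseteq> ?A" using dvd_iff by auto
    have fA: "finite ?A" using fin by simp
    have "U k = (\<Sum>x\<in>?A - ?B. F P (\<nu> x) * \<epsilon> p ^ (multiplicity p (\<nu> x) - k)) +
        (\<Sum>x\<in>?B. F P (\<nu> x) * \<epsilon> p ^ (multiplicity p (\<nu> x) - k))"
      unfolding U_def by (rule sum.subset_diff[OF BA fA])
    also have "(\<Sum>x\<in>?A - ?B. F P (\<nu> x) * \<epsilon> p ^ (multiplicity p (\<nu> x) - k)) = (\<Sum>x\<in>?A - ?B. F P (\<nu> x))"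
      by (intro sum.cong refl) (auto simp: dvd_iff not_less_eq_eq simp del: power_Suc)
    also have "\<dots> = G k - G (Suc k)" unfolding G_def using sum.subset_diff[OF BA fA, of "\<lambda>x. F P (\<nu> x)"] by simp
    also have "(\<Sum>x\<in>?B. F P (\<nu> x) * \<epsilon> p ^ (multiplicity p (\<nu> x) - k)) = \<epsilon> p * U (Suc k)"
      unfolding U_def sum_distrib_left
    proof (intro sum.cong refl)
      fix x assume "x \<in> ?B"
      then have "Suc k \<le> multiplicity p (\<nu> x)" using dvd_iff[of x "Suc k"] by auto
      then have "multiplicity p (\<nu> x) - k = Suc (multiplicity p (\<nu> x) - Suc k)" by simp
      then show "F P (\<nu> x) * \<epsilon> p ^ (multiplicity p (\<nu> x) - k) = \<epsilon> p * (F P (\<nu> x) * \<epsilon> p ^ (multiplicity p (\<nu> x) - Suc k))"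
        by simp
    qed
    finally show ?thesis .
  qed
  \<comment> \<open>From \<open>k = N\<close> on no value is a multiple of \<open>p ^ k\<close>; the
    recursion runs downwards from there.\<close>
  define N where "N = (\<Sum>x\<in>I. \<nu> x)"
  have big: "{x \<in> I. m * p ^ k dvd \<nu> x} = {}" if "k \<ge> N" for k
  proof -
    have "False" if x: "x \<in> I" "m * p ^ k dvd \<nu> x" for x
    proof -
      have "p ^ k dvd \<nu> x" using x(2) by (rule dvd_mult_right)
      then have "p ^ k \<le> \<nu> x" using pos[OF x(1)] by (rule dvd_imp_le)
      also have "\<nu> x \<le> N" unfolding N_def using x(1) fin by (intro member_le_sum) auto
      also have "N < 2 ^ N" by (rule less_exp)
      also have "(2::nat) ^ N \<le> 2 ^ k" using \<open>k \<ge> N\<close> by simp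
      also have "(2::nat) ^ k \<le> p ^ k" using p1 by (intro power_mono) auto
      finally show False by simp
    qed
    then show ?thesis by blast
  qed
  have claim: "\<bar>U k - M / real (m * p ^ k) * K * kap p\<bar> \<le> A k * lam p" for k
  proof (induction "N - k" arbitrary: k)
    case 0
    \<comment> \<open>The sum is empty, and \<open>Gb\<close> shows that the main term is then
      itself within the error.\<close>
    then have b: "{x \<in> I. m * p ^ k dvd \<nu> x} = {}" using big by simp
    have c: "0 \<le> M / real (m * p ^ k) * K" using M K by simp
    have "\<bar>U k - M / real (m * p ^ k) * K * kap p\<bar> = (M / real (m * p ^ k) * K) * kap p"
      unfolding U_def b using mult_nonneg_nonneg[OF c, of "kap p"] kap_bounds[OF p1]
      by (simp only: sum.empty diff_0 abs_minus_cancel abs_of_nonneg)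
    also have "\<dots> \<le> (M / real (m * p ^ k) * K) * 1" using c kap_bounds[OF p1] by (intro mult_left_mono) auto
    also have "\<dots> \<le> A k" using Gb[of k, unfolded G_def b] c by (simp only: sum.empty diff_0 abs_minus_cancel abs_of_nonneg mult_1_right)
    also have "\<dots> \<le> A k * lam p" using mult_left_mono[OF lam_ge[OF p1] A_pos] by simp
    finally show ?case .
  next
    case (Suc l)
    have "l = N - Suc k" using Suc.hyps(2) by simp
    note IH = Suc.hyps(1)[OF this]
    define X where "X = M / real (m * p ^ k) * K"
    have X1: "M / real (m * p ^ Suc k) * K = X / real p" unfolding X_def by simp
    have "U k - X * kap p = (G k - X) - (G (Suc k) - X / real p) + \<epsilon> p * (U (Suc k) - X / real p * kap p)"
    proof -
      have "X * kap p = X * ((1 - 1 / real p) + \<epsilon> p * (kap p / real p))" using kap_rec[OF p1] by simp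
      then show ?thesis unfolding rec[of k] by (simp add: algebra_simps)
    qed
    then have "\<bar>U k - X * kap p\<bar> \<le> \<bar>G k - X\<bar> + \<bar>G (Suc k) - X / real p\<bar> + \<bar>\<epsilon> p\<bar> * \<bar>U (Suc k) - X / real p * kap p\<bar>"
    proof -
      have "\<bar>x - y + z\<bar> \<le> \<bar>x\<bar> + \<bar>y\<bar> + \<bar>z\<bar>" for x y z :: real by linarith
      then show ?thesis using \<open>U k - X * kap p = _\<close> by (simp only: abs_mult[symmetric])
    qed
    also have "\<dots> \<le> A k + A (Suc k) + 1 * (A (Suc k) * lam p)"
    proof (intro add_mono mult_mono)
      show "\<bar>G k - X\<bar> \<le> A k" using Gb[of k] by (simp add: X_def)
      show "\<bar>G (Suc k) - X / real p\<bar> \<le> A (Suc k)" using Gb[of "Suc k"] unfolding X1 .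
      show "\<bar>U (Suc k) - X / real p * kap p\<bar> \<le> A (Suc k) * lam p" using IH unfolding X1 .
    qed (use \<epsilon>[of p] in auto)
    also have "\<dots> = A k * (1 + real p powr (- \<alpha>) + real p powr (- \<alpha>) * lam p)"
      unfolding A_Suc by (simp add: algebra_simps)
    also have "\<dots> = A k * lam p" using lam_rec[OF p1] by simp
    finally show ?case unfolding X_def .
  qed
  have FU: "F (insert p P) n = F P n * \<epsilon> p ^ multiplicity p n" for n
    unfolding F_def using insert.hyps by (simp add: mult.commute)
  have "\<bar>U 0 - M / real m * K * kap p\<bar> \<le> A 0 * lam p" using claim[of 0] by simp
  then show ?case
    unfolding FU K_def L_def A_def U_def using insert.hyps by (simp add: mult_ac)
qed

lemma sieve:
  assumes P: "finite P" "\<And>p. p \<in> P \<Longrightarrow> prime p \<and> odd p"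
  shows "\<bar>(\<Sum>x\<in>I. F P (\<nu> x)) - M * (\<Prod>p\<in>P. kap p)\<bar> \<le> E * (\<Prod>p\<in>P. lam p)"
proof -
  have "\<not> p dvd 1" if "p \<in> P" for p using P(2)[OF that] by auto
  then show ?thesis using sieve_aux[OF P, of 1] by simp
qed

end

section \<open>Counting multiples among the weighted values\<close>

lemma card_residue_class:
  assumes "m > 0" "c < (m::nat)"
  shows "\<bar>real (card {i. i < H \<and> i mod m = c}) - real H / real m\<bar> \<le> 1"
proof -
  define k where "k = H div m"
  have H1: "k * m \<le> H" "H < (k + 1) * m" using assms(1) dividend_less_times_div[of m H] by (auto simp: k_def algebra_simps)
  have inj: "inj_on (\<lambda>t. c + t * m) A" for A using assms(1) by (auto intro: inj_onI)
  have "(\<lambda>t. c + t * m) ` {..<k} \<subseteq> {i. i < H \<and> i mod m = c}"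
  proof
    fix x assume "x \<in> (\<lambda>t. c + t * m) ` {..<k}"
    then obtain t where t: "t < k" "x = c + t * m" by auto
    have "x < m + t * m" using t assms by simp
    also have "\<dots> = Suc t * m" by simp
    also have "\<dots> \<le> k * m" using t by (intro mult_right_mono) auto
    finally show "x \<in> {i. i < H \<and> i mod m = c}" using H1 t assms by simp
  qed
  then have "card ((\<lambda>t. c + t * m) ` {..<k}) \<le> card {i. i < H \<and> i mod m = c}"
    by (intro card_mono) auto
  then have lo: "k \<le> card {i. i < H \<and> i mod m = c}" by (simp add: card_image inj)
  have "{i. i < H \<and> i mod m = c} \<subseteq> (\<lambda>t. c + t * m) ` {..k}"
  proof
    fix x assume x: "x \<in> {i. i < H \<and> i mod m = c}"
    then have e: "x = c + (x div m) * m" using div_mult_mod_eq[of x m] by auto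
    have "(x div m) \<le> k" using x unfolding k_def by (intro div_le_mono) auto
    then show "x \<in> (\<lambda>t. c + t * m) ` {..k}" using e by blast
  qed
  then have "card {i. i < H \<and> i mod m = c} \<le> card ((\<lambda>t. c + t * m) ` {..k})" by (intro card_mono) auto
  then have hi: "card {i. i < H \<and> i mod m = c} \<le> k + 1" by (simp add: card_image inj)
  have "real (k * m) \<le> real H" "real H < real ((k + 1) * m)" using H1 by (simp_all only: of_nat_le_iff of_nat_less_iff)
  then have "real k \<le> real H / real m" "real H / real m < real k + 1"
    using assms(1) by (simp_all add: field_simps)
  then show ?thesis using lo hi by linarith
qed

lemma card_progression:
  assumes "odd (m::nat)"
  shows "\<bar>real (card {i. i < H \<and> int m dvd 8 * int i + r}) - real H / real m\<bar> \<le> 1"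
proof -
  have mp: "m > 0" using assms by (rule odd_pos)
  have "coprime (2 ^ 3) (int m)" unfolding coprime_power_left_iff using assms by simp
  moreover have "(2::int) ^ 3 = 8" by simp
  ultimately have co: "coprime 8 (int m)" by metis
  then obtain s where s: "[8 * s = 1] (mod int m)" using cong_solve_coprime_int by blast
  define c where "c = nat ((- s * r) mod int m)"
  have c: "c < m" "int c = (- s * r) mod int m" using mp by (simp_all add: c_def nat_less_iff)
  have "int m dvd 8 * int i + r \<longleftrightarrow> i mod m = c" for i
  proof -
    have c8: "[8 * int c = - r] (mod int m)"
    proof -
      have "[int c = - s * r] (mod int m)" unfolding c(2) by simp
      then have "[8 * int c = 8 * (- s * r)] (mod int m)" by (rule cong_scalar_left)
      also have "8 * (- s * r) = (8 * s) * (- r)" by simp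
      also have "[(8 * s) * (- r) = 1 * (- r)] (mod int m)" using s by (rule cong_scalar_right)
      finally show ?thesis by simp
    qed
    have "int m dvd 8 * int i + r \<longleftrightarrow> [8 * int i = - r] (mod int m)" by (simp add: cong_iff_dvd_diff)
    also have "\<dots> \<longleftrightarrow> [8 * int i = 8 * int c] (mod int m)" using c8 cong_sym cong_trans by blast
    also have "\<dots> \<longleftrightarrow> [int i = int c] (mod int m)" using co by (simp add: cong_mult_lcancel)
    also have "\<dots> \<longleftrightarrow> [i = c] (mod m)" by (rule cong_int_iff)
    also have "\<dots> \<longleftrightarrow> i mod m = c mod m" by (simp add: cong_def)
    finally show ?thesis using c(1) by simp
  qed
  then show ?thesis using card_residue_class[OF mp c(1), of H] by simp
qed

text \<open>The values are 1 modulo 8, which makes all signs in quadratic reciprocity trivial.\<close>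
definition tent :: "nat \<Rightarrow> nat \<times> nat \<Rightarrow> nat" where
  "tent H = (\<lambda>(i, j). 8 * (H + i - j) + 1)"

lemma tent_le: "x \<in> {..<H} \<times> {..<H} \<Longrightarrow> tent H x \<le> 17 * H"
  by (auto simp: tent_def)

lemma tent_count:
  assumes "odd m"
  shows "\<bar>real (card {x \<in> {..<H} \<times> {..<H}. m dvd tent H x}) - (real H)\<^sup>2 / real m\<bar> \<le> real H"
proof -
  have "{x \<in> {..<H} \<times> {..<H}. m dvd tent H x} = (\<Union>j<H. (\<lambda>i. (i, j)) ` {i. i < H \<and> int m dvd 8 * int i + (8 * (int H - int j) + 1)})"
  proof -
    have "m dvd 8 * (H + i - j) + 1 \<longleftrightarrow> int m dvd 8 * int i + (8 * (int H - int j) + 1)" if "j < H" for i j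
    proof -
      have "int (8 * (H + i - j) + 1) = 8 * int i + (8 * (int H - int j) + 1)" using that by (simp add: of_nat_diff)
      then show ?thesis by (metis int_dvd_int_iff)
    qed
    then show ?thesis by (auto simp: tent_def)
  qed
  also have "card \<dots> = (\<Sum>j<H. card ((\<lambda>i. (i, j)) ` {i. i < H \<and> int m dvd 8 * int i + (8 * (int H - int j) + 1)}))"
    by (intro card_UN_disjoint) auto
  also have "\<dots> = (\<Sum>j<H. card {i. i < H \<and> int m dvd 8 * int i + (8 * (int H - int j) + 1)})"
    by (intro sum.cong refl card_image) (auto intro: inj_onI)
  finally have "real (card {x \<in> {..<H} \<times> {..<H}. m dvd tent H x}) - (real H)\<^sup>2 / real m =
      (\<Sum>j<H. real (card {i. i < H \<and> int m dvd 8 * int i + (8 * (int H - int j) + 1)}) - real H / real m)"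
    by (simp add: sum_subtractf power2_eq_square)
  also have "\<bar>\<dots>\<bar> \<le> (\<Sum>j<H. 1)"
    by (rule order_trans[OF sum_abs]) (intro sum_mono card_progression[OF assms])
  finally show ?thesis by simp
qed

text \<open>The bound equals \<open>17 * H * (H / m) powr \<alpha>\<close>. For
  \<open>m \<le> 17 * H\<close> this exceeds the counting error \<open>H\<close>; for larger
  \<open>m\<close> there are no multiples, and it exceeds the main term.\<close>

lemma tent_count_powr:
  assumes m: "odd m" and H: "H > 0" and \<alpha>: "0 < \<alpha>" "\<alpha> \<le> 1"
  shows "\<bar>real (card {x \<in> {..<H} \<times> {..<H}. m dvd tent H x}) - (real H)\<^sup>2 / real m\<bar>
     \<le> 17 * real H powr (1 + \<alpha>) * real m powr (- \<alpha>)"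
proof -
  have mp: "m > 0" using m by (rule odd_pos)
  have e: "17 * real H powr (1 + \<alpha>) * real m powr (- \<alpha>) = 17 * real H * (real H / real m) powr \<alpha>"
    using H mp by (simp add: powr_add powr_divide powr_minus field_simps)
  show ?thesis
  proof (cases "m \<le> 17 * H")
    case True
    then have "real m \<le> 17 * real H" by (metis of_nat_le_iff of_nat_mult of_nat_numeral)
    then have "1 / 17 \<le> real H / real m" using mp by (simp add: field_simps)
    then have "(1 / 17) powr \<alpha> \<le> (real H / real m) powr \<alpha>" using \<alpha> by (intro powr_mono2) auto
    moreover have "(1 / 17) powr 1 \<le> (1 / 17 :: real) powr \<alpha>" using \<alpha> by (intro powr_mono') auto
    ultimately have "1 / 17 \<le> (real H / real m) powr \<alpha>" by simp
    then have "17 * real H * (1 / 17) \<le> 17 * real H * (real H / real m) powr \<alpha>" by (intro mult_left_mono) auto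
    then show ?thesis using tent_count[OF m, of H] unfolding e by simp
  next
    case False
    have "\<not> m dvd tent H x" if "x \<in> {..<H} \<times> {..<H}" for x
    proof
      assume "m dvd tent H x"
      moreover have "tent H x > 0" by (cases x) (simp add: tent_def)
      ultimately have "m \<le> tent H x" by (simp add: dvd_imp_le)
      then show False using tent_le[OF that] False by simp
    qed
    then have z: "{x \<in> {..<H} \<times> {..<H}. m dvd tent H x} = {}" by blast
    have "real H / real m \<le> 1" using False mp by simp
    then have "(real H / real m) powr 1 \<le> (real H / real m) powr \<alpha>" using \<alpha> by (intro powr_mono') auto
    then have "real H * (real H / real m) \<le> real H * (real H / real m) powr \<alpha>" using H by (intro mult_left_mono) auto
    also have "\<dots> \<le> 17 * real H * (real H / real m) powr \<alpha>" by simp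
    finally show ?thesis unfolding z e by (simp add: power2_eq_square)
  qed
qed

section \<open>Lower and upper bounds for the character sum\<close>

definition bad_prime :: "int \<Rightarrow> nat \<Rightarrow> bool" where
  "bad_prime d p \<longleftrightarrow> prime p \<and> odd p \<and> jacobi d p \<noteq> 1"

lemma bad_prime_value: "bad_prime d p \<Longrightarrow> jacobi d p = 0 \<or> jacobi d p = - 1"
  using jacobi_cases[of p d] by (auto simp: bad_prime_def)

lemma jacobi_prod: 
  assumes "n > 0" shows "jacobi d n = (\<Prod>p\<in>prime_factors n. jacobi d p ^ multiplicity p n)"
proof -
  have "jacobi d n = (\<Prod>p\<in>prime_factors n. Legendre d (int p) ^ count (prime_factorization n) p)"
    unfolding jacobi_def by (simp add: image_prod_mset_multiplicity)
  also have "\<dots> = (\<Prod>p\<in>prime_factors n. jacobi d p ^ multiplicity p n)"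
    by (intro prod.cong refl) (simp add: in_prime_factors_imp_prime jacobi_prime count_prime_factorization_prime)
  finally show ?thesis .
qed

definition chi :: "int \<Rightarrow> nat \<Rightarrow> real" where
  "chi d p = (if bad_prime d p then of_int (jacobi d p) else 0)"

lemma chi_cases: "chi d p = 0 \<or> chi d p = - 1"
  using bad_prime_value[of d p] by (auto simp: chi_def)

text \<open>The character with its values at bad primes from \<open>z\<close> on replaced by 1; at
  odd primes that are not bad it is 1 anyway.\<close>

definition smooth_char :: "int \<Rightarrow> nat \<Rightarrow> nat \<Rightarrow> real" where
  "smooth_char d z n = (\<Prod>p\<in>{p. bad_prime d p \<and> p < z}. chi d p ^ multiplicity p n)"

lemma smooth_char_eq:
  assumes n: "odd n" and no: "\<And>p. bad_prime d p \<Longrightarrow> p dvd n \<Longrightarrow> p < z"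
  shows "of_int (jacobi d n) = smooth_char d z n"
proof -
  have np: "n > 0" using n by (rule odd_pos)
  let ?P = "{p. bad_prime d p \<and> p < z}"
  have fP: "finite ?P" by (rule finite_subset[of _ "{..<z}"]) auto
  have "of_int (jacobi d n) = (\<Prod>p\<in>prime_factors n. (of_int (jacobi d p) :: real) ^ multiplicity p n)"
    unfolding jacobi_prod[OF np] by simp
  also have "\<dots> = (\<Prod>p\<in>prime_factors n \<inter> ?P. chi d p ^ multiplicity p n)"
  proof (rule prod.mono_neutral_cong_right)
    show "\<forall>p\<in>prime_factors n - prime_factors n \<inter> ?P. (of_int (jacobi d p) :: real) ^ multiplicity p n = 1"
    proof
      fix p assume p: "p \<in> prime_factors n - prime_factors n \<inter> ?P"
      then have pp: "prime p" "p dvd n" by auto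
      then have "odd p" using n by (meson dvd_trans)
      then have "jacobi d p = 1" using p pp no[of p] by (auto simp: bad_prime_def)
      then show "(of_int (jacobi d p) :: real) ^ multiplicity p n = 1" by simp
    qed
    show "(of_int (jacobi d p) :: real) ^ multiplicity p n = chi d p ^ multiplicity p n"
      if "p \<in> prime_factors n \<inter> ?P" for p using that by (simp add: chi_def)
  qed auto
  also have "\<dots> = smooth_char d z n"
    unfolding smooth_char_def
  proof (rule prod.mono_neutral_left[OF fP])
    show "\<forall>p\<in>?P - prime_factors n \<inter> ?P. chi d p ^ multiplicity p n = 1"
    proof
      fix p assume p: "p \<in> ?P - prime_factors n \<inter> ?P"
      then have "prime p" "\<not> p dvd n" using np by (auto simp: bad_prime_def prime_factors_dvd)
      then have "multiplicity p n = 0" by (simp add: not_dvd_imp_multiplicity_0)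
      then show "chi d p ^ multiplicity p n = 1" by simp
    qed
  qed auto
  finally show ?thesis .
qed

lemma smooth_char_bound: "\<bar>smooth_char d z n\<bar> \<le> 1"
proof -
  have "\<bar>chi d p ^ multiplicity p n\<bar> \<le> 1" for p
    using chi_cases[of d p] by (auto simp: power_abs power_0_left)
  then show ?thesis unfolding smooth_char_def abs_prod by (intro prod_le_1) auto
qed

text \<open>Both values have modulus at most 1 and agree unless a bad prime from \<open>z\<close> on
  divides \<open>n\<close>; one such prime already contributes 2.\<close>

lemma smooth_char_diff:
  assumes n: "odd n" and Y: "n \<le> Y"
  shows "\<bar>of_int (jacobi d n) - smooth_char d z n\<bar> \<le> (\<Sum>p\<in>{p. bad_prime d p \<and> z \<le> p \<and> p \<le> Y}. if p dvd n then 2 else 0)"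
proof (cases "\<exists>p. bad_prime d p \<and> p dvd n \<and> z \<le> p")
  case True
  then obtain p where p: "bad_prime d p" "p dvd n" "z \<le> p" by blast
  let ?B = "{p. bad_prime d p \<and> z \<le> p \<and> p \<le> Y}"
  have "p \<le> Y" using p(2) n Y by (meson dvd_imp_le odd_pos order_trans)
  then have "p \<in> ?B" using p by simp
  moreover have "finite ?B" by (rule finite_subset[of _ "{..Y}"]) auto
  ultimately have "(if p dvd n then 2 else 0 :: real) \<le> (\<Sum>p\<in>?B. if p dvd n then 2 else 0)"
    by (intro member_le_sum) auto
  moreover have "\<bar>of_int (jacobi d n) :: real\<bar> \<le> 1" using jacobi_cases[OF n, of d] by auto
  ultimately show ?thesis using smooth_char_bound[of d z n] p by simp
next
  case False
  then have "of_int (jacobi d n) = smooth_char d z n" by (intro smooth_char_eq[OF n]) (auto simp: not_le)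
  then show ?thesis by (simp add: sum_nonneg)
qed

text \<open>The sieve handles the bad primes below \<open>z\<close>; returning to the true character
  costs 2 for each larger bad prime dividing a value. The worst case
  \<open>\<epsilon> p = - 1\<close> is used in the main product.\<close>

theorem character_sum_lower:
  fixes d :: int and H z :: nat and \<alpha> :: real
  assumes H: "H > 0" and \<alpha>: "0 < \<alpha>" "\<alpha> \<le> 1"
  defines "P \<equiv> {p. bad_prime d p \<and> p < z}"
  shows "(\<Sum>x\<in>{..<H} \<times> {..<H}. of_int (jacobi d (tent H x))) \<ge>
     (real H)\<^sup>2 * (\<Prod>p\<in>P. (1 - 1 / real p) / (1 + 1 / real p))
     - 17 * real H powr (1 + \<alpha>) * (\<Prod>p\<in>P. (1 + real p powr (- \<alpha>)) / (1 - real p powr (- \<alpha>)))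
     - 36 * (real H)\<^sup>2 * (\<Sum>p\<in>{p. bad_prime d p \<and> z \<le> p \<and> p \<le> 17 * H}. 1 / real p)"
proof -
  let ?I = "{..<H} \<times> {..<H}"
  let ?B = "{p. bad_prime d p \<and> z \<le> p \<and> p \<le> 17 * H}"
  interpret weighted_sieve ?I "tent H" "(real H)\<^sup>2" "17 * real H powr (1 + \<alpha>)" \<alpha> "chi d"
    using \<alpha> H chi_cases tent_count_powr by unfold_locales (auto simp: tent_def)
  have fP: "finite P" unfolding P_def by (rule finite_subset[of _ "{..<z}"]) auto
  have PP: "prime p \<and> odd p" if "p \<in> P" for p using that by (simp add: P_def bad_prime_def)
  have sc: "smooth_char d z n = F P n" for n by (simp add: smooth_char_def F_def P_def)
  have "(\<Sum>x\<in>?I. F P (tent H x)) \<ge> (real H)\<^sup>2 * (\<Prod>p\<in>P. kap p) - 17 * real H powr (1 + \<alpha>) * (\<Prod>p\<in>P. lam p)"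
    using sieve[OF fP PP] by linarith
  moreover have "(\<Prod>p\<in>P. kap p) \<ge> (\<Prod>p\<in>P. (1 - 1 / real p) / (1 + 1 / real p))"
  proof (rule prod_mono)
    fix p assume "p \<in> P"
    then have p: "p > 1" using PP prime_gt_1_nat by blast
    then have "0 < 1 - chi d p / real p" "1 - chi d p / real p \<le> 1 + 1 / real p"
      using chi_cases[of d p] by (auto intro: add_pos_pos)
    then show "0 \<le> (1 - 1 / real p) / (1 + 1 / real p) \<and> (1 - 1 / real p) / (1 + 1 / real p) \<le> kap p"
      unfolding kap_def using p by (intro conjI divide_nonneg_pos divide_left_mono mult_pos_pos) (auto intro: add_pos_pos)
  qed
  then have "(real H)\<^sup>2 * (\<Prod>p\<in>P. kap p) \<ge> (real H)\<^sup>2 * (\<Prod>p\<in>P. (1 - 1 / real p) / (1 + 1 / real p))"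
    by (intro mult_left_mono) auto
  moreover have "\<bar>(\<Sum>x\<in>?I. of_int (jacobi d (tent H x))) - (\<Sum>x\<in>?I. F P (tent H x))\<bar> \<le> 36 * (real H)\<^sup>2 * (\<Sum>p\<in>?B. 1 / real p)"
  proof -
    have "\<bar>(\<Sum>x\<in>?I. of_int (jacobi d (tent H x))) - (\<Sum>x\<in>?I. F P (tent H x))\<bar> \<le>
        (\<Sum>x\<in>?I. \<Sum>p\<in>?B. if p dvd tent H x then 2 else 0)"
      unfolding sum_subtractf[symmetric] sc[symmetric]
      by (rule order_trans[OF sum_abs], intro sum_mono smooth_char_diff tent_le) (auto simp: tent_def)
    also have "\<dots> = (\<Sum>p\<in>?B. \<Sum>x\<in>?I. if p dvd tent H x then 2 else 0)" by (rule sum.swap)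
    also have "\<dots> = (\<Sum>p\<in>?B. 2 * real (card {x \<in> ?I. p dvd tent H x}))"
      by (intro sum.cong refl) (simp add: sum.If_cases Int_def)
    also have "\<dots> \<le> (\<Sum>p\<in>?B. 36 * (real H)\<^sup>2 * (1 / real p))"
    proof (rule sum_mono)
      fix p assume p: "p \<in> ?B"
      then have po: "odd p" "real p > 0" by (auto simp: bad_prime_def prime_gt_0_nat)
      have "real p \<le> 17 * real H" using p by (metis (mono_tags, lifting) mem_Collect_eq of_nat_le_iff of_nat_mult of_nat_numeral)
      then have "real H * real p \<le> real H * (17 * real H)" by (intro mult_left_mono) auto
      \<comment> \<open>The counting error \<open>H\<close> is at most 17 times the main term
        \<open>H\<^sup>2 / p\<close>; hence 18, doubled to 36.\<close>
      then have "real H \<le> 17 * (real H)\<^sup>2 / real p" using po by (simp add: field_simps power2_eq_square)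
      then have "real (card {x \<in> ?I. p dvd tent H x}) \<le> 18 * (real H)\<^sup>2 / real p"
        using tent_count[OF po(1), of H] by (simp add: field_simps)
      then show "2 * real (card {x \<in> ?I. p dvd tent H x}) \<le> 36 * (real H)\<^sup>2 * (1 / real p)" by simp
    qed
    finally show ?thesis by (simp add: sum_distrib_left)
  qed
  ultimately show ?thesis unfolding lam_def by linarith
qed

theorem character_sum_upper:
  assumes d: "d = - (2 ^ e * int d')" "odd d'" "squarefree d'" and H: "H \<le> d'"
  shows "\<bar>\<Sum>x\<in>{..<H} \<times> {..<H}. jacobi d (tent H x)\<bar> \<le> real H * sqrt (real d')"
proof -
  interpret gauss_sum d' using d by unfold_locales
  have c: "coprime 8 (int d')"
  proof -
    have "coprime (2 ^ 3) (int d')" unfolding coprime_power_left_iff using d by simp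
    moreover have "(2::int) ^ 3 = 8" by simp
    ultimately show ?thesis by metis
  qed
  have "jacobi d (tent H (i, j)) = jacobi (8 * (int i - int j) + (8 * int H + 1)) d'" if "j < H" for i j
  proof -
    have "jacobi d (tent H (i, j)) = jacobi (int (tent H (i, j))) d'"
      by (rule jacobi_one_mod_8[OF _ d(1,2)]) (simp add: tent_def)
    moreover have "int (tent H (i, j)) = 8 * (int i - int j) + (8 * int H + 1)"
      using that by (simp add: tent_def of_nat_diff)
    ultimately show ?thesis by simp
  qed
  then have "(\<Sum>x\<in>{..<H} \<times> {..<H}. jacobi d (tent H x)) = (\<Sum>i<H. \<Sum>j<H. jacobi (8 * (int i - int j) + (8 * int H + 1)) d')"
  proof -
    assume *: "\<And>j i. j < H \<Longrightarrow> jacobi d (tent H (i, j)) = jacobi (8 * (int i - int j) + (8 * int H + 1)) d'"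
    have "(\<Sum>x\<in>{..<H} \<times> {..<H}. jacobi d (tent H x)) = (\<Sum>i<H. \<Sum>j<H. jacobi d (tent H (i, j)))"
      by (simp add: sum.cartesian_product split_def)
    also have "\<dots> = (\<Sum>i<H. \<Sum>j<H. jacobi (8 * (int i - int j) + (8 * int H + 1)) d')"
      by (intro sum.cong refl *) auto
    finally show ?thesis .
  qed
  then show ?thesis using double_sum_bound[OF c H, of "8 * int H + 1"] by simp
qed

section \<open>Chebyshev bounds in dyadic blocks\<close>

lemma prod_primes_dvd:
  assumes "finite A" "\<And>p. p \<in> A \<Longrightarrow> prime p \<and> p dvd (n::nat)"
  shows "\<Prod>A dvd n"
  using assms
proof (induction rule: finite_induct)
  case (insert p A)
  have "coprime p (\<Prod>A)"
    using insert by (intro prod_coprime_right) (metis insertI1 insertI2 primes_coprime)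
  then show ?case using insert by (simp add: divides_mult)
qed simp

text \<open>Chebyshev: with \<open>n = 2 ^ j\<close>, the primes between \<open>n\<close> and
  \<open>2 * n\<close> divide the central binomial coefficient, which is at most
  \<open>4 ^ n\<close>. For \<open>j = 1\<close> the endpoint \<open>n\<close> is itself prime,
  hence the separate case.\<close>

lemma primes_dyadic:
  assumes "j > 0"
  shows "j * card {p. prime p \<and> 2 ^ j \<le> p \<and> p < (2::nat) ^ Suc j} \<le> 2 ^ Suc j"
proof (cases "j = 1")
  case True
  have "{p. prime p \<and> 2 ^ j \<le> p \<and> p < (2::nat) ^ Suc j} \<subseteq> {2, 3}" using True by auto
  then have "card {p. prime p \<and> 2 ^ j \<le> p \<and> p < (2::nat) ^ Suc j} \<le> card {2, 3 :: nat}" by (intro card_mono) auto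
  then show ?thesis using True by simp
next
  case False
  then have j: "j > 1" using assms by simp
  define n where "n = (2::nat) ^ j"
  define A where "A = {p. prime p \<and> 2 ^ j \<le> p \<and> p < (2::nat) ^ Suc j}"
  have fA: "finite A" unfolding A_def by (rule finite_subset[of _ "{..<2 ^ Suc j}"]) auto
  have "prime p \<and> p dvd (2 * n choose n)" if p: "p \<in> A" for p
  proof
    show pp: "prime p" using p by (simp add: A_def)
    have "p \<noteq> n"
    proof
      assume "p = n"
      then have "prime ((2::nat) ^ j)" using pp by (simp add: n_def)
      then show False using j prime_power_iff by (metis less_irrefl)
    qed
    then have lt: "n < p" "p \<le> 2 * n" using p by (auto simp: A_def n_def)
    have "fact n * fact (2 * n - n) * (2 * n choose n) = fact (2 * n)" by (rule binomial_fact_lemma) simp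
    then have "p dvd fact n * fact n * (2 * n choose n)" using pp lt(2) prime_dvd_fact_iff[of p "2 * n"] by (simp add: mult_2)
    moreover have "\<not> p dvd fact n" using pp lt(1) prime_dvd_fact_iff[of p n] by simp
    ultimately show "p dvd (2 * n choose n)" using pp prime_dvd_mult_iff by blast
  qed
  then have "\<Prod>A dvd (2 * n choose n)" by (intro prod_primes_dvd[OF fA]) auto
  then have "\<Prod>A \<le> (2 * n choose n)" by (rule dvd_imp_le) simp
  also have "\<dots> \<le> 2 ^ (2 * n)" by (rule binomial_le_pow2)
  finally have "\<Prod>A \<le> 2 ^ (2 * n)" .
  moreover have "n ^ card A \<le> \<Prod>A"
    unfolding prod_constant[symmetric] by (intro prod_mono) (auto simp: A_def n_def)
  ultimately have "(2::nat) ^ (j * card A) \<le> 2 ^ (2 * n)" unfolding n_def power_mult[symmetric] by linarith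
  then have "j * card A \<le> 2 * n" by (rule power_le_imp_le_exp[rotated]) simp
  then show ?thesis unfolding A_def n_def by simp
qed

lemma primes_dyadic_real:
  assumes "j > 0" "A \<subseteq> {p. prime p \<and> 2 ^ j \<le> p \<and> p < (2::nat) ^ Suc j}"
  shows "real (card A) / 2 ^ j \<le> 2 / real j"
proof -
  let ?Q = "{p. prime p \<and> 2 ^ j \<le> p \<and> p < (2::nat) ^ Suc j}"
  have "finite ?Q" by (rule finite_subset[of _ "{..<2 ^ Suc j}"]) auto
  then have "card A \<le> card ?Q" using assms(2) by (rule card_mono)
  then have "j * card A \<le> 2 ^ Suc j" using primes_dyadic[OF assms(1)] by (meson mult_le_mono2 order_trans)
  then have "real (j * card A) \<le> real (2 ^ Suc j)" by (simp only: of_nat_le_iff)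
  then show ?thesis using assms(1) by (simp add: field_simps)
qed

lemma dyadic_sum:
  assumes "a \<le> b"
  shows "(\<Sum>p\<in>{p. Q p \<and> 2 ^ a \<le> p \<and> p < 2 ^ b}. 1 / real p) \<le> (\<Sum>j\<in>{a..<b}. real (card {p. Q p \<and> 2 ^ j \<le> p \<and> p < 2 ^ Suc j}) / 2 ^ j)"
  using assms
proof (induction b rule: dec_induct)
  case base
  have "{p. Q p \<and> 2 ^ a \<le> p \<and> p < (2::nat) ^ a} = {}" by auto
  then show ?case by (simp only: sum.empty atLeastLessThan_empty order_refl)
next
  case (step b)
  let ?A = "{p. Q p \<and> 2 ^ a \<le> p \<and> p < 2 ^ b}" and ?B = "{p. Q p \<and> 2 ^ b \<le> p \<and> p < 2 ^ Suc b}"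
  have "(2::nat) ^ a \<le> 2 ^ b" "(2::nat) ^ b \<le> 2 ^ Suc b" using step by auto
  moreover have "{p. Q p \<and> x \<le> p \<and> p < z} = {p. Q p \<and> x \<le> p \<and> p < y} \<union> {p. Q p \<and> y \<le> p \<and> p < z}"
    if "x \<le> y" "y \<le> z" for x y z :: nat using that by auto
  ultimately have e: "{p. Q p \<and> 2 ^ a \<le> p \<and> p < 2 ^ Suc b} = ?A \<union> ?B" by blast
  have "finite {p. Q p \<and> x \<le> p \<and> p < y}" for x y :: nat
    by (rule finite_subset[of _ "{..<y}"]) auto
  then have f: "finite ?A" "finite ?B" by blast+
  have "(\<Sum>p\<in>?B. 1 / real p) \<le> (\<Sum>p\<in>?B. 1 / 2 ^ b)"
  proof (rule sum_mono)
    fix p assume "p \<in> ?B"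
    then have "real (2 ^ b) \<le> real p" by (simp only: of_nat_le_iff mem_Collect_eq)
    then show "1 / real p \<le> 1 / 2 ^ b" by (intro divide_left_mono) (auto intro!: mult_pos_pos simp: order_less_le_trans[of 0 "2 ^ b"])
  qed
  also have "\<dots> = real (card ?B) / 2 ^ b" by simp
  finally have "(\<Sum>p\<in>?B. 1 / real p) \<le> real (card ?B) / 2 ^ b" .
  moreover have "(\<Sum>p\<in>?A \<union> ?B. 1 / real p) = (\<Sum>p\<in>?A. 1 / real p) + (\<Sum>p\<in>?B. 1 / real p)"
    using f by (intro sum.union_disjoint) auto
  ultimately show ?case unfolding e using step by (simp add: sum.atLeastLessThan_Suc del: power_Suc)
qed

section \<open>Counting inert products\<close>

lemma one_plus_over_one_minus_le_exp:
  fixes x :: real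
  assumes "0 \<le> x" "x < 1"
  shows "(1 + x) / (1 - x) \<le> exp (2 * x / (1 - x))"
proof -
  have "(1 + x) / (1 - x) = 1 + 2 * x / (1 - x)" using assms by (simp add: field_simps)
  also have "\<dots> \<le> exp (2 * x / (1 - x))" by (rule exp_ge_add_one_self)
  finally show ?thesis .
qed

lemma harmonic_sum_le:
  assumes "J > 0"
  shows "(\<Sum>j\<in>{1..<J}. 1 / real j) \<le> 1 + ln (real J)"
proof -
  have "(\<Sum>j\<in>{1..<Suc n}. 1 / real j) \<le> 1 + ln (real n)" if "n > 0" for n
    using that
  proof (induction n)
    case (Suc n)
    show ?case
    proof (cases "n = 0")
      case False
      then have "ln (real n / real (Suc n)) \<le> real n / real (Suc n) - 1" by (intro ln_le_minus_one) auto
      then have "1 / real (Suc n) \<le> ln (real (Suc n)) - ln (real n)"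
        using False by (simp add: ln_div field_simps)
      then show ?thesis using Suc False by simp
    qed (use Suc in simp)
  qed simp
  note * = this
  show ?thesis
  proof (cases "J = 1")
    case False
    then obtain n where n: "J = Suc n" "n > 0" using assms by (cases J) auto
    have "ln (real n) \<le> ln (real J)" using n by simp
    then show ?thesis using *[OF n(2)] n(1) by simp
  qed simp
qed

lemma bad_reciprocal_sum:
  assumes "J > 0"
  shows "(\<Sum>p\<in>{p. bad_prime d p \<and> p < 2 ^ J}. 1 / real p) \<le> 2 * (1 + ln (real J))"
proof -
  have "2 \<le> p" if "bad_prime d p" for p using that by (auto simp: bad_prime_def prime_ge_2_nat)
  then have "{p. bad_prime d p \<and> p < 2 ^ J} = {p. bad_prime d p \<and> 2 ^ 1 \<le> p \<and> p < 2 ^ J}" by auto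
  then have "(\<Sum>p\<in>{p. bad_prime d p \<and> p < 2 ^ J}. 1 / real p) \<le>
     (\<Sum>j\<in>{1..<J}. real (card {p. bad_prime d p \<and> 2 ^ j \<le> p \<and> p < 2 ^ Suc j}) / 2 ^ j)"
    using dyadic_sum[of 1 J "bad_prime d"] assms by simp
  also have "\<dots> \<le> (\<Sum>j\<in>{1..<J}. 2 * (1 / real j))"
  proof (rule sum_mono)
    fix j assume "j \<in> {1..<J}"
    then have "j > 0" by simp
    then have "real (card {p. bad_prime d p \<and> 2 ^ j \<le> p \<and> p < 2 ^ Suc j}) / 2 ^ j \<le> 2 / real j"
      by (rule primes_dyadic_real) (auto simp: bad_prime_def)
    then show "real (card {p. bad_prime d p \<and> 2 ^ j \<le> p \<and> p < 2 ^ Suc j}) / 2 ^ j \<le> 2 * (1 / real j)" by simp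
  qed
  also have "\<dots> = 2 * (\<Sum>j\<in>{1..<J}. 1 / real j)" by (rule sum_distrib_left[symmetric])
  also have "\<dots> \<le> 2 * (1 + ln (real J))" using harmonic_sum_le[OF assms] by simp
  finally show ?thesis .
qed

text \<open>For odd primes \<open>x = 1/p \<le> 1/3\<close>, so
  \<open>(1 + x) / (1 - x) \<le> exp (3 * x)\<close>; the 6 is 3 times the 2 of
  \<open>bad_reciprocal_sum\<close>. The bound is a fixed power of \<open>1 / J\<close> up to a
  constant.\<close>

lemma kappa_prod_ge:
  assumes "J > 0"
  shows "exp (- 6 * (1 + ln (real J))) \<le> (\<Prod>p\<in>{p. bad_prime d p \<and> p < 2 ^ J}. (1 - 1 / real p) / (1 + 1 / real p))"
proof -
  let ?P = "{p. bad_prime d p \<and> p < 2 ^ J}"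
  have fP: "finite ?P" by (rule finite_subset[of _ "{..<2 ^ J}"]) auto
  have "exp (- 6 * (1 + ln (real J))) \<le> exp (- 3 * (\<Sum>p\<in>?P. 1 / real p))"
    using bad_reciprocal_sum[OF assms, of d] by simp
  also have "\<dots> = (\<Prod>p\<in>?P. exp (- 3 * (1 / real p)))"
    unfolding sum_distrib_left using fP by (rule exp_sum)
  also have "\<dots> \<le> (\<Prod>p\<in>?P. (1 - 1 / real p) / (1 + 1 / real p))"
  proof (rule prod_mono)
    fix p assume "p \<in> ?P"
    then have "p > 2" using odd_prime_gt_2 by (auto simp: bad_prime_def)
    define x where "x = 1 / real p"
    have x: "0 < x" "x \<le> 1 / 3" using \<open>p > 2\<close> by (auto simp: x_def field_simps)
    have "2 * x / (1 - x) \<le> 3 * x" using x by (simp add: field_simps)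
    then have "(1 + x) / (1 - x) \<le> exp (3 * x)"
      using one_plus_over_one_minus_le_exp[of x] x by (meson exp_le_cancel_iff less_eq_real_def order_trans le_less_trans one_less_numeral_iff divide_less_eq_1_pos semiring_norm(77) zero_less_numeral)
    then have "inverse (exp (3 * x)) \<le> inverse ((1 + x) / (1 - x))" using x by (intro le_imp_inverse_le divide_pos_pos) auto
    then show "0 \<le> exp (- 3 * (1 / real p)) \<and> exp (- 3 * (1 / real p)) \<le> (1 - 1 / real p) / (1 + 1 / real p)"
      unfolding x_def[symmetric] by (simp add: exp_minus)
  qed
  finally show ?thesis .
qed

text \<open>Writing \<open>p powr (- \<alpha>) = p powr (1 - \<alpha>) / p\<close> and bounding the
  numerator by its value at \<open>2 ^ J\<close> reduces this to reciprocals of primes. For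
  \<open>p \<ge> 3\<close> one has \<open>x \<le> 3/5\<close>, which gives the 5, and 10 is 5 times
  2.\<close>

lemma lambda_prod_le:
  assumes J: "J > 0" and \<alpha>: "1 / 2 \<le> \<alpha>" "\<alpha> \<le> 1"
  shows "(\<Prod>p\<in>{p. bad_prime d p \<and> p < 2 ^ J}. (1 + real p powr (- \<alpha>)) / (1 - real p powr (- \<alpha>)))
    \<le> exp (10 * 2 powr (real J * (1 - \<alpha>)) * (1 + ln (real J)))"
proof -
  let ?P = "{p. bad_prime d p \<and> p < 2 ^ J}"
  define C where "C = 2 powr (real J * (1 - \<alpha>))"
  have fP: "finite ?P" by (rule finite_subset[of _ "{..<2 ^ J}"]) auto
  have "(\<Prod>p\<in>?P. (1 + real p powr (- \<alpha>)) / (1 - real p powr (- \<alpha>))) \<le> (\<Prod>p\<in>?P. exp (5 * C * (1 / real p)))"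
  proof (rule prod_mono)
    fix p assume p: "p \<in> ?P"
    then have p2: "p > 2" using odd_prime_gt_2 by (auto simp: bad_prime_def)
    define x where "x = real p powr (- \<alpha>)"
    have "x \<le> real p powr (- (1 / 2))" unfolding x_def using p2 \<alpha> by (intro powr_mono) auto
    also have "\<dots> = 1 / sqrt (real p)" by (simp only: powr_minus_divide powr_half_sqrt of_nat_0_le_iff)
    also have "\<dots> \<le> 3 / 5"
    proof -
      have "(5 / 3 :: real)\<^sup>2 \<le> real p" using p2 by (simp add: power2_eq_square)
      then have "5 / 3 \<le> sqrt (real p)" by (rule real_le_rsqrt)
      then have "1 / sqrt (real p) \<le> 1 / (5 / 3)" using p2 by (intro divide_left_mono) auto
      then show ?thesis by simp
    qed
    finally have x: "0 < x" "x \<le> 3 / 5" using p2 by (auto simp: x_def)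
    have "2 * x / (1 - x) \<le> 5 * x" using x by (simp add: field_simps)
    moreover have "x \<le> C * (1 / real p)"
    proof -
      have "x = real p powr (1 - \<alpha>) * (1 / real p)"
        unfolding x_def using p2 by (simp add: powr_diff powr_minus field_simps)
      moreover have "real p \<le> 2 powr real J" using p by (simp add: powr_realpow)
      then have "real p powr (1 - \<alpha>) \<le> (2 powr real J) powr (1 - \<alpha>)" using \<alpha> by (intro powr_mono2) auto
      then have "real p powr (1 - \<alpha>) \<le> C" by (simp add: C_def powr_powr)
      then have "real p powr (1 - \<alpha>) * (1 / real p) \<le> C * (1 / real p)" by (intro mult_right_mono) auto
      ultimately show ?thesis by simp
    qed
    ultimately have "2 * x / (1 - x) \<le> 5 * C * (1 / real p)" by linarith
    then have "exp (2 * x / (1 - x)) \<le> exp (5 * C * (1 / real p))" by simp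
    moreover have "(1 + x) / (1 - x) \<le> exp (2 * x / (1 - x))" using x by (intro one_plus_over_one_minus_le_exp) auto
    moreover have "0 \<le> (1 + x) / (1 - x)" using x by simp
    ultimately show "0 \<le> (1 + real p powr (- \<alpha>)) / (1 - real p powr (- \<alpha>)) \<and>
       (1 + real p powr (- \<alpha>)) / (1 - real p powr (- \<alpha>)) \<le> exp (5 * C * (1 / real p))"
      unfolding x_def[symmetric] by linarith
  qed
  also have "\<dots> = exp (5 * C * (\<Sum>p\<in>?P. 1 / real p))"
    unfolding sum_distrib_left using fP by (rule exp_sum[symmetric])
  also have "\<dots> \<le> exp (5 * C * (2 * (1 + ln (real J))))"
    using bad_reciprocal_sum[OF J, of d] by (simp add: C_def)
  also have "5 * C * (2 * (1 + ln (real J))) = 10 * C * (1 + ln (real J))" by simp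
  finally show ?thesis unfolding C_def .
qed

section \<open>Sparsity of inert primes when there are few walls\<close>

context imaginary_quadratic_order
begin

definition inert :: "nat \<Rightarrow> bool" where "inert p \<longleftrightarrow> prime p \<and> odd p \<and> jacobi D p = - 1"

definition ell :: real where "ell = log 2 (of_int (- D))"

lemma ell_powr: "2 powr ell = of_int (- D)"
  using D by (simp add: ell_def)

lemma prod_inert_adm:
  assumes A: "finite A" "\<And>p. p \<in> A \<Longrightarrow> inert p" and b: "4 * (int (\<Prod>A))\<^sup>2 < - D"
  shows "\<Prod>A \<in> adm"
proof -
  have "odd (\<Prod>A) \<and> squarefree (\<Prod>A)"
    using A
  proof (induction rule: finite_induct)
    case (insert p A)
    have "prime p" "odd p" using insert.prems by (auto simp: inert_def)
    moreover have "coprime p (\<Prod>A)"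
      using insert by (intro prod_coprime_right) (metis inert_def insertI1 insertI2 primes_coprime)
    ultimately show ?case using insert by (simp add: squarefree_mult_coprime squarefree_prime)
  qed simp
  moreover have "\<not> (\<exists>x. [x\<^sup>2 = D] (mod int p))" if p: "prime p" "p dvd \<Prod>A" for p
  proof -
    obtain p' where "p' \<in> A" "p dvd p'" using p prime_dvd_prod_iff[OF A(1) p(1), of "\<lambda>x. x"] by auto
    moreover have "prime p'" using A(2)[OF \<open>p' \<in> A\<close>] by (simp add: inert_def)
    ultimately have "p \<in> A" using p(1) primes_dvd_imp_eq by blast
    then have "inert p" using A by blast
    then have "prime p" "jacobi D p = - 1" by (auto simp: inert_def)
    then have "Legendre D (int p) = - 1" using jacobi_prime[of p D] by simp
    then show ?thesis unfolding Legendre_def QuadRes_def by (auto split: if_splits)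
  qed
  ultimately show ?thesis using b unfolding adm_def by blast
qed

text \<open>A set of primes is recovered from its product, so every set of \<open>u\<close> inert
  primes of the block gives its own element of \<open>adm\<close>.\<close>

lemma inert_choose_le:
  assumes fin: "finite adm" and b: "4 * ((2::int) ^ (Suc j * u))\<^sup>2 < - D"
  shows "card {p. inert p \<and> 2 ^ j \<le> p \<and> p < 2 ^ Suc j} choose u \<le> card adm"
proof -
  let ?K = "{p. inert p \<and> 2 ^ j \<le> p \<and> p < 2 ^ Suc j}"
  let ?S = "{A. A \<subseteq> ?K \<and> card A = u}"
  have fK: "finite ?K" by (rule finite_subset[of _ "{..<2 ^ Suc j}"]) auto
  have inj: "inj_on (\<lambda>A. \<Prod>A) ?S"
  proof (rule inj_onI)
    fix A B assume AB: "A \<in> ?S" "B \<in> ?S" "\<Prod>A = \<Prod>B"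
    have mem: "p \<in> X \<longleftrightarrow> prime p \<and> p dvd \<Prod>X" if "X \<in> ?S" for X p
    proof
      have fX: "finite X" using that fK finite_subset by blast
      have pX: "prime p" if "p \<in> X" for p using that \<open>X \<in> ?S\<close> by (auto simp: inert_def)
      show "p \<in> X \<Longrightarrow> prime p \<and> p dvd \<Prod>X" using pX dvd_prodI[OF fX, of p "\<lambda>x. x"] by blast
      assume "prime p \<and> p dvd \<Prod>X"
      then obtain p' where "p' \<in> X" "p dvd p'" "prime p" using prime_dvd_prod_iff[OF fX, of p "\<lambda>x. x"] by auto
      then show "p \<in> X" using pX primes_dvd_imp_eq by blast
    qed
    show "A = B"
    proof (rule Set.set_eqI)
      fix p
      show "p \<in> A \<longleftrightarrow> p \<in> B" using mem[OF AB(1), of p] mem[OF AB(2), of p] unfolding AB(3) by blast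
    qed
  qed
  have "(\<lambda>A. \<Prod>A) ` ?S \<subseteq> adm"
  proof
    fix n assume "n \<in> (\<lambda>A. \<Prod>A) ` ?S"
    then obtain A where A: "A \<subseteq> ?K" "card A = u" "n = \<Prod>A" by blast
    have "\<Prod>A \<le> (\<Prod>p\<in>A. 2 ^ Suc j)" using A(1) 
    proof (intro prod_mono conjI)
      fix p assume "p \<in> A"
      then have "p < 2 ^ Suc j" using A(1) by blast
      then show "p \<le> 2 ^ Suc j" by (rule less_imp_le)
    qed simp
    also have "\<dots> = 2 ^ (Suc j * u)" using A(2) by (simp only: prod_constant power_mult)
    finally have "int (\<Prod>A) \<le> 2 ^ (Suc j * u)" by (metis of_nat_le_iff of_nat_numeral of_nat_power)
    then have "(int (\<Prod>A))\<^sup>2 \<le> (2 ^ (Suc j * u))\<^sup>2" by (rule power_mono) (rule of_nat_0_le_iff)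
    then have "4 * (int (\<Prod>A))\<^sup>2 < - D" using b by linarith
    moreover have "finite A" using A(1) fK finite_subset by blast
    ultimately show "n \<in> adm" unfolding A(3) using A(1) by (intro prod_inert_adm) auto
  qed
  then have "card ((\<lambda>A. \<Prod>A) ` ?S) \<le> card adm" using fin by (rule card_mono[rotated])
  then show ?thesis unfolding card_image[OF inj] n_subsets[OF fK] .
qed

text \<open>Taking the \<open>u\<close>-th root of \<open>(K / u) ^ u \<le> card adm\<close> bounds
  \<open>K\<close> by about \<open>2 powr (ell * (1/4 - \<epsilon>) / u)\<close>, and
  \<open>ell / u\<close> is at most about \<open>4 * j\<close>. That factor 4 uses up the exponent
  1/4 and leaves the saving \<open>4 * \<epsilon> * j\<close>.\<close>

lemma inert_dyadic:
  assumes fin: "finite adm" and \<epsilon>: "0 < \<epsilon>" "\<epsilon> \<le> 1 / 8" and r: "real (card adm) < 2 powr (ell * (1 / 4 - \<epsilon>))"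
    and j: "2 * real j + 4 < ell"
  shows "real (card {p. inert p \<and> 2 ^ j \<le> p \<and> p < 2 ^ Suc j}) / 2 ^ j \<le> 4 * ell * 2 powr (- 4 * \<epsilon> * real j)"
proof -
  define K where "K = card {p. inert p \<and> 2 ^ j \<le> p \<and> p < 2 ^ Suc j}"
  \<comment> \<open>The size condition for \<open>u\<close> factors below \<open>2 ^ (j + 1)\<close>
    is \<open>u < v\<close>; rounding up and subtracting 1 keeps this strict, and
    \<open>v > 1\<close> leaves \<open>u \<ge> 1\<close>.\<close>
  define v where "v = (ell - 2) / (2 * (real j + 1))"
  define u where "u = nat (\<lceil>v\<rceil> - 1)"
  have v1: "v > 1" using j by (simp add: v_def field_simps)
  then have u: "real u < v" "v \<le> real u + 1" "u \<ge> 1" unfolding u_def by linarith+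
  have ul: "2 + 2 * (real j + 1) * real u < ell" using u(1) by (simp add: v_def field_simps)
  have uh: "ell \<le> 2 * (real j + 1) * (real u + 1) + 2" using u(2) by (simp add: v_def field_simps)
  have ell0: "ell > 0" using j by simp
  have "2 powr (2 + 2 * (real j + 1) * real u) < 2 powr ell" using ul by simp
  moreover have "2 powr (2 + 2 * (real j + 1) * real u) = real_of_int (4 * ((2::int) ^ (Suc j * u))\<^sup>2)"
  proof -
    have "2 powr (2 + 2 * (real j + 1) * real u) = 2 powr real (2 + 2 * (Suc j * u))" by (simp add: algebra_simps)
    also have "\<dots> = 2 ^ (2 + 2 * (Suc j * u))" by (rule powr_realpow) simp
    also have "\<dots> = 4 * (2 ^ (Suc j * u))\<^sup>2" by (simp add: power_add power_mult[symmetric] mult.commute del: mult_Suc mult_Suc_right)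
    finally show ?thesis by simp
  qed
  ultimately have "real_of_int (4 * ((2::int) ^ (Suc j * u))\<^sup>2) < real_of_int (- D)" unfolding ell_powr by simp
  then have "4 * ((2::int) ^ (Suc j * u))\<^sup>2 < - D" by (simp only: of_int_less_iff)
  then have ch: "K choose u \<le> card adm" unfolding K_def by (rule inert_choose_le[OF fin])
  have uell: "real u \<le> ell"
  proof -
    have "real u * 1 \<le> real u * (real j + 1)" by (intro mult_left_mono) auto
    moreover have "0 \<le> real u * real j" by simp
    moreover have "2 * (real j + 1) * real u = 2 * (real u * (real j + 1))" by (simp add: algebra_simps)
    ultimately show ?thesis using ul by linarith
  qed
  have "real K \<le> 4 * ell * 2 powr ((1 - 4 * \<epsilon>) * real j)"
  proof (cases "u \<le> K")
    case True
    define y where "y = ell * (1 / 4 - \<epsilon>) / real u"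
    have "(real K / real u) ^ u \<le> real (K choose u)" using binomial_ge_n_over_k_pow_k[OF True] .
    also have "\<dots> < 2 powr (ell * (1 / 4 - \<epsilon>))" using ch r by linarith
    also have "ell * (1 / 4 - \<epsilon>) = y * real u" using u by (simp add: y_def)
    also have "2 powr (y * real u) = (2 powr y) ^ u" by (simp add: powr_powr[symmetric] powr_realpow)
    finally have "real K / real u < 2 powr y" by (rule power_less_imp_less_base) simp
    then have K: "real K < real u * 2 powr y" using u by (simp add: field_simps)
    have "ell \<le> (4 * (real j + 1) + 2) * real u"
    proof -
      \<comment> \<open>The rounding loss \<open>u + 1 \<le> 2 * u\<close> is worst for
        \<open>u = 1\<close>, that is, for primes just above the fourth root of
        \<open>- D\<close>.\<close>
      have "2 * (real j + 1) * (real u + 1) \<le> 2 * (real j + 1) * (2 * real u)" using u by (intro mult_left_mono) auto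
      then show ?thesis using uh u by (simp add: algebra_simps)
    qed
    then have "ell / real u \<le> 4 * (real j + 1) + 2" using u by (simp add: field_simps)
    then have "(ell / real u) * (1 / 4 - \<epsilon>) \<le> (4 * (real j + 1) + 2) * (1 / 4 - \<epsilon>)" using \<epsilon> by (intro mult_right_mono) auto
    moreover have "y = (ell / real u) * (1 / 4 - \<epsilon>)" by (simp add: y_def)
    moreover have "(4 * (real j + 1) + 2) * (1 / 4 - \<epsilon>) = (1 - 4 * \<epsilon>) * real j + (3 / 2 - 6 * \<epsilon>)"
      by (simp add: algebra_simps)
    ultimately have "y \<le> (1 - 4 * \<epsilon>) * real j + 2" using \<epsilon> by linarith
    then have "2 powr y \<le> 2 powr ((1 - 4 * \<epsilon>) * real j + 2)" by simp
    also have "\<dots> = 4 * 2 powr ((1 - 4 * \<epsilon>) * real j)" by (simp add: powr_add)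
    finally have "real u * 2 powr y \<le> ell * (4 * 2 powr ((1 - 4 * \<epsilon>) * real j))" using uell ell0 by (intro mult_mono) auto
    then show ?thesis using K by simp
  next
    case False
    then have "real K \<le> ell * 1" using uell by simp
    also have "\<dots> \<le> ell * (4 * 2 powr ((1 - 4 * \<epsilon>) * real j))"
    proof (rule mult_left_mono)
      have "(2::real) powr 0 \<le> 2 powr ((1 - 4 * \<epsilon>) * real j)" using \<epsilon> by (intro powr_mono) auto
      then show "1 \<le> 4 * (2::real) powr ((1 - 4 * \<epsilon>) * real j)" by simp
    qed (use ell0 in simp)
    finally show ?thesis by simp
  qed
  then have "real K / 2 ^ j \<le> 4 * ell * 2 powr ((1 - 4 * \<epsilon>) * real j) / 2 ^ j" by (intro divide_right_mono) auto
  also have "\<dots> = 4 * ell * (2 powr ((1 - 4 * \<epsilon>) * real j) / 2 powr real j)" by (simp add: powr_realpow)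
  also have "2 powr ((1 - 4 * \<epsilon>) * real j) / 2 powr real j = 2 powr (- 4 * \<epsilon> * real j)"
    unfolding powr_diff[symmetric] by (simp add: algebra_simps)
  finally show ?thesis unfolding K_def .
qed

lemma ramified_card: "real (card {p. prime p \<and> int p dvd D}) \<le> ell" and ramified_finite: "finite {p. prime p \<and> int p dvd D}"
proof -
  let ?A = "{p. prime p \<and> int p dvd D}"
  have "p \<le> nat (- D)" if "p \<in> ?A" for p
  proof -
    have "int p dvd - D" using that by simp
    then have "int p \<le> - D" using D by (intro zdvd_imp_le) auto
    then show ?thesis by simp
  qed
  then show f: "finite ?A" by (meson finite_atMost finite_subset atMost_iff subsetI)
  have "p dvd nat (- D)" if "p \<in> ?A" for p
  proof -
    have "int p dvd int (nat (- D))" using that D by simp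
    then show ?thesis by (simp only: int_dvd_int_iff)
  qed
  then have "\<Prod>?A dvd nat (- D)" by (intro prod_primes_dvd[OF f]) auto
  then have "\<Prod>?A \<le> nat (- D)" using D by (intro dvd_imp_le) auto
  moreover have "2 ^ card ?A \<le> \<Prod>?A"
    unfolding prod_constant[symmetric] by (intro prod_mono) (auto simp: prime_ge_2_nat)
  ultimately have "2 ^ card ?A \<le> nat (- D)" by linarith
  then have "real (2 ^ card ?A) \<le> real (nat (- D))" by (simp only: of_nat_le_iff)
  then have "2 ^ card ?A \<le> real_of_int (- D)" using D by simp
  then have "2 powr real (card ?A) \<le> 2 powr ell" unfolding ell_powr by (simp add: powr_realpow)
  then show "real (card ?A) \<le> ell" by simp
qed

text \<open>The summands stand for the inert primes up to about the square root of
  \<open>- D\<close>, in at most \<open>9 * ell\<close> blocks made small by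
  \<open>inert_dyadic\<close>; the other inert primes up to \<open>17 * H\<close>, in about
  \<open>log 2 ell\<close> blocks bounded by Chebyshev; and at most \<open>ell\<close> ramified
  primes, each at least \<open>ell ^ 4\<close>.\<close>

lemma bad_tail:
  assumes fin: "finite adm" and \<epsilon>: "0 < \<epsilon>" "\<epsilon> \<le> 1 / 8" and r: "real (card adm) < 2 powr (ell * (1 / 4 - \<epsilon>))"
    and ell: "ell > 16" and J: "ell powr (1 / \<epsilon>) \<le> 2 ^ J"
    and H: "real H \<le> 2 powr (ell / 2) * ell + 1"
  shows "(\<Sum>p\<in>{p. bad_prime D p \<and> 2 ^ J \<le> p \<and> p \<le> 17 * H}. 1 / real p) \<le>
     36 / ell\<^sup>2 + 4 * (log 2 ell + 10) / (ell - 4) + 1 / ell ^ 3"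
proof -
  \<comment> \<open>Chosen so that \<open>17 * H < 2 ^ b\<close>: the 6 comes from
    \<open>17 * H \<le> 34 * (2 powr (ell / 2) * ell)\<close> and 34 < 64.\<close>
  define b where "b = nat \<lceil>ell / 2 + log 2 ell + 6\<rceil>"
  have l0: "log 2 ell > 0" using ell by simp
  have b: "ell / 2 + log 2 ell + 6 \<le> real b" "real b \<le> ell / 2 + log 2 ell + 7"
    using l0 ell unfolding b_def by linarith+
  have "log 2 ell \<le> ell"
  proof -
    have "log 2 ell \<le> log 2 (2 powr ell)"
    proof (rule log_le_cancel_iff[THEN iffD2])
      show "ell \<le> 2 powr ell"
      proof -
        have "real (nat \<lfloor>ell\<rfloor>) + 1 \<le> 2 ^ nat \<lfloor>ell\<rfloor>"
        proof -
          have "nat \<lfloor>ell\<rfloor> < 2 ^ nat \<lfloor>ell\<rfloor>" by (rule less_exp)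
          then have "real (Suc (nat \<lfloor>ell\<rfloor>)) \<le> real (2 ^ nat \<lfloor>ell\<rfloor>)" by (simp only: of_nat_le_iff Suc_le_eq)
          then show ?thesis by simp
        qed
        moreover have "ell \<le> real (nat \<lfloor>ell\<rfloor>) + 1" using ell by linarith
        moreover have "(2::real) ^ nat \<lfloor>ell\<rfloor> \<le> 2 powr ell"
        proof -
          have "(2::real) powr real (nat \<lfloor>ell\<rfloor>) \<le> 2 powr ell" using ell by (intro powr_mono) auto
          then show ?thesis by (simp add: powr_realpow)
        qed
        ultimately show ?thesis by linarith
      qed
    qed (use ell in auto)
    then show ?thesis by simp
  qed
  then have b9: "real b \<le> 9 * ell" using b ell by linarith
  have "17 * real H < 2 ^ b"
  proof -
    have "1 \<le> 2 powr (ell / 2) * ell"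
    proof -
      have "(2::real) powr 0 * 1 \<le> 2 powr (ell / 2) * ell" using ell by (intro mult_mono powr_mono) auto
      then show ?thesis by simp
    qed
    then have "17 * real H \<le> 34 * (2 powr (ell / 2) * ell)" using H by linarith
    also have "\<dots> < 64 * (2 powr (ell / 2) * ell)" using ell by simp
    also have "\<dots> = 2 powr (ell / 2 + log 2 ell + 6)" using ell by (simp add: powr_add)
    also have "\<dots> \<le> 2 powr real b" using b by simp
    also have "\<dots> = 2 ^ b" by (simp add: powr_realpow)
    finally show ?thesis .
  qed
  then have Hb: "17 * H < 2 ^ b" by (metis of_nat_less_iff of_nat_mult of_nat_numeral of_nat_power)
  let ?I = "{p. inert p \<and> 2 ^ J \<le> p \<and> p < 2 ^ b}"
  let ?R = "{p. (prime p \<and> int p dvd D) \<and> 2 ^ J \<le> p}"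
  have fI: "finite ?I" by (rule finite_subset[of _ "{..<2 ^ b}"]) auto
  have fR: "finite ?R" by (rule finite_subset[OF _ ramified_finite]) auto
  have J1: "1 / 2 ^ J \<le> 1 / ell ^ 4"
  proof -
    have "8 \<le> 1 / \<epsilon>" using \<epsilon> by (simp add: field_simps)
    then have "ell powr 4 \<le> ell powr (1 / \<epsilon>)" using ell by (intro powr_mono) auto
    then have "ell ^ 4 \<le> 2 ^ J" using J ell by (simp add: powr_numeral)
    then show ?thesis using ell by (intro divide_left_mono) auto
  qed
  \<comment> \<open>Raising the hypothesis on \<open>J\<close> to the power
    \<open>4 * \<epsilon>\<close> yields \<open>ell ^ 4\<close>, which pays for the factor
    \<open>ell\<close> of \<open>inert_dyadic\<close> and for the number of blocks.\<close>
  have J2: "2 powr (- 4 * \<epsilon> * real j) \<le> 1 / ell ^ 4" if "J \<le> j" for j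
  proof -
    have "ell powr 4 = (ell powr (1 / \<epsilon>)) powr (4 * \<epsilon>)" using \<epsilon> by (simp add: powr_powr)
    also have "\<dots> \<le> (2 ^ J) powr (4 * \<epsilon>)" using J \<epsilon> by (intro powr_mono2) auto
    also have "\<dots> = 2 powr (4 * \<epsilon> * real J)" by (simp add: powr_realpow[symmetric] powr_powr mult.commute)
    also have "\<dots> \<le> 2 powr (4 * \<epsilon> * real j)" using that \<epsilon> by (intro powr_mono mult_left_mono) auto
    finally have "ell ^ 4 \<le> 2 powr (4 * \<epsilon> * real j)" using ell by (simp add: powr_numeral)
    then have "1 / 2 powr (4 * \<epsilon> * real j) \<le> 1 / ell ^ 4" using ell by (intro divide_left_mono) auto
    then show ?thesis by (simp add: powr_minus_divide)
  qed
  have "{p. bad_prime D p \<and> 2 ^ J \<le> p \<and> p \<le> 17 * H} \<subseteq> ?I \<union> ?R"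
  proof
    fix p assume p: "p \<in> {p. bad_prime D p \<and> 2 ^ J \<le> p \<and> p \<le> 17 * H}"
    then have bp: "prime p" "odd p" "p < 2 ^ b" "2 ^ J \<le> p" using Hb by (auto simp: bad_prime_def)
    have "jacobi D p = 0 \<or> jacobi D p = - 1" using p bad_prime_value by blast
    then show "p \<in> ?I \<union> ?R"
    proof
      assume "jacobi D p = 0"
      then have "Legendre D (int p) = 0" using jacobi_prime[OF bp(1), of D] by simp
      then have "int p dvd D" by (simp add: Legendre_eq_0_iff)
      then show ?thesis using bp by simp
    next
      assume "jacobi D p = - 1"
      then show ?thesis using bp by (simp add: inert_def)
    qed
  qed
  then have "(\<Sum>p\<in>{p. bad_prime D p \<and> 2 ^ J \<le> p \<and> p \<le> 17 * H}. 1 / real p) \<le> (\<Sum>p\<in>?I \<union> ?R. 1 / real p)"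
    using fI fR by (intro sum_mono2) auto
  also have "\<dots> \<le> (\<Sum>p\<in>?I. 1 / real p) + (\<Sum>p\<in>?R. 1 / real p)"
    using sum.union_inter[OF fI fR, of "\<lambda>p. 1 / real p"] sum_nonneg[of "?I \<inter> ?R" "\<lambda>p. 1 / real p"] by simp
  finally have split: "(\<Sum>p\<in>{p. bad_prime D p \<and> 2 ^ J \<le> p \<and> p \<le> 17 * H}. 1 / real p)
      \<le> (\<Sum>p\<in>?I. 1 / real p) + (\<Sum>p\<in>?R. 1 / real p)" .
  have R: "(\<Sum>p\<in>?R. 1 / real p) \<le> 1 / ell ^ 3"
  proof -
    have "(\<Sum>p\<in>?R. 1 / real p) \<le> (\<Sum>p\<in>?R. 1 / ell ^ 4)"
    proof (rule sum_mono)
      fix p assume "p \<in> ?R"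
      then have "2 ^ J \<le> p" "p > 0" by (auto simp: prime_gt_0_nat)
      then have "(2::real) ^ J \<le> real p" by (metis of_nat_le_iff of_nat_numeral of_nat_power)
      then have "1 / real p \<le> 1 / 2 ^ J" using \<open>p > 0\<close> by (intro divide_left_mono) auto
      then show "1 / real p \<le> 1 / ell ^ 4" using J1 by linarith
    qed
    also have "\<dots> = real (card ?R) * (1 / ell ^ 4)" by simp
    also have "\<dots> \<le> ell * (1 / ell ^ 4)"
    proof (rule mult_right_mono)
      have "card ?R \<le> card {p. prime p \<and> int p dvd D}" using ramified_finite by (intro card_mono) auto
      then show "real (card ?R) \<le> ell" using ramified_card by linarith
    qed (use ell in simp)
    also have "\<dots> = 1 / ell ^ 3" using ell by (simp add: field_simps eval_nat_numeral)
    finally show ?thesis .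
  qed
  have I: "(\<Sum>p\<in>?I. 1 / real p) \<le> 36 / ell\<^sup>2 + 4 * (log 2 ell + 10) / (ell - 4)"
  proof (cases "J \<le> b")
    case True
    define c where "c j = real (card {p. inert p \<and> 2 ^ j \<le> p \<and> p < 2 ^ Suc j}) / 2 ^ j" for j
    \<comment> \<open>The first block to which \<open>inert_dyadic\<close> does not apply.\<close>
    define j0 where "j0 = nat \<lceil>(ell - 4) / 2\<rceil>"
    have j0: "(ell - 4) / 2 \<le> real j0" "real j0 < (ell - 4) / 2 + 1" 
    proof -
      have "real j0 = of_int \<lceil>(ell - 4) / 2\<rceil>" using ell by (simp add: j0_def)
      then show "(ell - 4) / 2 \<le> real j0" "real j0 < (ell - 4) / 2 + 1"
        using ceiling_correct[of "(ell - 4) / 2"] by linarith+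
    qed
    have "c j \<le> (if j < j0 then 4 / ell ^ 3 else 0) + (if j0 \<le> j then 4 / (ell - 4) else 0)" if j: "J \<le> j" for j
    proof (cases "j < j0")
      case True
      then have "real j + 1 \<le> real j0" by linarith
      then have "real j + 1 < (ell - 4) / 2 + 1" using j0(2) by (rule le_less_trans)
      then have "2 * real j + 4 < ell" by (simp add: field_simps)
      then have "c j \<le> 4 * ell * 2 powr (- 4 * \<epsilon> * real j)" unfolding c_def by (rule inert_dyadic[OF fin \<epsilon> r])
      also have "\<dots> \<le> 4 * ell * (1 / ell ^ 4)" using ell J2[OF j] by (intro mult_left_mono) auto
      also have "\<dots> = 4 / ell ^ 3" using ell by (simp add: field_simps eval_nat_numeral)
      finally show ?thesis using True by simp
    next
      case False
      then have jr: "(ell - 4) / 2 \<le> real j" using j0 by linarith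
      then have jp: "j > 0" using ell by (cases j) auto
      have "c j \<le> 2 / real j" unfolding c_def using jp by (rule primes_dyadic_real) (auto simp: inert_def)
      also have "\<dots> \<le> 2 / ((ell - 4) / 2)" using jr ell jp by (intro divide_left_mono) auto
      finally show ?thesis using False by simp
    qed
    then have "(\<Sum>j\<in>{J..<b}. c j) \<le> (\<Sum>j\<in>{J..<b}. (if j < j0 then 4 / ell ^ 3 else 0) + (if j0 \<le> j then 4 / (ell - 4) else 0))"
      by (intro sum_mono) auto
    also have "\<dots> = (\<Sum>j\<in>{J..<b}. if j < j0 then 4 / ell ^ 3 else 0) + (\<Sum>j\<in>{J..<b}. if j0 \<le> j then 4 / (ell - 4) else 0)"
      by (rule sum.distrib)
    also have "\<dots> \<le> 36 / ell\<^sup>2 + 4 * (log 2 ell + 10) / (ell - 4)"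
    proof (rule add_mono)
      have "(\<Sum>j\<in>{J..<b}. if j < j0 then 4 / ell ^ 3 else 0) \<le> (\<Sum>j\<in>{J..<b}. 4 / ell ^ 3)"
        using ell by (intro sum_mono) auto
      also have "\<dots> = real (b - J) * (4 / ell ^ 3)" by simp
      also have "\<dots> \<le> (9 * ell) * (4 / ell ^ 3)" using b9 ell by (intro mult_right_mono) auto
      also have "\<dots> = 36 / ell\<^sup>2" using ell by (simp add: field_simps eval_nat_numeral)
      finally show "(\<Sum>j\<in>{J..<b}. if j < j0 then 4 / ell ^ 3 else 0) \<le> 36 / ell\<^sup>2" .
      have "(\<Sum>j\<in>{J..<b}. if j0 \<le> j then 4 / (ell - 4) else 0) = (\<Sum>j\<in>{j \<in> {J..<b}. j0 \<le> j}. 4 / (ell - 4))"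
        by (rule sum.inter_filter[symmetric]) simp
      also have "\<dots> \<le> (\<Sum>j\<in>{j0..<b}. 4 / (ell - 4))" using ell by (intro sum_mono2) auto
      also have "\<dots> = real (b - j0) * (4 / (ell - 4))" by simp
      also have "\<dots> \<le> (log 2 ell + 10) * (4 / (ell - 4))"
        using b j0 ell l0 by (intro mult_right_mono) (auto simp: of_nat_diff_real)
      finally show "(\<Sum>j\<in>{J..<b}. if j0 \<le> j then 4 / (ell - 4) else 0) \<le> 4 * (log 2 ell + 10) / (ell - 4)"
        by (simp add: mult.commute)
    qed
    finally show ?thesis using dyadic_sum[OF True, of inert] unfolding c_def by linarith
  next
    case False
    then have "(2::nat) ^ b \<le> 2 ^ J" by simp
    then have "p \<notin> ?I" for p by (simp only: mem_Collect_eq) linarith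
    then have "?I = {}" by blast
    then have "(\<Sum>p\<in>?I. 1 / real p) = 0" by (simp only: sum.empty)
    also have "0 \<le> 36 / ell\<^sup>2 + 4 * (log 2 ell + 10) / (ell - 4)"
      using ell l0 by (intro add_nonneg_nonneg divide_nonneg_nonneg) auto
    finally show ?thesis .
  qed
  show ?thesis using split R I by linarith
qed

text \<open>The lower and upper bounds of one character sum, divided by \<open>H\<^sup>2\<close>.
  The extra factor \<open>ell\<close> in \<open>H\<close> makes the Gauss sum term
  \<open>1 / ell\<close>, yet adds only about \<open>log 2 ell\<close> blocks beyond the square root
  of \<open>- D\<close>.\<close>

lemma counting_inequality:
  assumes fin: "finite adm" and \<epsilon>: "0 < \<epsilon>" "\<epsilon> \<le> 1 / 8" and r: "real (card adm) < 2 powr (ell * (1 / 4 - \<epsilon>))"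
    and D': "D = - (2 ^ e * int d')" "odd d'" "squarefree d'" "e \<le> 3"
    and ell: "ell > 16" "2 powr (ell / 2) * ell + 1 \<le> 2 powr ell / 8"
    and J: "J > 0" "ell powr (1 / \<epsilon>) \<le> 2 ^ J"
  shows "exp (- 6 * (1 + ln (real J))) \<le> 1 / ell
      + 17 * 2 powr (- (\<epsilon> * ell / 4)) * exp (10 * 2 powr (real J * (\<epsilon> / 2)) * (1 + ln (real J)))
      + 36 * (36 / ell\<^sup>2 + 4 * (log 2 ell + 10) / (ell - 4) + 1 / ell ^ 3)"
proof -
  define H where "H = nat \<lceil>2 powr (ell / 2) * ell\<rceil>"
  have X: "0 < 2 powr (ell / 2) * ell" using ell by simp
  then have H: "2 powr (ell / 2) * ell \<le> real H" "real H \<le> 2 powr (ell / 2) * ell + 1" unfolding H_def by linarith+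
  have Hpos: "real H > 0" "H > 0" using H X by linarith+
  \<comment> \<open>With \<open>2 ^ J\<close> near \<open>ell powr (1 / \<epsilon>)\<close>, the
    error product is the exponential of about \<open>sqrt ell\<close> up to logarithms, which the
    saving \<open>H powr (- (\<epsilon> / 2))\<close> still beats.\<close>
  define \<alpha> where "\<alpha> = 1 - \<epsilon> / 2"
  have \<alpha>: "1 / 2 \<le> \<alpha>" "\<alpha> \<le> 1" using \<epsilon> by (auto simp: \<alpha>_def)
  define B where "B = 36 / ell\<^sup>2 + 4 * (log 2 ell + 10) / (ell - 4) + 1 / ell ^ 3"
  define k where "k = exp (- 6 * (1 + ln (real J)))"
  define L where "L = exp (10 * 2 powr (real J * (\<epsilon> / 2)) * (1 + ln (real J)))"
  have dD: "real d' \<le> 2 powr ell" "2 powr ell \<le> 8 * real d'"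
  proof -
    have "real_of_int (- D) = 2 ^ e * real d'" by (simp add: D'(1))
    then have e: "(2 powr ell :: real) = 2 ^ e * real d'" using ell_powr by simp
    have "(1::real) \<le> 2 ^ e" by simp
    moreover have "(2::real) ^ e \<le> 2 ^ 3" using D'(4) by (intro power_increasing) auto
    ultimately have "1 * real d' \<le> 2 ^ e * real d'" "2 ^ e * real d' \<le> 2 ^ 3 * real d'"
      by (intro mult_right_mono; simp)+
    then show "real d' \<le> 2 powr ell" "2 powr ell \<le> 8 * real d'" unfolding e by auto
  qed
  \<comment> \<open>The diagonal argument for the Gauss sum needs \<open>H \<le> d'\<close>; the odd
    part is at least \<open>- D / 8\<close>.\<close>
  have "real H \<le> real d'" using H(2) ell(2) dD by linarith
  then have "H \<le> d'" by simp
  then have "\<bar>\<Sum>x\<in>{..<H} \<times> {..<H}. jacobi D (tent H x)\<bar> \<le> real H * sqrt (real d')"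
    using character_sum_upper[OF D'(1-3)] by simp
  also have "\<dots> \<le> real H * 2 powr (ell / 2)"
  proof (rule mult_left_mono)
    have "sqrt (real d') \<le> sqrt (2 powr ell)" using dD by simp
    also have "\<dots> = 2 powr (ell / 2)" by (simp add: powr_half_sqrt[symmetric] powr_powr)
    finally show "sqrt (real d') \<le> 2 powr (ell / 2)" .
  qed simp
  finally have up: "(\<Sum>x\<in>{..<H} \<times> {..<H}. real_of_int (jacobi D (tent H x))) \<le> real H * 2 powr (ell / 2)"
    by (simp add: abs_le_iff)
  define P1 where "P1 = (\<Prod>p\<in>{p. bad_prime D p \<and> p < 2 ^ J}. (1 - 1 / real p) / (1 + 1 / real p))"
  define P2 where "P2 = (\<Prod>p\<in>{p. bad_prime D p \<and> p < 2 ^ J}. (1 + real p powr (- \<alpha>)) / (1 - real p powr (- \<alpha>)))"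
  define T where "T = (\<Sum>p\<in>{p. bad_prime D p \<and> 2 ^ J \<le> p \<and> p \<le> 17 * H}. 1 / real p)"
  have low: "(real H)\<^sup>2 * P1 - 17 * real H powr (1 + \<alpha>) * P2 - 36 * (real H)\<^sup>2 * T
      \<le> (\<Sum>x\<in>{..<H} \<times> {..<H}. real_of_int (jacobi D (tent H x)))"
    unfolding P1_def P2_def T_def using character_sum_lower[OF Hpos(2), of \<alpha> D "2 ^ J"] \<alpha> by simp
  have P1: "k \<le> P1" unfolding k_def P1_def by (rule kappa_prod_ge[OF J(1)])
  have P2: "P2 \<le> L" unfolding L_def P2_def using lambda_prod_le[OF J(1) \<alpha>, of D] by (simp add: \<alpha>_def)
  have T: "T \<le> B" unfolding T_def B_def by (rule bad_tail[OF fin \<epsilon> r ell(1) J(2) H(2)])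
  have hp: "real H powr (1 + \<alpha>) = (real H)\<^sup>2 * real H powr (- (\<epsilon> / 2))"
  proof -
    have "1 + \<alpha> = 2 + - (\<epsilon> / 2)" by (simp add: \<alpha>_def)
    then have "real H powr (1 + \<alpha>) = real H powr 2 * real H powr (- (\<epsilon> / 2))" by (simp only: powr_add)
    then show ?thesis using Hpos by (simp add: powr_numeral)
  qed
  have h1: "2 powr (ell / 2) \<le> real H"
  proof -
    have "2 powr (ell / 2) * 1 \<le> 2 powr (ell / 2) * ell" using ell by (intro mult_left_mono) auto
    then show ?thesis using H by linarith
  qed
  have hs: "real H powr (- (\<epsilon> / 2)) \<le> 2 powr (- (\<epsilon> * ell / 4))"
  proof -
    have "(2 powr (ell / 2)) powr (\<epsilon> / 2) \<le> real H powr (\<epsilon> / 2)" using h1 \<epsilon> by (intro powr_mono2) auto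
    then have "2 powr (\<epsilon> * ell / 4) \<le> real H powr (\<epsilon> / 2)" by (simp add: powr_powr mult.commute)
    then have "1 / real H powr (\<epsilon> / 2) \<le> 1 / 2 powr (\<epsilon> * ell / 4)" using Hpos by (intro divide_left_mono) auto
    then show ?thesis by (simp add: powr_minus_divide)
  qed
  define s where "s = 2 powr (- (\<epsilon> * ell / 4))"
  have "(real H)\<^sup>2 * k \<le> (real H)\<^sup>2 * P1" using P1 by (intro mult_left_mono) auto
  moreover have "17 * real H powr (1 + \<alpha>) * P2 \<le> (real H)\<^sup>2 * (17 * s * L)"
  proof -
    have "17 * real H powr (1 + \<alpha>) * P2 \<le> 17 * real H powr (1 + \<alpha>) * L" using P2 by (intro mult_left_mono) auto
    also have "\<dots> = ((real H)\<^sup>2 * 17 * L) * real H powr (- (\<epsilon> / 2))" unfolding hp by (simp add: mult_ac)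
    also have "\<dots> \<le> ((real H)\<^sup>2 * 17 * L) * s" unfolding s_def using hs by (intro mult_left_mono) (auto simp: L_def)
    finally show ?thesis by (simp add: mult_ac)
  qed
  moreover have "36 * (real H)\<^sup>2 * T \<le> (real H)\<^sup>2 * (36 * B)" using T by (simp add: mult_left_mono)
  moreover have "real H * 2 powr (ell / 2) \<le> (real H)\<^sup>2 * (1 / ell)"
  proof -
    have "2 powr (ell / 2) \<le> real H * (1 / ell)" using H ell by (simp add: field_simps)
    then have "real H * 2 powr (ell / 2) \<le> real H * (real H * (1 / ell))" by (intro mult_left_mono) auto
    then show ?thesis by (simp add: power2_eq_square)
  qed
  ultimately have "(real H)\<^sup>2 * k \<le> (real H)\<^sup>2 * (1 / ell) + (real H)\<^sup>2 * (17 * s * L) + (real H)\<^sup>2 * (36 * B)"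
    using low up by linarith
  then have "(real H)\<^sup>2 * k \<le> (real H)\<^sup>2 * (1 / ell + 17 * s * L + 36 * B)" by (simp only: distrib_left)
  then have "k \<le> 1 / ell + 17 * s * L + 36 * B" using Hpos by (simp only: mult_le_cancel_left) auto
  then show ?thesis unfolding k_def s_def L_def B_def .
qed

end

section \<open>Asymptotics and conclusion\<close>

text \<open>With \<open>x\<close> the binary logarithm of |d|, the left side has order
  \<open>log x / x\<close>, the right side that of the power -6 of \<open>log x\<close>.\<close>

lemma eventually_counting_contradiction:
  fixes \<epsilon> :: real
  assumes "0 < \<epsilon>"
  shows "\<forall>\<^sub>F x in at_top. 1 / x
      + 17 * 2 powr (- (\<epsilon> * x / 4)) * exp (20 * sqrt x * (1 + ln (log 2 x / \<epsilon> + 1)))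
      + 36 * (36 / x\<^sup>2 + 4 * (log 2 x + 10) / (x - 4) + 1 / x ^ 3)
      < exp (- 6 * (1 + ln (log 2 x / \<epsilon> + 1)))"
  using assms by real_asymp

lemma eventually_length_small: "\<forall>\<^sub>F x in at_top. 2 powr (x / 2) * x + 1 \<le> 2 powr x / (8::real)"
  by real_asymp

theorem card_adm_lower:
  fixes \<epsilon> :: real
  assumes \<epsilon>: "0 < \<epsilon>" "\<epsilon> \<le> 1 / 8"
  shows "\<exists>d0::real. d0 \<ge> 4 \<and> (\<forall>d::int. negative_fundamental_discriminant d \<and> real_of_int \<bar>d\<bar> > d0 \<longrightarrow>
     real (card (imaginary_quadratic_order.adm d)) \<ge> real_of_int \<bar>d\<bar> powr (1 / 4 - \<epsilon>))"
proof -
  have "\<forall>\<^sub>F x in at_top. (16::real) < x" by (rule eventually_gt_at_top)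
  with eventually_counting_contradiction[OF \<epsilon>(1)] eventually_length_small
  have "\<forall>\<^sub>F x in at_top. 1 / x
      + 17 * 2 powr (- (\<epsilon> * x / 4)) * exp (20 * sqrt x * (1 + ln (log 2 x / \<epsilon> + 1)))
      + 36 * (36 / x\<^sup>2 + 4 * (log 2 x + 10) / (x - 4) + 1 / x ^ 3)
      < exp (- 6 * (1 + ln (log 2 x / \<epsilon> + 1))) \<and> 2 powr (x / 2) * x + 1 \<le> 2 powr x / (8::real) \<and> 16 < x"
    by eventually_elim blast
  then obtain N where N: "\<And>x. x \<ge> N \<Longrightarrow> 1 / x
      + 17 * 2 powr (- (\<epsilon> * x / 4)) * exp (20 * sqrt x * (1 + ln (log 2 x / \<epsilon> + 1)))
      + 36 * (36 / x\<^sup>2 + 4 * (log 2 x + 10) / (x - 4) + 1 / x ^ 3)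
      < exp (- 6 * (1 + ln (log 2 x / \<epsilon> + 1))) \<and> 2 powr (x / 2) * x + 1 \<le> 2 powr x / (8::real) \<and> 16 < x"
    unfolding eventually_at_top_linorder by blast
  show ?thesis
  proof (intro exI conjI allI impI)
    show "max 4 (2 powr N) \<ge> 4" by simp
    fix d :: int assume d: "negative_fundamental_discriminant d \<and> real_of_int \<bar>d\<bar> > max 4 (2 powr N)"
    then have dneg: "d < 0" by (simp add: negative_fundamental_discriminant_def)
    then have d4: "d < - 4" using d by simp
    interpret i: imaginary_quadratic_order d using fundamental_order(1) d d4 by blast
    define x where "x = i.ell"
    have px: "2 powr x = real_of_int \<bar>d\<bar>" using i.ell_powr dneg by (simp add: x_def)
    then have "2 powr N < 2 powr x" using d by simp
    then have "N \<le> x" by simp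
    from N[OF this] have x: "1 / x
      + 17 * 2 powr (- (\<epsilon> * x / 4)) * exp (20 * sqrt x * (1 + ln (log 2 x / \<epsilon> + 1)))
      + 36 * (36 / x\<^sup>2 + 4 * (log 2 x + 10) / (x - 4) + 1 / x ^ 3)
      < exp (- 6 * (1 + ln (log 2 x / \<epsilon> + 1)))" "2 powr (x / 2) * x + 1 \<le> 2 powr x / 8" "16 < x" by blast+
    obtain e d' where D': "d = - (2 ^ e * int d')" "odd d'" "squarefree d'" "e \<le> 3"
      using fundamental_odd_part[of d] d d4 by (metis le_refl numeral_le_iff semiring_norm(72) zero_le numeral_2_eq_2 numeral_3_eq_3 le_SucI)
    show "real_of_int \<bar>d\<bar> powr (1 / 4 - \<epsilon>) \<le> real (card i.adm)"
    proof (rule ccontr)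
      assume "\<not> ?thesis"
      then have r: "real (card i.adm) < 2 powr (i.ell * (1 / 4 - \<epsilon>))"
        unfolding px[symmetric] powr_powr by (simp add: x_def)
      define v where "v = log 2 x / \<epsilon>"
      have v: "v > 0" using x(3) \<epsilon> by (simp add: v_def)
      \<comment> \<open>The least \<open>J\<close> with
        \<open>x powr (1 / \<epsilon>) \<le> 2 ^ J\<close>. From \<open>J \<le> v + 1\<close> the
        power \<open>2 powr (J * (\<epsilon> / 2))\<close> is at most \<open>2 * sqrt x\<close>,
        which turns 10 into 20.\<close>
      define J where "J = nat \<lceil>v\<rceil>"
      have "real J = of_int \<lceil>v\<rceil>" using v by (simp add: J_def)
      then have J: "v \<le> real J" "real J \<le> v + 1" using ceiling_correct[of v] by linarith+
      have J0: "J > 0" using J v by (cases J) auto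
      have "x powr (1 / \<epsilon>) = 2 powr v" using x(3) by (simp add: v_def powr_def log_def)
      also have "\<dots> \<le> 2 powr real J" using J by simp
      also have "\<dots> = 2 ^ J" by (simp add: powr_realpow)
      finally have J1: "x powr (1 / \<epsilon>) \<le> 2 ^ J" .
      have "exp (- 6 * (1 + ln (real J))) \<le> 1 / x
        + 17 * 2 powr (- (\<epsilon> * x / 4)) * exp (10 * 2 powr (real J * (\<epsilon> / 2)) * (1 + ln (real J)))
        + 36 * (36 / x\<^sup>2 + 4 * (log 2 x + 10) / (x - 4) + 1 / x ^ 3)"
        using i.counting_inequality[OF i.finite_adm \<epsilon> r D'] x J0 J1 unfolding x_def by blast
      moreover have lnJ: "0 \<le> 1 + ln (real J)" "1 + ln (real J) \<le> 1 + ln (v + 1)"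
        using J0 J by (auto simp: add_nonneg_nonneg)
      then have "exp (- 6 * (1 + ln (v + 1))) \<le> exp (- 6 * (1 + ln (real J)))" by simp
      moreover have "exp (10 * 2 powr (real J * (\<epsilon> / 2)) * (1 + ln (real J))) \<le> exp (20 * sqrt x * (1 + ln (v + 1)))"
      proof -
        have "real J * (\<epsilon> / 2) \<le> (v + 1) * (\<epsilon> / 2)" using J \<epsilon> by (intro mult_right_mono) auto
        also have "\<dots> = log 2 x / 2 + \<epsilon> / 2" using \<epsilon> by (simp add: v_def field_simps)
        also have "\<dots> \<le> log 2 x / 2 + 1" using \<epsilon> by simp
        finally have "2 powr (real J * (\<epsilon> / 2)) \<le> 2 powr (log 2 x / 2 + 1)" by simp
        also have "\<dots> = 2 * 2 powr (log 2 x * (1 / 2))" by (simp add: powr_add)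
        also have "2 powr (log 2 x * (1 / 2)) = sqrt x" using x(3) unfolding powr_powr[symmetric] by (simp add: powr_half_sqrt)
        finally have "10 * 2 powr (real J * (\<epsilon> / 2)) * (1 + ln (real J)) \<le> 10 * (2 * sqrt x) * (1 + ln (v + 1))"
          using lnJ x(3) by (intro mult_mono) auto
        then show ?thesis by simp
      qed
      then have "17 * 2 powr (- (\<epsilon> * x / 4)) * exp (10 * 2 powr (real J * (\<epsilon> / 2)) * (1 + ln (real J)))
          \<le> 17 * 2 powr (- (\<epsilon> * x / 4)) * exp (20 * sqrt x * (1 + ln (v + 1)))" by (intro mult_left_mono) auto
      ultimately show False using x(1) unfolding v_def[symmetric] by linarith
    qed
  qed
qed

theorem corollary1:
  fixes \<epsilon> :: real
  assumes "\<epsilon> > 0"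
  shows "\<exists>d0::real. d0 > 0 \<and>
           (\<forall>d::int. negative_fundamental_discriminant d \<and> real_of_int \<bar>d\<bar> > d0 \<longrightarrow>
              (\<exists>(n::nat) \<phi>. real n \<ge> real_of_int \<bar>d\<bar> powr (1 / 4 - \<epsilon>) \<and>
                 \<phi> \<in> epi (Bianchi_group d) (free_group {..<n})))"
proof -
  \<comment> \<open>The count is available for losses up to 1/8; a smaller loss gives a larger power
    of |d|.\<close>
  define \<delta> where "\<delta> = min \<epsilon> (1 / 8)"
  have "0 < \<delta>" "\<delta> \<le> 1 / 8" "\<delta> \<le> \<epsilon>" using assms by (auto simp: \<delta>_def)
  then obtain d0 :: real where d0: "d0 \<ge> 4" "\<And>d::int. negative_fundamental_discriminant d \<Longrightarrow> real_of_int \<bar>d\<bar> > d0 \<Longrightarrow>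
     real (card (imaginary_quadratic_order.adm d)) \<ge> real_of_int \<bar>d\<bar> powr (1 / 4 - \<delta>)"
    using card_adm_lower[of \<delta>] by blast
  show ?thesis
  proof (intro exI[of _ d0] conjI allI impI)
    show "d0 > 0" using d0(1) by simp
    fix d :: int assume d: "negative_fundamental_discriminant d \<and> real_of_int \<bar>d\<bar> > d0"
    then have "d < 0" by (simp add: negative_fundamental_discriminant_def)
    then have d4: "d < - 4" using d d0(1) by simp
    interpret i: imaginary_quadratic_order d using fundamental_order(1) d d4 by blast
    obtain \<phi> where "\<phi> \<in> epi (Bianchi_group d) (free_group {..<card i.adm})"
      using i.Bianchi_group_free_quotient fundamental_order(2) d d4 by blast
    moreover have "real_of_int \<bar>d\<bar> powr (1 / 4 - \<epsilon>) \<le> real_of_int \<bar>d\<bar> powr (1 / 4 - \<delta>)"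
      using d4 \<open>\<delta> \<le> \<epsilon>\<close> by (intro powr_mono) auto
    then have "real_of_int \<bar>d\<bar> powr (1 / 4 - \<epsilon>) \<le> real (card i.adm)" using d0(2) d by fastforce
    ultimately show "\<exists>(n::nat) \<phi>. real n \<ge> real_of_int \<bar>d\<bar> powr (1 / 4 - \<epsilon>) \<and>
                 \<phi> \<in> epi (Bianchi_group d) (free_group {..<n})" by blast
  qed
qed

end
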